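(* Let \[ E_4(q)=1+240\sum_{n\ge1}\sigma_3(n)q^n . \] A formal power series $g(q)=q+\sum_{n\ge2} b_n q^n\in\mathbb{C}[[q]]$ has the property that both $g(q)$ and $E_4(q)g(q)$ are multiplicative (in the sense of the context) if and only if $g(q)$ is one of the following six series: \begin{itemize} \item $\Delta_{12}(q)=q-24q^2+252q^3-1472q^4+4830q^5+\cdots$; \item $\Delta_{16}(q)=q+216q^2-3348q^3+13888q^4+52110q^5+\cdots$; \item $\Delta_{18}(q)=q-528q^2-4284q^3+147712q^4-1025850q^5+\cdots$; \item $\Delta_{22}(q)=q-288q^2-128844q^3-2014208q^4+21640950q^5+\cdots$; \item $\varphi_8(q)=\eta(z)^8\eta(2z)^8=q-8q^2+12q^3+64q^4-210q^5+\cdots$; \item $\frac{1}{480\pi i}\frac{dE_4}{dz}(q)=q+18q^2+84q^3+292q^4+630q^5+\cdots$. \end{itemize} Here $\Delta_m$ is the unique normalized cusp form of level $1$ and weight $m$, $\eta(z)=q^{1/24}\prod_{n\ge1}(1-q^n)$ with $q=e^{2\pi i z}$, and $\varphi_8$ is the normalized cusp form of level $2$ and weight $8$.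
   Context: $\sigma_r(n)=\sum_{d\mid n}d^r$. A power series $a_0+a_1q+a_2q^2+\cdots$ with $a_1=1$ (here the series $g(q)=q+\sum_{n\ge 2}b_nq^n$, with $b_1=1$, and $E_4(q)g(q)=q+\sum_{n\ge2}c_nq^n$) is called multiplicative if its coefficients satisfy $a_{mn}=a_ma_n$ for all coprime positive integers $m,n$. The series are regarded as formal power series with complex coefficients, with $q=e^{2\pi i z}$ when interpreted as modular forms. *)

theory Defs
  imports "HOL-Complex_Analysis.Complex_Analysis"
begin

definition multiplicative_fps :: "complex fps \<Rightarrow> bool" where
  "multiplicative_fps F \<longleftrightarrow> fps_nth F 1 = 1 \<and>
     (\<forall>m n. m > 0 \<longrightarrow> n > 0 \<longrightarrow> coprime m n \<longrightarrow>
        fps_nth F (m * n) = fps_nth F m * fps_nth F n)"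

definition divisor_sigma :: "nat \<Rightarrow> nat \<Rightarrow> nat" where
  "divisor_sigma r n = (\<Sum>d | d dvd n. d ^ r)"

definition E4 :: "complex fps" where
  "E4 = Abs_fps (\<lambda>n. if n = 0 then 1 else 240 * of_nat (divisor_sigma 3 n))"

definition nome :: "complex \<Rightarrow> complex" where
  "nome z = exp (2 * of_real pi * \<i> * z)"

(* Functions on the upper half plane are total functions on the complex numbers;
   only their values at points with positive imaginary part are ever constrained. *)

definition upper_half_plane :: "complex set" where
  "upper_half_plane = {z. Im z > 0}"

definition has_q_expansion :: "(complex \<Rightarrow> complex) \<Rightarrow> complex fps \<Rightarrow> bool" where
  "has_q_expansion f F \<longleftrightarrow>
     (\<forall>z\<in>upper_half_plane. (\<lambda>n. fps_nth F n * nome z ^ n) sums f z)"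

(* Meaningful for functions possessing a q-expansion, which is then unique. *)
definition q_expansion :: "(complex \<Rightarrow> complex) \<Rightarrow> complex fps" where
  "q_expansion f = (THE F. has_q_expansion f F)"

(* Cusp forms of weight k for Gamma_0(N).  Every cusp is of the form A(infinity) with A in
   SL_2(Z), so vanishing at all cusps means that each slash f |_k A, with A ranging over the
   whole of SL_2(Z), tends to 0 as Im z tends to infinity (uniformly in Re z). *)
definition cusp_form :: "nat \<Rightarrow> nat \<Rightarrow> (complex \<Rightarrow> complex) \<Rightarrow> bool" where
  "cusp_form N k f \<longleftrightarrow>
     f holomorphic_on upper_half_plane \<and>
     (\<forall>a b c d :: int. a * d - b * c = 1 \<longrightarrow> int N dvd c \<longrightarrow>
        (\<forall>z\<in>upper_half_plane.
           f ((of_int a * z + of_int b) / (of_int c * z + of_int d)) =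
             (of_int c * z + of_int d) ^ k * f z)) \<and>
     (\<forall>a b c d :: int. a * d - b * c = 1 \<longrightarrow>
        ((\<lambda>z. f ((of_int a * z + of_int b) / (of_int c * z + of_int d)) /
              (of_int c * z + of_int d) ^ k) \<longlongrightarrow> 0) (filtercomap Im at_top))"

definition normalized_cusp_series :: "nat \<Rightarrow> nat \<Rightarrow> complex fps \<Rightarrow> bool" where
  "normalized_cusp_series N k F \<longleftrightarrow>
     fps_nth F 1 = 1 \<and> (\<exists>f. cusp_form N k f \<and> has_q_expansion f F)"

(* Meaningful only for weights with exactly one normalized cusp form of level 1. *)
definition Delta :: "nat \<Rightarrow> complex fps" where
  "Delta k = (THE F. normalized_cusp_series 1 k F)"

(* The factor q^(1/24) is exp (2 pi i z / 24), not a principal power of q. *)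
definition dedekind_eta :: "complex \<Rightarrow> complex" where
  "dedekind_eta z = nome (z / 24) * (\<Prod>n. 1 - nome z ^ Suc n)"

definition phi8 :: "complex fps" where
  "phi8 = q_expansion (\<lambda>z. dedekind_eta z ^ 8 * dedekind_eta (2 * z) ^ 8)"

definition E4_deriv_series :: "complex fps" where
  "E4_deriv_series =
     q_expansion (\<lambda>z. 1 / (480 * of_real pi * \<i>) * deriv (\<lambda>w. eval_fps E4 (nome w)) z)"

end

theory Submission
  imports Defs "HOL-Number_Theory.Cong"
begin

text \<open>
  Write \<open>b\<^sub>n\<close> for the coefficients of \<open>g\<close>. Multiplicativity of \<open>g\<close> and \<open>E\<^sub>4 g\<close> amounts to polynomial relations
  between the \<open>b\<^sub>n\<close>. Linear elimination in the relations of index at most 66, carried out with rational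
  coefficients of denominator prime to 19 of which only the residues modulo 19 are recorded, shows that on
  the set of solutions \<open>b\<^sub>2\<^sup>6\<close>, \<open>b\<^sub>3\<close>, \<open>b\<^sub>4\<close>, \<open>b\<^sub>7\<close> and \<open>b\<^sub>8\<close> are fixed linear combinations of \<open>1, b\<^sub>2, \<dots>, b\<^sub>2\<^sup>5\<close>.
  So \<open>b\<^sub>2\<close> is a root of a fixed polynomial of degree 6, whose roots are the values of \<open>b\<^sub>2\<close> for the six series, and
  \<open>b\<^sub>2\<close> determines \<open>b\<^sub>3\<close>, \<open>b\<^sub>4\<close>, \<open>b\<^sub>7\<close>, \<open>b\<^sub>8\<close>. These determine \<open>g\<close>, since \<open>n\<close> and \<open>n + 1\<close> are both prime
  powers only if one of them is a power of 2.

  Conversely, the series are Hecke eigenforms. The only analytic input on modular forms is the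
  transformation of \<open>E\<^sub>2\<close> under \<open>z \<mapsto> -1/z\<close>, obtained by exchanging the order of a conditionally convergent double
  series. It gives the transformation of \<open>\<eta>\<^sup>8\<close>, hence the nowhere vanishing forms \<open>\<Delta>\<close> and \<open>\<phi>\<^sub>8\<close>, and with
  Ramanujan's differential equations \<open>E\<^sub>4\<close> and \<open>E\<^sub>6\<close>. By the maximum modulus principle modular functions without
  poles are constant, so that a modular form is determined by its first coefficients; this yields the
  Hecke eigenvalues, \<open>E\<^sub>4 \<Delta>\<^sub>1\<^sub>2 = \<Delta>\<^sub>1\<^sub>6\<close> and its analogues, and \<open>E\<^sub>4(z) \<phi>\<^sub>8(z) = \<Delta>(z) + 256 \<Delta>(2z)\<close>.
\<close>

subsection \<open>Elimination in the coefficient relations\<close>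

text \<open>The two directions of the theorem are not independent. The elimination shows only that
  some polynomial of degree 6 annihilates b_2 for every solution; its coefficients are never
  computed. That the six series are solutions supplies six distinct roots, and these identify all
  possible b_2. In the same way the polynomials that express b_3, b_4, b_7, b_8 in terms of b_2 are
  used only through their existence: a solution that shares b_2 with one of the six series agrees
  with it there as well. This is why residues suffice. A pivot with nonzero residue is a nonzero
  number, so each step is valid over the rationals, while the true coefficients stay existentially
  quantified.

  On the analytic side the obstacle is phi_8, which has level 2. Carrying along all translates of a
  form lets one compactness argument serve both levels, without a fundamental domain for a
  subgroup.\<close>

text \<open>A rational number without 19 in its denominator, and its residue.\<close>

definition cong19 :: "complex \<Rightarrow> int \<Rightarrow> bool" where
  "cong19 r c \<longleftrightarrow> (\<exists>a b. r * of_int b = of_int a \<and> \<not> 19 dvd b \<and> 19 dvd (a - c * b))"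

lemma prime_19: "prime (19::int)"
  by (simp add: prime_int_numeral_eq)

lemma cong19_of_int: "19 dvd (a - c) \<Longrightarrow> cong19 (of_int a) c"
  unfolding cong19_def by (rule exI[of _ a], rule exI[of _ 1]) auto

lemma cong19_add:
  assumes "cong19 r c" "cong19 s d" "19 dvd (e - (c + d))"
  shows "cong19 (r + s) e"
proof -
  obtain a b where 1: "r * of_int b = of_int a" "\<not> 19 dvd b" "19 dvd (a - c * b)"
    using assms(1) unfolding cong19_def by blast
  obtain a' b' where 2: "s * of_int b' = of_int a'" "\<not> 19 dvd b'" "19 dvd (a' - d * b')"
    using assms(2) unfolding cong19_def by blast
  have "(r + s) * of_int (b * b') = (r * of_int b) * of_int b' + (s * of_int b') * of_int b"
    by (simp add: algebra_simps)
  also have "\<dots> = of_int (a * b' + a' * b)" using 1 2 by simp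
  finally have A: "(r + s) * of_int (b * b') = of_int (a * b' + a' * b)" .
  have "a * b' + a' * b - e * (b * b') = (a - c * b) * b' + (a' - d * b') * b - (e - (c + d)) * (b * b')"
    by (simp add: algebra_simps)
  hence "19 dvd (a * b' + a' * b - e * (b * b'))" using 1 2 assms(3) by simp
  moreover have "\<not> 19 dvd b * b'" using 1 2 prime_dvd_mult_iff[OF prime_19] by blast
  ultimately show ?thesis using A unfolding cong19_def by blast
qed

lemma cong19_mult:
  assumes "cong19 r c" "cong19 s d" "19 dvd (e - c * d)"
  shows "cong19 (r * s) e"
proof -
  obtain a b where 1: "r * of_int b = of_int a" "\<not> 19 dvd b" "19 dvd (a - c * b)"
    using assms(1) unfolding cong19_def by blast
  obtain a' b' where 2: "s * of_int b' = of_int a'" "\<not> 19 dvd b'" "19 dvd (a' - d * b')"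
    using assms(2) unfolding cong19_def by blast
  have "(r * s) * of_int (b * b') = (r * of_int b) * (s * of_int b')"
    by (simp add: algebra_simps)
  also have "\<dots> = of_int (a * a')" using 1 2 by simp
  finally have A: "(r * s) * of_int (b * b') = of_int (a * a')" .
  have "a * a' - e * (b * b') = (a - c * b) * a' + (a' - d * b') * (c * b) - (e - c * d) * (b * b')"
    by (simp add: algebra_simps)
  hence "19 dvd (a * a' - e * (b * b'))" using 1 2 assms(3) by simp
  moreover have "\<not> 19 dvd b * b'" using 1 2 prime_dvd_mult_iff[OF prime_19] by blast
  ultimately show ?thesis using A unfolding cong19_def by blast
qed

text \<open>An invertible residue certifies that the true number is nonzero and that its inverse
  again has a denominator prime to 19. This licenses division by a pivot of which only the residue
  is known.\<close>

lemma cong19_inverse: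
  assumes "cong19 r c" "19 dvd (c * d - 1)"
  shows "r \<noteq> 0" "cong19 (inverse r) d"
proof -
  obtain a b where 1: "r * of_int b = of_int a" "\<not> 19 dvd b" "19 dvd (a - c * b)"
    using assms(1) unfolding cong19_def by blast
  have "19 dvd (c * d - 1) * b + (a - c * b) * d" using 1 assms(2) by (intro dvd_add) auto
  hence 2: "19 dvd (a * d - b)" by (simp add: algebra_simps)
  have na: "\<not> 19 dvd a"
  proof
    assume "19 dvd a"
    hence "19 dvd a * d - (a * d - b)" using 2 dvd_diff dvd_mult2 by blast
    moreover have "a * d - (a * d - b) = b" by simp
    ultimately show False using 1 by metis
  qed
  hence "a \<noteq> 0" by auto
  hence r: "r \<noteq> 0" using 1 by auto
  thus "r \<noteq> 0" .
  have "inverse r * of_int a = of_int b" using 1(1) r by (simp add: field_simps)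
  moreover have "19 dvd (b - d * a)" using 2 by (metis dvd_minus_iff minus_diff_eq mult.commute)
  ultimately show "cong19 (inverse r) d" using na unfolding cong19_def by blast
qed

section \<open>The relations between the coefficients of a solution\<close>

definition twin_multiplicative :: "complex fps \<Rightarrow> bool" where
  "twin_multiplicative g \<longleftrightarrow> fps_nth g 0 = 0 \<and> multiplicative_fps g \<and> multiplicative_fps (E4 * g)"

text \<open>The coefficient of \<open>(E4 - 1) / 240 * g\<close> at q^n when b_0 = 0. Its last term
  is b_{n-1} with factor 1, so a relation of index n can be solved for b_{n-1}.\<close>

definition sigma_conv :: "complex fps \<Rightarrow> nat \<Rightarrow> complex" where
  "sigma_conv g n = (\<Sum>j=1..<n. of_nat (divisor_sigma 3 (n - j)) * fps_nth g j)"

lemma fps_nth_E4_mult: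
  assumes "fps_nth g 0 = 0"
  shows "fps_nth (E4 * g) n = fps_nth g n + 240 * sigma_conv g n"
proof (cases "n = 0")
  case True
  thus ?thesis using assms by (simp add: sigma_conv_def fps_mult_nth)
next
  case False
  have "fps_nth (E4 * g) n = (\<Sum>i=0..n. fps_nth g i * fps_nth E4 (n - i))"
    by (subst mult.commute) (simp add: fps_mult_nth)
  also have "{0..n} = insert 0 (insert n {1..<n})" using False by auto
  also have "(\<Sum>i\<in>\<dots>. fps_nth g i * fps_nth E4 (n - i)) =
     fps_nth g n + (\<Sum>i=1..<n. fps_nth g i * fps_nth E4 (n - i))"
    using assms False by (simp add: E4_def)
  also have "(\<Sum>i=1..<n. fps_nth g i * fps_nth E4 (n - i)) = 240 * sigma_conv g n"
    unfolding sigma_conv_def sum_distrib_left by (intro sum.cong) (auto simp: E4_def)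
  finally show ?thesis .
qed

text \<open>The relation of index a c: multiplicativity of \<open>E4 * g\<close> minus that of
  \<open>g\<close>, divided by 240. Its left side involves only b_j with j < a c.\<close>

lemma sigma_conv_mult:
  assumes "twin_multiplicative g" "a > 0" "c > 0" "coprime a c"
  shows "sigma_conv g (a * c) = fps_nth g a * sigma_conv g c +
           sigma_conv g a * (fps_nth g c + 240 * sigma_conv g c)"
proof -
  have g0: "fps_nth g 0 = 0" using assms(1) by (simp add: twin_multiplicative_def)
  have "fps_nth (E4 * g) (a * c) = fps_nth (E4 * g) a * fps_nth (E4 * g) c"
    "fps_nth g (a * c) = fps_nth g a * fps_nth g c"
    using assms by (auto simp: twin_multiplicative_def multiplicative_fps_def)
  hence "240 * sigma_conv g (a * c) = 240 * (fps_nth g a * sigma_conv g c +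
           sigma_conv g a * (fps_nth g c + 240 * sigma_conv g c))"
    unfolding fps_nth_E4_mult[OF g0] by (simp add: algebra_simps)
  thus ?thesis by (subst (asm) mult_cancel_left) simp
qed

text \<open>Seven coefficients \<open>b\<^sub>i\<close> serve as variables; each is represented by a prime, and a monomial by the product
  of its primes. Monomials are thus integers, multiplied as such. The other \<open>b\<^sub>n\<close> with \<open>n\<close> at most 65 are
  integral polynomials in these: \<open>n\<close> or \<open>n + 1\<close> is a product of two coprime factors.\<close>

definition var_index :: "(int \<times> int) list" where
  "var_index = [(2,2),(3,3),(5,4),(7,7),(11,8),(19,16),(29,31)]"

text \<open>The defaults 0 and 1 make this total, while it stays completely multiplicative on the
  positive integers.\<close>

definition coeff_monomial :: "complex fps \<Rightarrow> int \<Rightarrow> complex" where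
  "coeff_monomial g k = (if k \<le> 0 then 0 else
     (\<Prod>q\<in>#prime_factorization k. case map_of var_index q of None \<Rightarrow> 1 | Some i \<Rightarrow> fps_nth g (nat i)))"

lemma coeff_monomial_mult:
  assumes "k > 0" "l > 0"
  shows "coeff_monomial g (k * l) = coeff_monomial g k * coeff_monomial g l"
  using assms by (auto simp: coeff_monomial_def mult_le_0_iff prime_factorization_mult)

lemma coeff_monomial_1: "coeff_monomial g 1 = 1"
  by (simp add: coeff_monomial_def)

lemma coeff_monomial_var:
  assumes "(q, i) \<in> set var_index"
  shows "coeff_monomial g q = fps_nth g (nat i)"
proof -
  have "prime q" using assms by (auto simp: var_index_def prime_int_numeral_eq)
  moreover have "map_of var_index q = Some i"
    using assms by (auto simp: var_index_def)
  ultimately show ?thesis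
    by (auto simp: coeff_monomial_def prime_factorization_prime dest: prime_gt_0_int)
qed

type_synonym residue_poly = "(int \<times> int) list"

text \<open>The residues in the list determine the true coefficients only modulo 19. Hence monomials with residue 0
  must be kept, and a monomial can be eliminated only if its residue is nonzero. The modulus 19 works because the six
  values of \<open>b\<^sub>2\<close> are distinct modulo 19, so that powers of \<open>b\<^sub>2\<close> remain linearly independent.\<close>

fun represents :: "(complex fps \<Rightarrow> complex) \<Rightarrow> residue_poly \<Rightarrow> bool" where
  "represents f [] \<longleftrightarrow> (\<forall>g. twin_multiplicative g \<longrightarrow> f g = 0)"
| "represents f ((k, c) # P) \<longleftrightarrow>
     k > 0 \<and> (\<exists>r. cong19 r c \<and> represents (\<lambda>g. f g - r * coeff_monomial g k) P)"

lemma represents_cong: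
  "(\<And>g. twin_multiplicative g \<Longrightarrow> f g = h g) \<Longrightarrow> represents f P = represents h P"
proof (induction P arbitrary: f h)
  case (Cons a P)
  obtain k c where a: "a = (k, c)" by force
  have "represents (\<lambda>g. f g - r * coeff_monomial g k) P = represents (\<lambda>g. h g - r * coeff_monomial g k) P" for r
    by (rule Cons.IH) (simp add: Cons.prems)
  thus ?case by (simp add: a)
qed auto

text \<open>On lists sorted by monomial this merge collects equal monomials. On other lists it
  merely may leave them apart, so sortedness is never part of an invariant.\<close>

fun rp_add :: "residue_poly \<Rightarrow> residue_poly \<Rightarrow> residue_poly" where
  "rp_add [] Q = Q"
| "rp_add ((k, c) # P) [] = (k, c) # P"
| "rp_add ((k, c) # P) ((l, d) # Q) =
     (if k < l then (k, c) # rp_add P ((l, d) # Q)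
      else if l < k then (l, d) # rp_add ((k, c) # P) Q
      else (k, (c + d) mod 19) # rp_add P Q)"

lemma represents_add:
  "represents f P \<Longrightarrow> represents h Q \<Longrightarrow> represents (\<lambda>g. f g + h g) (rp_add P Q)"
proof (induction P Q arbitrary: f h rule: rp_add.induct)
  case (1 Q)
  thus ?case using represents_cong[of "\<lambda>g. f g + h g" h Q] by simp
next
  case (2 k c P)
  have "represents (\<lambda>g. f g + h g) ((k, c) # P) = represents f ((k, c) # P)"
    using 2 by (intro represents_cong) simp
  thus ?case using 2 by simp
next
  case (3 k c P l d Q)
  from 3(4) obtain r where r: "k > 0" "cong19 r c" "represents (\<lambda>g. f g - r * coeff_monomial g k) P" by auto
  from 3(5) obtain s where s: "l > 0" "cong19 s d" "represents (\<lambda>g. h g - s * coeff_monomial g l) Q" by auto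
  show ?case
  proof (cases "k < l")
    case True
    have "represents (\<lambda>g. (f g - r * coeff_monomial g k) + h g) (rp_add P ((l, d) # Q))"
      using 3(1)[OF True r(3) 3(5)] .
    hence "represents (\<lambda>g. (f g + h g) - r * coeff_monomial g k) (rp_add P ((l, d) # Q))"
      by (simp add: algebra_simps)
    thus ?thesis using True r by auto
  next
    case F: False
    show ?thesis
    proof (cases "l < k")
      case True
      have "represents (\<lambda>g. f g + (h g - s * coeff_monomial g l)) (rp_add ((k, c) # P) Q)"
        using 3(2)[OF F True 3(4) s(3)] .
      hence "represents (\<lambda>g. (f g + h g) - s * coeff_monomial g l) (rp_add ((k, c) # P) Q)"
        by (simp add: algebra_simps)
      thus ?thesis using True F s by auto
    next
      case False
      hence kl: "k = l" using F by simp
      have "represents (\<lambda>g. (f g - r * coeff_monomial g k) + (h g - s * coeff_monomial g l)) (rp_add P Q)"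
        using 3(3)[OF F False r(3) s(3)] .
      hence "represents (\<lambda>g. (f g + h g) - (r + s) * coeff_monomial g k) (rp_add P Q)"
        by (simp add: algebra_simps kl)
      moreover have "cong19 (r + s) ((c + d) mod 19)"
        by (rule cong19_add[OF r(2) s(2)]) (metis mod_eq_dvd_iff mod_mod_trivial)
      ultimately show ?thesis using F False r by auto
    qed
  qed
qed

fun rp_scale :: "int \<Rightarrow> residue_poly \<Rightarrow> residue_poly" where
  "rp_scale a [] = []"
| "rp_scale a ((k, c) # P) = (k, (a * c) mod 19) # rp_scale a P"

lemma represents_scale:
  "cong19 u a \<Longrightarrow> represents f P \<Longrightarrow> represents (\<lambda>g. u * f g) (rp_scale a P)"
proof (induction P arbitrary: f rule: rp_scale.induct)
  case (2 a k c P)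
  then obtain r where r: "k > 0" "cong19 r c" "represents (\<lambda>g. f g - r * coeff_monomial g k) P" by auto
  have "represents (\<lambda>g. u * (f g - r * coeff_monomial g k)) (rp_scale a P)" using 2 r by blast
  hence "represents (\<lambda>g. u * f g - (u * r) * coeff_monomial g k) (rp_scale a P)"
    by (simp add: algebra_simps)
  moreover have "cong19 (u * r) ((a * c) mod 19)"
    by (rule cong19_mult[OF 2(2) r(2)]) (metis mod_eq_dvd_iff mod_mod_trivial)
  ultimately show ?case using r by auto
qed auto

fun rp_shift :: "int \<Rightarrow> int \<Rightarrow> residue_poly \<Rightarrow> residue_poly" where
  "rp_shift l a [] = []"
| "rp_shift l a ((k, c) # P) = (l * k, (a * c) mod 19) # rp_shift l a P"

lemma represents_shift:
  "cong19 u a \<Longrightarrow> l > 0 \<Longrightarrow> represents f P \<Longrightarrow>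
     represents (\<lambda>g. (u * coeff_monomial g l) * f g) (rp_shift l a P)"
proof (induction P arbitrary: f rule: rp_shift.induct)
  case (2 l a k c P)
  then obtain r where r: "k > 0" "cong19 r c" "represents (\<lambda>g. f g - r * coeff_monomial g k) P" by auto
  have "represents (\<lambda>g. (u * coeff_monomial g l) * (f g - r * coeff_monomial g k)) (rp_shift l a P)"
    using 2 r by blast
  moreover have "(\<lambda>g. (u * coeff_monomial g l) * (f g - r * coeff_monomial g k)) =
     (\<lambda>g. (u * coeff_monomial g l) * f g - (u * r) * coeff_monomial g (l * k))"
    using 2 r by (auto simp: algebra_simps coeff_monomial_mult)
  moreover have "cong19 (u * r) ((a * c) mod 19)"
    by (rule cong19_mult[OF 2(2) r(2)]) (metis mod_eq_dvd_iff mod_mod_trivial)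
  ultimately show ?case using r 2 by auto
qed auto

fun rp_mult :: "residue_poly \<Rightarrow> residue_poly \<Rightarrow> residue_poly" where
  "rp_mult [] Q = []"
| "rp_mult ((k, c) # P) Q = rp_add (rp_shift k c Q) (rp_mult P Q)"

lemma represents_mult:
  "represents f P \<Longrightarrow> represents h Q \<Longrightarrow> represents (\<lambda>g. f g * h g) (rp_mult P Q)"
proof (induction P Q arbitrary: f rule: rp_mult.induct)
  case (2 k c P Q)
  then obtain r where r: "k > 0" "cong19 r c" "represents (\<lambda>g. f g - r * coeff_monomial g k) P" by auto
  have "represents (\<lambda>g. (r * coeff_monomial g k) * h g + (f g - r * coeff_monomial g k) * h g)
          (rp_add (rp_shift k c Q) (rp_mult P Q))"
    by (intro represents_add represents_shift 2 r)
  thus ?case by (simp add: algebra_simps)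
qed auto

fun rp_extract :: "int \<Rightarrow> residue_poly \<Rightarrow> (int \<times> residue_poly) option" where
  "rp_extract m [] = None"
| "rp_extract m ((k, c) # P) = (if k = m then Some (c, P) else
     (case rp_extract m P of None \<Rightarrow> None | Some (a, Q) \<Rightarrow> Some (a, (k, c) # Q)))"

lemma represents_extract:
  "represents f P \<Longrightarrow> rp_extract m P = Some (a, Q) \<Longrightarrow>
     m > 0 \<and> (\<exists>r. cong19 r a \<and> represents (\<lambda>g. f g - r * coeff_monomial g m) Q)"
proof (induction m P arbitrary: f Q rule: rp_extract.induct)
  case (2 m k c P)
  show ?case
  proof (cases "k = m")
    case True
    thus ?thesis using 2 by auto
  next
    case False
    then obtain Q' where Q': "rp_extract m P = Some (a, Q')" "Q = (k, c) # Q'"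
      using 2(3) by (auto split: option.splits)
    from 2 obtain r where r: "k > 0" "cong19 r c" "represents (\<lambda>g. f g - r * coeff_monomial g k) P" by auto
    from 2(1)[OF False r(3) Q'(1)] obtain s where
      "m > 0" "cong19 s a" "represents (\<lambda>g. f g - r * coeff_monomial g k - s * coeff_monomial g m) Q'" by auto
    moreover from this have "represents (\<lambda>g. f g - s * coeff_monomial g m - r * coeff_monomial g k) Q'"
      by (simp add: algebra_simps)
    ultimately show ?thesis using r Q' by auto
  qed
qed auto

definition rp_subst :: "int \<Rightarrow> residue_poly \<Rightarrow> residue_poly \<Rightarrow> residue_poly" where
  "rp_subst m R P = (case rp_extract m P of None \<Rightarrow> P | Some (a, Q) \<Rightarrow> rp_add Q (rp_scale a R))"

lemma represents_subst:
  assumes "represents f P" "represents (\<lambda>g. coeff_monomial g m) R"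
  shows "represents f (rp_subst m R P)"
proof (cases "rp_extract m P")
  case None
  thus ?thesis using assms by (simp add: rp_subst_def)
next
  case (Some z)
  then obtain a Q where z: "rp_extract m P = Some (a, Q)" by (cases z) auto
  from represents_extract[OF assms(1) z] obtain r where
    r: "cong19 r a" "represents (\<lambda>g. f g - r * coeff_monomial g m) Q" by auto
  have "represents (\<lambda>g. (f g - r * coeff_monomial g m) + r * coeff_monomial g m) (rp_add Q (rp_scale a R))"
    by (intro represents_add represents_scale r assms)
  thus ?thesis using z by (simp add: rp_subst_def)
qed

section \<open>Rewriting rules and Gauss-Jordan elimination\<close>

type_synonym rule_list = "(int \<times> residue_poly) list"

definition rules_ok :: "rule_list \<Rightarrow> bool" where
  "rules_ok rs \<longleftrightarrow> (\<forall>(m, R)\<in>set rs. m > 0 \<and> represents (\<lambda>g. coeff_monomial g m) R)"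

text \<open>One pass suffices for sorted lists, since \<open>insert_row\<close> keeps the system
  reduced: no right-hand side contains the monomial of another rule.\<close>

fun rp_reduce :: "rule_list \<Rightarrow> residue_poly \<Rightarrow> residue_poly" where
  "rp_reduce [] P = P"
| "rp_reduce ((m, R) # rs) P = rp_reduce rs (rp_subst m R P)"

lemma represents_reduce: "rules_ok rs \<Longrightarrow> represents f P \<Longrightarrow> represents f (rp_reduce rs P)"
  by (induction rs P rule: rp_reduce.induct) (auto simp: rules_ok_def intro: represents_subst)

text \<open>The last admissible monomial is the largest in a sorted list, so the size of the integer
  serves as the monomial order. Residue 0 is excluded because the true coefficient may vanish; 1, 2,
  ..., 32 stand for 1, b_2, ..., b_2^5, in terms of which everything is to be expressed.\<close>

fun rp_pivot :: "int option \<Rightarrow> residue_poly \<Rightarrow> int option" where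
  "rp_pivot s [] = s"
| "rp_pivot s ((k, c) # P) =
     rp_pivot (if c = 0 \<or> k \<in> set [1, 2, 4, 8, 16, 32] then s else Some k) P"

text \<open>\<open>insert_row\<close> tests the inverse before using it, and the default 0 fails the
  test; so the table needs no proof of its own.\<close>

definition inverse_mod19 :: "int \<Rightarrow> int" where
  "inverse_mod19 c = (case map_of [(1,1),(2,10),(3,13),(4,5),(5,4),(6,16),(7,11),(8,12),(9,17),(10,2),
     (11,7),(12,8),(13,3),(14,15),(15,14),(16,6),(17,9),(18,18)] c of None \<Rightarrow> 0 | Some d \<Rightarrow> d)"

fun subst_rules :: "int \<Rightarrow> residue_poly \<Rightarrow> rule_list \<Rightarrow> rule_list" where
  "subst_rules m R [] = []"
| "subst_rules m R ((l, Q) # rs) = (l, rp_subst m R Q) # subst_rules m R rs"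

lemma rules_ok_subst_rules:
  "represents (\<lambda>g. coeff_monomial g m) R \<Longrightarrow> rules_ok rs \<Longrightarrow> rules_ok (subst_rules m R rs)"
  by (induction m R rs rule: subst_rules.induct) (auto simp: rules_ok_def intro: represents_subst)

text \<open>The new rule is also substituted into the old ones. A row without a usable pivot is
  dropped, which loses information but never soundness.\<close>

definition insert_row :: "residue_poly \<Rightarrow> rule_list \<Rightarrow> rule_list" where
  "insert_row P0 rs = (let P = rp_reduce rs P0 in
     case rp_pivot None P of None \<Rightarrow> rs
     | Some m \<Rightarrow> (case rp_extract m P of None \<Rightarrow> rs
        | Some (c, Q) \<Rightarrow> (let d = inverse_mod19 c in
            if (c * d) mod 19 = 1 then
              (let R = rp_scale (- d) Q in (m, R) # subst_rules m R rs) else rs)))"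

lemma rules_ok_insert_row:
  assumes "rules_ok rs" "represents (\<lambda>g. 0) P0"
  shows "rules_ok (insert_row P0 rs)"
proof -
  have P: "represents (\<lambda>g. 0) (rp_reduce rs P0)" by (intro represents_reduce assms)
  show ?thesis
  proof (cases "rp_pivot None (rp_reduce rs P0)")
    case None
    thus ?thesis using assms by (simp add: insert_row_def)
  next
    case p: (Some m)
    show ?thesis
    proof (cases "rp_extract m (rp_reduce rs P0)")
      case None
      thus ?thesis using assms p by (simp add: insert_row_def)
    next
      case (Some z)
      then obtain c Q where z: "rp_extract m (rp_reduce rs P0) = Some (c, Q)" by (cases z) auto
      define d where "d = inverse_mod19 c"
      show ?thesis
      proof (cases "(c * d) mod 19 = 1")
        case False
        thus ?thesis using assms p z by (simp add: insert_row_def d_def)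
      next
        case True
        hence cd: "19 dvd (c * d - 1)" by presburger
        from represents_extract[OF P z] obtain r where
          r: "m > 0" "cong19 r c" "represents (\<lambda>g. 0 - r * coeff_monomial g m) Q" by auto
        note inv = cong19_inverse[OF r(2) cd]
        have "cong19 (of_int (-1) * inverse r) (- d)"
          by (rule cong19_mult[OF cong19_of_int[of "-1" "-1"] inv(2)]) auto
        hence "cong19 (- inverse r) (- d)" by simp
        from represents_scale[OF this r(3)]
        have "represents (\<lambda>g. coeff_monomial g m) (rp_scale (- d) Q)"
          using inv(1) by (simp add: field_simps)
        thus ?thesis using assms p z True r rules_ok_subst_rules
          by (auto simp: insert_row_def d_def Let_def rules_ok_def)
      qed
    qed
  qed
qed

lemma represents_eqI:
  "represents f P \<Longrightarrow> (\<And>g. twin_multiplicative g \<Longrightarrow> h g = f g) \<Longrightarrow> represents h P"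
  using represents_cong[of f h P] by simp

section \<open>Convolutions with sigma_3 and the table of coefficients\<close>

fun rp_dot :: "int list \<Rightarrow> (int \<times> residue_poly) list \<Rightarrow> residue_poly" where
  "rp_dot (s # ss) ((i, P) # bs) = rp_add (rp_scale s P) (rp_dot ss bs)"
| "rp_dot _ _ = []"

text \<open>The newest coefficient stands first, so that a convolution becomes the dot product with
  sigma_3(1), sigma_3(2), and so on.\<close>

fun coeff_table :: "nat \<Rightarrow> (int \<times> residue_poly) list \<Rightarrow> bool" where
  "coeff_table n [] \<longleftrightarrow> n = 0"
| "coeff_table n ((i, P) # bs) \<longleftrightarrow>
     n > 0 \<and> i = int n \<and> represents (\<lambda>g. fps_nth g n) P \<and> coeff_table (n - 1) bs"

fun sigma_table :: "nat \<Rightarrow> int list \<Rightarrow> bool" where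
  "sigma_table t [] \<longleftrightarrow> True"
| "sigma_table t (s # ss) \<longleftrightarrow> cong19 (of_nat (divisor_sigma 3 t)) s \<and> sigma_table (Suc t) ss"

text \<open>t = 1 gives the convolution of index n + 1; t = 2 gives that of index n + 2 without its
  last term, the still unknown b_{n+1}.\<close>

lemma represents_dot:
  "coeff_table n bs \<Longrightarrow> sigma_table t ss \<Longrightarrow> n \<le> length ss \<Longrightarrow>
     represents (\<lambda>g. \<Sum>j=1..<Suc n. of_nat (divisor_sigma 3 (t + n - j)) * fps_nth g j) (rp_dot ss bs)"
proof (induction ss bs arbitrary: n t rule: rp_dot.induct)
  case (1 s ss i P bs)
  hence n: "n > 0" "represents (\<lambda>g. fps_nth g n) P" "coeff_table (n - 1) bs"
    and s: "cong19 (of_nat (divisor_sigma 3 t)) s" "sigma_table (Suc t) ss" by auto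
  have "represents (\<lambda>g. of_nat (divisor_sigma 3 t) * fps_nth g n +
      (\<Sum>j=1..<Suc (n - 1). of_nat (divisor_sigma 3 (Suc t + (n - 1) - j)) * fps_nth g j))
      (rp_add (rp_scale s P) (rp_dot ss bs))"
    using 1(4) by (intro represents_add represents_scale 1(1) n s) auto
  also have "(\<lambda>g. of_nat (divisor_sigma 3 t) * fps_nth g n +
      (\<Sum>j=1..<Suc (n - 1). of_nat (divisor_sigma 3 (Suc t + (n - 1) - j)) * fps_nth g j)) =
      (\<lambda>g. \<Sum>j=1..<Suc n. of_nat (divisor_sigma 3 (t + n - j)) * fps_nth g j)"
    using n(1) by (auto simp: fun_eq_iff add.commute)
  finally show ?case by simp
qed auto

fun table_below :: "int \<Rightarrow> (int \<times> residue_poly) list \<Rightarrow> (int \<times> residue_poly) list" where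
  "table_below m [] = []"
| "table_below m ((i, P) # bs) = (if i < m then (i, P) # bs else table_below m bs)"

lemma coeff_table_below:
  "coeff_table n bs \<Longrightarrow> 0 < m \<Longrightarrow> m \<le> Suc n \<Longrightarrow> coeff_table (m - 1) (table_below (int m) bs)"
proof (induction bs arbitrary: n)
  case (Cons p bs)
  obtain i P where p: "p = (i, P)" by force
  show ?case
  proof (cases "m = Suc n")
    case True
    thus ?thesis using Cons.prems p by auto
  next
    case False
    thus ?thesis using Cons.prems p Cons.IH[of "n - 1"] by auto
  qed
qed auto

lemma coeff_table_lookup:
  "coeff_table n bs \<Longrightarrow> map_of bs i = Some P \<Longrightarrow> represents (\<lambda>g. fps_nth g (nat i)) P \<and> 0 < i \<and> i \<le> int n"
proof (induction bs arbitrary: n)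
  case (Cons p bs)
  obtain j Q where p: "p = (j, Q)" by force
  show ?case
  proof (cases "j = i")
    case True
    thus ?thesis using Cons.prems p by auto
  next
    case False
    thus ?thesis using Cons.prems p Cons.IH[of "n - 1"] by auto
  qed
qed auto

definition rp_conv :: "int list \<Rightarrow> (int \<times> residue_poly) list \<Rightarrow> int \<Rightarrow> residue_poly" where
  "rp_conv ss bs m = rp_dot ss (table_below m bs)"

lemma represents_conv:
  assumes "coeff_table n bs" "sigma_table 1 ss" "0 < m" "m \<le> int n + 1" "n \<le> length ss"
  shows "represents (\<lambda>g. sigma_conv g (nat m)) (rp_conv ss bs m)"
proof -
  define k where "k = nat m"
  have k: "m = int k" "0 < k" "k \<le> Suc n" using assms by (auto simp: k_def)
  have "represents (\<lambda>g. \<Sum>j=1..<Suc (k - 1). of_nat (divisor_sigma 3 (1 + (k - 1) - j)) * fps_nth g j)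
          (rp_dot ss (table_below (int k) bs))"
    using coeff_table_below[OF assms(1) k(2,3)] assms k by (intro represents_dot) auto
  thus ?thesis using k by (simp add: rp_conv_def sigma_conv_def)
qed

text \<open>The right-hand side of \<open>sigma_conv_mult\<close>; 12 is the residue of 240.\<close>

definition rp_rhs :: "int list \<Rightarrow> (int \<times> residue_poly) list \<Rightarrow> int \<Rightarrow> int \<Rightarrow> residue_poly option" where
  "rp_rhs ss bs a c = (case (map_of bs a, map_of bs c) of
     (Some A, Some C) \<Rightarrow> (let S = rp_conv ss bs c in
        Some (rp_add (rp_mult A S) (rp_mult (rp_conv ss bs a) (rp_add C (rp_scale 12 S)))))
   | _ \<Rightarrow> None)"

lemma represents_rhs:
  assumes "coeff_table n bs" "sigma_table 1 ss" "n \<le> length ss" "rp_rhs ss bs a c = Some P" "gcd a c = 1"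
  shows "represents (\<lambda>g. sigma_conv g (nat (a * c))) P"
proof -
  obtain A C where AC: "map_of bs a = Some A" "map_of bs c = Some C"
    and P: "P = rp_add (rp_mult A (rp_conv ss bs c))
                  (rp_mult (rp_conv ss bs a) (rp_add C (rp_scale 12 (rp_conv ss bs c))))"
    using assms(4) by (auto simp: rp_rhs_def Let_def split: option.splits)
  note A = coeff_table_lookup[OF assms(1) AC(1)] and C = coeff_table_lookup[OF assms(1) AC(2)]
  have 240: "cong19 240 12" using cong19_of_int[of 240 12] by simp
  have "represents (\<lambda>g. fps_nth g (nat a) * sigma_conv g (nat c) +
           sigma_conv g (nat a) * (fps_nth g (nat c) + 240 * sigma_conv g (nat c))) P"
    unfolding P using A C assms
    by (intro represents_add represents_mult represents_scale 240 represents_conv[of n]) auto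
  moreover have "sigma_conv g (nat (a * c)) = fps_nth g (nat a) * sigma_conv g (nat c) +
           sigma_conv g (nat a) * (fps_nth g (nat c) + 240 * sigma_conv g (nat c))"
    if "twin_multiplicative g" for g
  proof -
    have "coprime a c" using assms(5) by (simp add: coprime_iff_gcd_eq_1)
    hence "coprime (nat a) (nat c)"
      using coprime_int_iff[of "nat a" "nat c"] A C by simp
    thus ?thesis using sigma_conv_mult[OF that, of "nat a" "nat c"] A C
      by (simp add: nat_mult_distrib)
  qed
  ultimately show ?thesis by (rule represents_eqI)
qed

text \<open>The first three steps compute the next coefficient \<open>b\<^sub>n\<close>: as a variable, as the product \<open>b\<^sub>a b\<^sub>c\<close>, or
  from the relation of index \<open>n + 1 = a c\<close>. The others insert the relation of index \<open>a c\<close>, or a rule for \<open>m\<close>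
  multiplied by the monomial \<open>v\<close>, into the reduced system of rules.\<close>

datatype elim_step = Variable int | Product int int | Solve int int | Relation int int | Multiply int int

type_synonym elim_state = "(int \<times> residue_poly) list \<times> rule_list"

fun elim_exec :: "int list \<Rightarrow> elim_step \<Rightarrow> elim_state \<Rightarrow> elim_state option" where
  "elim_exec ss (Variable k) (bs, rs) = (let n = fst (hd bs) + 1 in
     if (k, n) \<in> set var_index then Some ((n, [(k, 1)]) # bs, rs) else None)"
| "elim_exec ss (Product a c) (bs, rs) = (let n = fst (hd bs) + 1 in
     if a * c = n \<and> gcd a c = 1 then
       (case (map_of bs a, map_of bs c) of
          (Some A, Some C) \<Rightarrow> Some ((n, rp_mult A C) # bs, rs) | _ \<Rightarrow> None) else None)"
| "elim_exec ss (Solve a c) (bs, rs) = (let n = fst (hd bs) + 1 in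
     if a * c = n + 1 \<and> gcd a c = 1 then
       (case rp_rhs ss bs a c of Some P \<Rightarrow>
          Some ((n, rp_add P (rp_scale (- 1) (rp_dot (tl ss) bs))) # bs, rs) | _ \<Rightarrow> None) else None)"
| "elim_exec ss (Relation a c) (bs, rs) =
     (if gcd a c = 1 \<and> a * c \<le> fst (hd bs) + 1 then
       (case rp_rhs ss bs a c of Some P \<Rightarrow>
          Some (bs, insert_row (rp_add P (rp_scale (- 1) (rp_conv ss bs (a * c)))) rs) | _ \<Rightarrow> None) else None)"
| "elim_exec ss (Multiply m v) (bs, rs) =
     (case map_of rs m of Some R \<Rightarrow>
        if v > 0 then Some (bs, insert_row (rp_add [(m * v, 1)] (rp_scale (- 1) (rp_shift v 1 R))) rs)
        else None | _ \<Rightarrow> None)"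

definition state_ok :: "nat \<Rightarrow> elim_state \<Rightarrow> bool" where
  "state_ok n st \<longleftrightarrow> n > 0 \<and> coeff_table n (fst st) \<and> rules_ok (snd st)"

lemma represents_diff:
  assumes "represents f P" "represents h Q"
  shows "represents (\<lambda>g. f g - h g) (rp_add P (rp_scale (- 1) Q))"
proof -
  have "cong19 (-1) (-1)" using cong19_of_int[of "-1" "-1"] by simp
  from represents_add[OF assms(1) represents_scale[OF this assms(2)]] show ?thesis by simp
qed

lemma cong19_1: "cong19 1 1" using cong19_of_int[of 1 1] by simp

lemma represents_single: "k > 0 \<Longrightarrow> represents (\<lambda>g. coeff_monomial g k) [(k, 1)]"
  using cong19_1 by (auto intro!: exI[of _ "1::complex"])

lemma coeff_table_hd: "coeff_table n bs \<Longrightarrow> n > 0 \<Longrightarrow> fst (hd bs) = int n"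
  by (cases bs) auto

text \<open>The bound \<open>n' \<le> Suc n\<close> guarantees that a run never exhausts the list of
  residues of sigma_3.\<close>

lemma elim_exec_sound:
  assumes ok: "state_ok n st" and sig: "sigma_table 1 ss" "n < length ss"
    and ex: "elim_exec ss step st = Some st'"
  shows "\<exists>n'. state_ok n' st' \<and> n' \<le> Suc n"
proof -
  obtain bs rs where st: "st = (bs, rs)" by force
  have n: "n > 0" "coeff_table n bs" "rules_ok rs" and hd: "fst (hd bs) = int n"
    using ok coeff_table_hd by (auto simp: state_ok_def st)
  have new: "state_ok (Suc n) ((int n + 1, P) # bs, rs)" if "represents (\<lambda>g. fps_nth g (Suc n)) P" for P
    using n that by (auto simp: state_ok_def)
  show ?thesis
  proof (cases step)
    case (Variable k)
    have k: "(k, int n + 1) \<in> set var_index" and st': "st' = ((int n + 1, [(k, 1)]) # bs, rs)"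
      using ex by (auto simp: Variable st hd Let_def split: if_splits)
    have "k > 0" using k by (auto simp: var_index_def)
    hence "represents (\<lambda>g. fps_nth g (Suc n)) [(k, 1)]"
      using represents_single[of k] coeff_monomial_var[OF k] by (simp add: nat_add_distrib)
    thus ?thesis using new st' by blast
  next
    case (Product a c)
    then obtain A C where ac: "a * c = int n + 1" "gcd a c = 1" "map_of bs a = Some A" "map_of bs c = Some C"
      and st': "st' = ((int n + 1, rp_mult A C) # bs, rs)"
      using ex by (auto simp: Product st hd Let_def split: if_splits option.splits)
    note A = coeff_table_lookup[OF n(2) ac(3)] and C = coeff_table_lookup[OF n(2) ac(4)]
    have "Suc n = nat (a * c)" using ac(1) by simp
    also have "\<dots> = nat a * nat c" using A by (simp add: nat_mult_distrib)
    finally have e: "Suc n = nat a * nat c" .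
    have "coprime a c" using ac(2) by (simp add: coprime_iff_gcd_eq_1)
    hence cop: "coprime (nat a) (nat c)"
      using coprime_int_iff[of "nat a" "nat c"] A C by simp
    have "represents (\<lambda>g. fps_nth g (nat a) * fps_nth g (nat c)) (rp_mult A C)"
      using A C by (intro represents_mult) auto
    moreover have "fps_nth g (Suc n) = fps_nth g (nat a) * fps_nth g (nat c)" if "twin_multiplicative g" for g
      unfolding e using that cop A C by (auto simp: twin_multiplicative_def multiplicative_fps_def)
    ultimately have "represents (\<lambda>g. fps_nth g (Suc n)) (rp_mult A C)"
      by (rule represents_eqI)
    thus ?thesis using new st' by blast
  next
    case (Solve a c)
    then obtain P where ac: "a * c = int n + 1 + 1" "gcd a c = 1" and P: "rp_rhs ss bs a c = Some P"
      and st': "st' = ((int n + 1, rp_add P (rp_scale (- 1) (rp_dot (tl ss) bs))) # bs, rs)"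
      using ex by (auto simp: Solve st hd Let_def split: if_splits option.splits)
    obtain s0 ss' where ss: "ss = s0 # ss'" using sig by (cases ss) auto
    have 1: "represents (\<lambda>g. sigma_conv g (nat (a * c))) P"
      using represents_rhs[OF n(2) sig(1) _ P ac(2)] sig by simp
    have 2: "represents (\<lambda>g. \<Sum>j=1..<Suc n. of_nat (divisor_sigma 3 (2 + n - j)) * fps_nth g j) (rp_dot (tl ss) bs)"
      using sig ss n by (intro represents_dot) (auto simp: numeral_2_eq_2)
    \<comment> \<open>The remaining term j = n + 1 has the factor sigma_3(1) = 1.\<close>
    have "sigma_conv g (nat (a * c)) - (\<Sum>j=1..<Suc n. of_nat (divisor_sigma 3 (2 + n - j)) * fps_nth g j)
           = fps_nth g (Suc n)" for g
      unfolding ac(1) by (simp add: sigma_conv_def nat_add_distrib divisor_sigma_def)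
    hence "represents (\<lambda>g. fps_nth g (Suc n)) (rp_add P (rp_scale (- 1) (rp_dot (tl ss) bs)))"
      using represents_diff[OF 1 2] by simp
    thus ?thesis using new st' by blast
  next
    case (Relation a c)
    then obtain P where ac: "a * c \<le> int n + 1" "gcd a c = 1" and P: "rp_rhs ss bs a c = Some P"
      and st': "st' = (bs, insert_row (rp_add P (rp_scale (- 1) (rp_conv ss bs (a * c)))) rs)"
      using ex by (auto simp: Relation st hd Let_def split: if_splits option.splits)
    have "a > 0" "c > 0" using P coeff_table_lookup[OF n(2)]
      by (auto simp: rp_rhs_def split: option.splits)
    hence "represents (\<lambda>g. sigma_conv g (nat (a * c)) - sigma_conv g (nat (a * c)))
            (rp_add P (rp_scale (- 1) (rp_conv ss bs (a * c))))"
      using ac sig n by (intro represents_diff represents_rhs[OF n(2) sig(1) _ P] represents_conv[of n]) auto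
    hence "rules_ok (insert_row (rp_add P (rp_scale (- 1) (rp_conv ss bs (a * c)))) rs)"
      by (intro rules_ok_insert_row n) simp
    thus ?thesis using st' n by (auto simp: state_ok_def)
  next
    case (Multiply m v)
    then obtain R where R: "map_of rs m = Some R" "v > 0"
      and st': "st' = (bs, insert_row (rp_add [(m * v, 1)] (rp_scale (- 1) (rp_shift v 1 R))) rs)"
      using ex by (auto simp: Multiply st split: if_splits option.splits)
    have m: "m > 0" "represents (\<lambda>g. coeff_monomial g m) R"
      using n(3) map_of_SomeD[OF R(1)] by (auto simp: rules_ok_def)
    have "represents (\<lambda>g. coeff_monomial g (m * v) - (1 * coeff_monomial g v) * coeff_monomial g m)
            (rp_add [(m * v, 1)] (rp_scale (- 1) (rp_shift v 1 R)))"
      using m R by (intro represents_diff represents_single represents_shift cong19_1) auto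
    hence "rules_ok (insert_row (rp_add [(m * v, 1)] (rp_scale (- 1) (rp_shift v 1 R))) rs)"
      using m R by (intro rules_ok_insert_row n) (simp add: coeff_monomial_mult mult.commute)
    thus ?thesis using st' n by (auto simp: state_ok_def)
  qed
qed

fun elim_run :: "int list \<Rightarrow> elim_step list \<Rightarrow> elim_state \<Rightarrow> elim_state option" where
  "elim_run ss [] st = Some st"
| "elim_run ss (x # xs) st = (case elim_exec ss x st of None \<Rightarrow> None | Some st' \<Rightarrow> elim_run ss xs st')"

lemma elim_run_sound:
  "state_ok n st \<Longrightarrow> sigma_table 1 ss \<Longrightarrow> n + length xs \<le> length ss \<Longrightarrow>
     elim_run ss xs st = Some st' \<Longrightarrow> \<exists>n'. state_ok n' st'"
proof (induction ss xs st arbitrary: n rule: elim_run.induct)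
  case (2 ss x xs st)
  then obtain st1 where st1: "elim_exec ss x st = Some st1" "elim_run ss xs st1 = Some st'"
    by (auto split: option.splits)
  obtain n1 where "state_ok n1 st1" "n1 \<le> Suc n"
    using elim_exec_sound[OF 2(2,3) _ st1(1)] 2(4) by auto
  thus ?case using 2(1)[OF st1(1) _ 2(3) _ st1(2)] 2(4) by auto
qed auto

lemma state_ok_initial: "state_ok 1 ([(1, [(1, 1)])], [])"
proof -
  have "represents (\<lambda>g. fps_nth g 1) [(1, 1)] = represents (\<lambda>g. coeff_monomial g 1) [(1, 1)]"
    by (intro represents_cong) (simp add: coeff_monomial_1 twin_multiplicative_def multiplicative_fps_def)
  thus ?thesis using represents_single[of 1] by (simp add: state_ok_def rules_ok_def)
qed

text \<open>Residues of sigma_3(1), ..., sigma_3(109). There are 108 steps, and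
  \<open>elim_run_sound\<close> counts each of them as if it extended the table, starting from one
  coefficient.\<close>

definition sigma_residues :: "int list" where
  "sigma_residues = [
     1, 9, 9, 16, 12, 5, 2, 15, 16, 13, 2, 11, 13, 18, 13, 7, 12, 11, 1, 2, 18, 18, 8, 2, 0, 3,
     15, 13, 13, 3, 0, 0, 18, 13, 5, 9, 0, 9, 3, 9, 9, 10, 12, 13, 2, 15, 8, 6, 3, 0, 13, 18,
     13, 2, 5, 11, 9, 3, 9, 18, 8, 0, 13, 1, 4, 10, 13, 2, 15, 7, 9, 12, 12, 0, 0, 16, 4, 8, 9,
     8, 7, 5, 2, 3, 11, 13, 3, 11, 13, 18, 7, 14, 0, 15, 12, 0, 9, 8, 13, 0, 8, 3, 0, 5, 7, 3,
     0, 12, 9]"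

text \<open>\<open>Variable\<close> occurs at n = 2, 3, 4, 7, 8, 16, 31: these are the n from 2 to
  65 for which n and n + 1 are both prime powers.\<close>

definition coeff_steps :: "elim_step list" where
  "coeff_steps = [
     Variable 2, Variable 3, Variable 5, Solve 2 3, Product 2 3, Variable 7, Variable 11,
     Solve 2 5, Product 2 5, Solve 3 4, Product 3 4, Solve 2 7, Product 2 7, Product 3 5,
     Variable 19, Solve 2 9, Product 2 9, Solve 4 5, Product 4 5, Product 3 7, Product 2 11,
     Solve 3 8, Product 3 8, Solve 2 13, Product 2 13, Solve 4 7, Product 4 7, Solve 2 15,
     Product 2 15, Variable 29, Solve 3 11, Product 3 11, Product 2 17, Product 5 7,
     Product 4 9, Solve 2 19, Product 2 19, Product 3 13, Product 5 8, Solve 2 21,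
     Product 2 21, Solve 4 11, Product 4 11, Product 5 9, Product 2 23, Solve 3 16,
     Product 3 16, Solve 2 25, Product 2 25, Product 3 17, Product 4 13, Solve 2 27,
     Product 2 27, Product 5 11, Product 7 8, Product 3 19, Product 2 29, Solve 3 20,
     Product 3 20, Solve 2 31, Product 2 31, Product 7 9, Solve 5 13, Product 5 13]"

text \<open>The relations of index at most 66 at which no coefficient was solved for, together with
  second factorisations of the indices 30, 42, 60 and 66.\<close>

definition relation_steps :: "elim_step list" where
  "relation_steps = [
     Relation 3 5, Relation 3 7, Relation 2 11, Relation 3 10, Relation 2 17, Relation 5 7,
     Relation 4 9, Relation 3 13, Relation 5 8, Relation 3 14, Relation 5 9, Relation 2 23,
     Relation 3 17, Relation 4 13, Relation 5 11, Relation 7 8, Relation 3 19, Relation 2 29,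
     Relation 4 15, Relation 7 9, Relation 2 33, Relation 3 22]"

text \<open>As in a Groebner basis computation, multiples of known rules by b_2 or b_3 (the
  monomials 2 and 3) can yield relations outside the linear span of the given ones.\<close>

definition multiply_steps :: "elim_step list" where
  "multiply_steps = [
     Multiply 15 3, Multiply 25 2, Multiply 30 2, Multiply 22 3, Multiply 33 2, Multiply 35 2,
     Multiply 29 2, Multiply 28 2, Multiply 27 2, Multiply 24 2, Multiply 21 2, Multiply 20 2,
     Multiply 19 2, Multiply 18 2, Multiply 12 2, Multiply 14 2, Multiply 11 2, Multiply 10 2,
     Multiply 9 2, Multiply 7 2, Multiply 6 2, Multiply 5 2]"

text \<open>A form of sigma_3 that \<open>code_simp\<close> can evaluate, used to check the table of
  residues.\<close>

fun cube_divisor_sum :: "int \<Rightarrow> int list \<Rightarrow> int" where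
  "cube_divisor_sum n [] = 0"
| "cube_divisor_sum n (d # ds) = (if n mod d = 0 then d * d * d else 0) + cube_divisor_sum n ds"

lemma divisor_sigma_3_eq: 
  assumes "n > 0"
  shows "int (divisor_sigma 3 n) = cube_divisor_sum (int n) [1..int n]"
proof -
  have *: "cube_divisor_sum m (map int ds) = (\<Sum>d | d \<in> set ds \<and> int d dvd m. int d ^ 3)" if "distinct ds" for m ds
    using that
  proof (induction ds)
    case (Cons d ds)
    have "{x. x \<in> set (d # ds) \<and> int x dvd m} =
      (if int d dvd m then insert d {x. x \<in> set ds \<and> int x dvd m} else {x. x \<in> set ds \<and> int x dvd m})"
      by auto
    thus ?case using Cons by (auto simp: power3_eq_cube dvd_eq_mod_eq_0 zmod_int)
  qed auto
  have 1: "[1..int n] = map int [1..<Suc n]"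
    by (intro nth_equalityI) (auto simp: nth_append simp del: upt_Suc)
  have "{d. d \<in> set [1..<Suc n] \<and> int d dvd int n} = {d. d dvd n}"
    using assms by (auto dest: dvd_imp_le intro: Suc_leI dvd_pos_nat)
  thus ?thesis using *[of "[1..<Suc n]" "int n"] by (simp add: 1 divisor_sigma_def del: upt_Suc)
qed

fun sigma_check :: "int \<Rightarrow> int list \<Rightarrow> bool" where
  "sigma_check t [] \<longleftrightarrow> True"
| "sigma_check t (s # ss) \<longleftrightarrow> cube_divisor_sum t [1..t] mod 19 = s \<and> sigma_check (t + 1) ss"

lemma sigma_table_if_check:
  "t > 0 \<Longrightarrow> sigma_check (int t) ss \<Longrightarrow> sigma_table t ss"
proof (induction ss arbitrary: t)
  case (Cons s ss)
  have "int (divisor_sigma 3 t) mod 19 = s" using Cons divisor_sigma_3_eq[of t] by simp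
  hence "19 dvd (int (divisor_sigma 3 t) - s)" by (metis mod_eq_dvd_iff mod_mod_trivial)
  from cong19_of_int[OF this] have "cong19 (of_nat (divisor_sigma 3 t)) s" by simp
  thus ?case using Cons.IH[of "Suc t"] Cons.prems by (simp add: add.commute)
qed auto

lemma sigma_table_residues: "sigma_table 1 sigma_residues"
proof -
  have "sigma_check 1 sigma_residues" by code_simp
  thus ?thesis using sigma_table_if_check[of 1] by simp
qed

definition powers_of_two_only :: "rule_list \<Rightarrow> int \<Rightarrow> bool" where
  "powers_of_two_only rs m = (case map_of rs m of None \<Rightarrow> False
     | Some R \<Rightarrow> list_all (\<lambda>(k, c). k \<in> set [1, 2, 4, 8, 16, 32]) R)"

text \<open>The five integers stand for b_2^6, b_3, b_4, b_7 and b_8. The variables b_16 and b_31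
  are recovered from earlier coefficients in \<open>twin_multiplicative_eqI\<close>.\<close>

definition elimination_succeeds :: bool where
  "elimination_succeeds = (case elim_run sigma_residues (coeff_steps @ relation_steps @ multiply_steps)
      ([(1, [(1, 1)])], []) of None \<Rightarrow> False
    | Some (bs, rs) \<Rightarrow> list_all (powers_of_two_only rs) [64, 3, 5, 7, 11])"

lemma elimination_success: elimination_succeeds
  by code_simp

subsection \<open>The Eisenstein series of weight 2\<close>

lemma iterated_sums_eq:
  fixes F :: "nat \<Rightarrow> nat \<Rightarrow> complex"
  assumes S: "(\<lambda>(c, d). F c d) summable_on UNIV \<times> UNIV"
    and A: "\<And>c. F c sums A c" and B: "\<And>d. (\<lambda>c. F c d) sums B d"
  shows "\<exists>X. A sums X \<and> B sums X"
proof -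
  obtain X where X: "((\<lambda>(c, d). F c d) has_sum X) (UNIV \<times> UNIV)"
    using S by (auto simp: summable_on_def)
  hence X': "((\<lambda>(d, c). F c d) has_sum X) (UNIV \<times> UNIV)"
    by (subst has_sum_swap) (simp add: case_prod_unfold)
  have a: "(F c has_sum A c) UNIV" for c
  proof -
    have "(\<lambda>d. (case (c, d) of (c, d) \<Rightarrow> F c d)) summable_on UNIV"
      using summable_on_SigmaD1[of "\<lambda>c d. F c d" UNIV "\<lambda>_. UNIV" c] S by simp
    then obtain Y where Y: "(F c has_sum Y) UNIV" by (auto simp: summable_on_def)
    have "Y = A c" using has_sum_imp_sums[OF Y] A[of c] by (rule sums_unique2)
    thus ?thesis using Y by simp
  qed
  have b: "((\<lambda>c. F c d) has_sum B d) UNIV" for d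
  proof -
    have "(\<lambda>(d, c). F c d) summable_on UNIV \<times> UNIV" using X' by (auto simp: summable_on_def)
    hence "(\<lambda>c. F c d) summable_on UNIV"
      using summable_on_SigmaD1[of "\<lambda>d c. F c d" UNIV "\<lambda>_. UNIV" d] by simp
    then obtain Y where Y: "((\<lambda>c. F c d) has_sum Y) UNIV" by (auto simp: summable_on_def)
    have "Y = B d" using has_sum_imp_sums[OF Y] B[of d] by (rule sums_unique2)
    thus ?thesis using Y by simp
  qed
  have "(A has_sum X) UNIV" by (rule has_sum_SigmaD[OF X]) (use a in simp)
  moreover have "(B has_sum X) UNIV" by (rule has_sum_SigmaD[OF X']) (use b in simp)
  ultimately show ?thesis using has_sum_imp_sums by blast
qed

lemma summable_on_product_majorant:
  fixes F :: "nat \<Rightarrow> nat \<Rightarrow> complex"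
  assumes "summable u" "summable v" "\<And>n. u n \<ge> (0::real)" "\<And>n. v n \<ge> (0::real)"
    and le: "\<And>c d. norm (F c d) \<le> u c * v d"
  shows "(\<lambda>(c, d). F c d) summable_on UNIV \<times> UNIV"
proof -
  have v: "(v has_sum suminf v) UNIV"
    using assms by (intro norm_summable_imp_has_sum) (auto simp: summable_sums)
  have u: "(\<lambda>c. u c * suminf v) summable_on UNIV"
    using assms by (intro norm_summable_imp_summable_on) (auto simp: suminf_nonneg intro!: summable_mult2)
  have "(\<lambda>(c, d). u c * v d) summable_on UNIV \<times> UNIV"
    by (rule summable_on_SigmaI[OF _ u]) (use v assms in \<open>auto intro: has_sum_cmult_right\<close>)
  hence "(\<lambda>x. norm (case x of (c, d) \<Rightarrow> F c d)) summable_on UNIV \<times> UNIV"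
    by (rule Infinite_Sum.abs_summable_on_comparison_test'[of "\<lambda>(c, d). u c * v d" _ "\<lambda>(c, d). F c d"])
       (use le in auto)
  thus ?thesis by (rule abs_summable_summable)
qed

text \<open>Collecting the terms with (c + 1)(n + 1) = m turns the double series into one over the
  divisors of m. Every natural number divides 0, so the added sum has an infinite index set and is 0
  by convention; it only balances the term at q^0.\<close>

lemma lambert_series:
  fixes a :: "nat \<Rightarrow> complex"
  assumes q: "norm q < 1" and a: "\<And>n. norm (a n) \<le> real n"
    and A: "\<And>c. (\<lambda>n. a (Suc n) * q ^ (Suc c * Suc n)) sums A c"
  shows "\<exists>X. A sums X \<and> (\<lambda>n. (\<Sum>d | d dvd n. a d) * q ^ n) sums (X + (\<Sum>d | d dvd (0::nat). a d))"
proof -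
  let ?F = "\<lambda>c n. a (Suc n) * q ^ (Suc c * Suc n)"
  have le: "norm (?F c n) \<le> norm q ^ c * (real (Suc n) * norm q ^ n)" for c n
  proof -
    have "norm (?F c n) \<le> real (Suc n) * norm q ^ (Suc c * Suc n)"
      unfolding norm_mult norm_power by (intro mult_right_mono a) auto
    \<comment> \<open>(c + 1)(n + 1) >= c + n separates the two variables.\<close>
    also have "norm q ^ (Suc c * Suc n) \<le> norm q ^ (c + n)"
      using q by (intro power_decreasing) auto
    finally show ?thesis by (simp add: power_add mult_ac)
  qed
  have sm: "(\<lambda>(c, n). ?F c n) summable_on UNIV \<times> UNIV"
  proof (rule summable_on_product_majorant[where u = "\<lambda>c. norm q ^ c" and v = "\<lambda>n. real (Suc n) * norm q ^ n"])
    show "summable (\<lambda>n. real (Suc n) * norm q ^ n)"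
      using geometric_deriv_sums[of "norm q"] q by (auto simp: sums_iff)
  qed (use q le in auto)
  obtain X where X: "((\<lambda>(c, n). ?F c n) has_sum X) (UNIV \<times> UNIV)"
    using sm by (auto simp: summable_on_def)
  have "((\<lambda>n. ?F c n) has_sum A c) UNIV" for c
  proof -
    have "(\<lambda>n. ?F c n) summable_on UNIV"
      using summable_on_SigmaD1[of ?F UNIV "\<lambda>_. UNIV" c] sm by simp
    then obtain Y where Y: "((\<lambda>n. ?F c n) has_sum Y) UNIV" by (auto simp: summable_on_def)
    have "Y = A c" using has_sum_imp_sums[OF Y] A[of c] by (rule sums_unique2)
    thus ?thesis using Y by simp
  qed
  hence AX: "(A has_sum X) UNIV" by (intro has_sum_SigmaD[OF X]) simp
  have bij: "bij_betw (\<lambda>(c, n). (Suc c * Suc n, Suc n)) (UNIV \<times> UNIV) (SIGMA n:{1..}. {d. d dvd n})"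
  proof (rule bij_betwI[where g = "\<lambda>(n, d). (n div d - 1, d - 1)"], goal_cases)
    case 1
    show ?case by (auto simp del: mult_Suc mult_Suc_right)
  next
    case 2
    show ?case by auto
  next
    case (3 x)
    show ?case by (cases x) (simp del: mult_Suc mult_Suc_right)
  next
    case (4 y)
    then obtain n d where y: "y = (n, d)" "n \<ge> 1" "d dvd n" by (cases y) auto
    then obtain k where k: "n = d * k" by auto
    hence "d > 0" "k > 0" using y by (auto intro: Nat.gr0I)
    thus ?case using y k by (simp del: mult_Suc mult_Suc_right)
  qed
  have "((\<lambda>(n, d). a d * q ^ n) has_sum X) (SIGMA n:{1..}. {d. d dvd n})"
    unfolding has_sum_reindex_bij_betw[OF bij, symmetric]
    using X by (simp add: case_prod_unfold)
  hence "((\<lambda>n. (\<Sum>d | d dvd n. a d) * q ^ n) has_sum X) {1..}"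
  proof (rule has_sum_SigmaD)
    fix n :: nat assume "n \<in> {1..}"
    hence "finite {d. d dvd n}" by auto
    thus "((\<lambda>d. case (n, d) of (n, d) \<Rightarrow> a d * q ^ n) has_sum (\<Sum>d | d dvd n. a d) * q ^ n) {d. d dvd n}"
      by (simp add: sum_distrib_right has_sum_finite)
  qed
  moreover have "{1..} = Suc ` UNIV" using greaterThan_0 atLeast_Suc_greaterThan[of 0] by simp
  ultimately have "((\<lambda>n. (\<Sum>d | d dvd Suc n. a d) * q ^ Suc n) has_sum X) UNIV"
    by (simp add: has_sum_reindex o_def)
  hence "(\<lambda>n. (\<Sum>d | d dvd Suc n. a d) * q ^ Suc n) sums X" by (rule has_sum_imp_sums)
  hence "(\<lambda>n. (\<Sum>d | d dvd n. a d) * q ^ n) sums (X + (\<Sum>d | d dvd (0::nat). a d))"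
    by (subst (asm) sums_Suc_iff) simp
  thus ?thesis using has_sum_imp_sums[OF AX] by blast
qed

section \<open>Lipschitz's formula and the cotangent series, from the gamma function\<close>

lemma sin_pi_nonzero:
  assumes "Im w \<noteq> 0"
  shows "sin (of_real pi * w) \<noteq> 0"
proof
  assume "sin (of_real pi * w) = 0"
  then obtain n :: int where "of_real pi * w = of_real (of_int n * pi)"
    by (auto simp: sin_eq_0)
  hence "Im (of_real pi * w) = 0" by (metis Im_complex_of_real)
  thus False using assms by simp
qed

lemma not_nonpos_int_if_Im: "Im w \<noteq> 0 \<Longrightarrow> w \<notin> \<int>\<^sub>\<le>\<^sub>0"
  by (auto elim!: nonpos_Ints_cases)

text \<open>The logarithmic derivative of Gamma(z) Gamma(1 - z) = pi / sin(pi z);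
  \<open>trigamma_reflection\<close> differentiates once more.\<close>

lemma digamma_reflection:
  assumes "Im w \<noteq> 0"
  shows "Digamma (1 - w) - Digamma w = of_real pi * cot (of_real pi * w)"
proof -
  define s where "s = sin (of_real pi * w)"
  have s: "s \<noteq> 0" using sin_pi_nonzero[OF assms] by (simp add: s_def)
  have ni: "w \<notin> \<int>\<^sub>\<le>\<^sub>0" "1 - w \<notin> \<int>\<^sub>\<le>\<^sub>0" using assms by (auto intro!: not_nonpos_int_if_Im)
  have 1: "((\<lambda>z. Gamma z * Gamma (1 - z)) has_field_derivative
          (Gamma w * Gamma (1 - w)) * (Digamma w - Digamma (1 - w))) (at w)"
    using ni by (auto intro!: derivative_eq_intros simp: algebra_simps)
  have "((\<lambda>z. of_real pi / sin (of_real pi * z)) has_field_derivative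
          - (of_real pi * (cos (of_real pi * w) * of_real pi)) / (s * s)) (at w)"
    using s by (auto intro!: derivative_eq_intros simp: s_def power2_eq_square)
  hence 2: "((\<lambda>z. Gamma z * Gamma (1 - z)) has_field_derivative
          - (of_real pi * (cos (of_real pi * w) * of_real pi)) / (s * s)) (at w)"
    by (simp add: Gamma_reflection_complex)
  have "(of_real pi / s) * (Digamma w - Digamma (1 - w)) =
          - (of_real pi * (cos (of_real pi * w) * of_real pi)) / (s * s)"
    using DERIV_unique[OF 1 2] by (simp add: Gamma_reflection_complex s_def)
  also have "\<dots> = (of_real pi / s) * (- (of_real pi * cos (of_real pi * w)) / s)" by simp
  finally have "Digamma w - Digamma (1 - w) = - (of_real pi * cos (of_real pi * w)) / s"
    using s by (subst (asm) mult_cancel_left) simp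
  thus ?thesis by (simp add: cot_def s_def algebra_simps)
qed

lemma trigamma_reflection:
  assumes "Im w \<noteq> 0"
  shows "Polygamma 1 w + Polygamma 1 (1 - w) = of_real pi ^ 2 / sin (of_real pi * w) ^ 2"
proof -
  have s: "sin (of_real pi * w) \<noteq> 0" using sin_pi_nonzero[OF assms] .
  have ni: "w \<notin> \<int>\<^sub>\<le>\<^sub>0" "1 - w \<notin> \<int>\<^sub>\<le>\<^sub>0" using assms by (auto intro!: not_nonpos_int_if_Im)
  have 1: "((\<lambda>z. Digamma (1 - z) - Digamma z) has_field_derivative
          - (Polygamma 1 w + Polygamma 1 (1 - w))) (at w)"
    using ni by (auto intro!: derivative_eq_intros)
  have 2: "((\<lambda>z. of_real pi * cot (of_real pi * z)) has_field_derivative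
          - (of_real pi ^ 2 / sin (of_real pi * w) ^ 2)) (at w)"
    using s by (auto intro!: derivative_eq_intros DERIV_chain2[OF DERIV_cot] simp: field_simps power2_eq_square)
  have "open {z. Im z \<noteq> 0}" by (intro open_Collect_neq continuous_intros)
  hence "((\<lambda>z. Digamma (1 - z) - Digamma z) has_field_derivative
          - (of_real pi ^ 2 / sin (of_real pi * w) ^ 2)) (at w)"
    using assms by (intro has_field_derivative_transform_within_open[OF 2, of "{z. Im z \<noteq> 0}"])
      (auto simp: digamma_reflection)
  from DERIV_unique[OF 1 this] show ?thesis using neg_equal_iff_equal by blast
qed

lemma sin_pi_squared_nome:
  "sin (of_real pi * w) ^ 2 = - ((1 - nome w) ^ 2) / (4 * nome w)"
proof -
  define e where "e = exp (\<i> * (of_real pi * w))"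
  have e: "e \<noteq> 0" "nome w = e ^ 2"
    unfolding e_def nome_def by (auto simp: power2_eq_square mult_ac simp flip: exp_add)
  have "exp (- (\<i> * (of_real pi * w))) = inverse e" by (simp add: e_def exp_minus)
  hence "sin (of_real pi * w) = (e - inverse e) / (2 * \<i>)"
    by (simp add: sin_exp_eq e_def)
  hence "sin (of_real pi * w) ^ 2 = - ((e - inverse e) ^ 2) / 4"
    by (simp add: power_divide power_mult_distrib)
  also have "(e - inverse e) ^ 2 = (1 - e ^ 2) ^ 2 / e ^ 2"
    using e by (simp add: power2_eq_square field_simps)
  finally show ?thesis unfolding e(2) by simp
qed

text \<open>Lipschitz's formula with exponent 2, the term n = 0 moved to the right. The terms with
  positive and negative n come from the trigamma series at w and 1 - w.\<close>

lemma lipschitz_sums: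
  assumes "Im w > 0"
  shows "(\<lambda>n. 1 / (w + of_nat (Suc n)) ^ 2 + 1 / (w - of_nat (Suc n)) ^ 2)
     sums (- 4 * of_real pi ^ 2 * (nome w / (1 - nome w) ^ 2) - 1 / w ^ 2)"
proof -
  have w0: "w \<noteq> 0" "1 - w \<noteq> 0" using assms by (auto simp: complex_eq_iff)
  have "(\<lambda>k. inverse ((w + of_nat k) ^ 2)) sums Polygamma 1 w"
    using Polygamma_LIMSEQ[OF w0(1), of 1] by (simp add: numeral_2_eq_2)
  hence 1: "(\<lambda>k. inverse ((w + of_nat (Suc k)) ^ 2)) sums (Polygamma 1 w - inverse (w ^ 2))"
    by (subst sums_Suc_iff) simp
  have 2: "(\<lambda>k. inverse ((1 - w + of_nat k) ^ 2)) sums Polygamma 1 (1 - w)"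
    using Polygamma_LIMSEQ[OF w0(2), of 1] by (simp add: numeral_2_eq_2)
  have "(1 - w + of_nat k) ^ 2 = (w - of_nat (Suc k)) ^ 2" for k
    by (simp add: power2_eq_square algebra_simps)
  from sums_add[OF 1 2, unfolded this]
  have "(\<lambda>n. 1 / (w + of_nat (Suc n)) ^ 2 + 1 / (w - of_nat (Suc n)) ^ 2)
     sums ((Polygamma 1 w + Polygamma 1 (1 - w)) - 1 / w ^ 2)"
    by (simp add: inverse_eq_divide algebra_simps)
  also have "Polygamma 1 w + Polygamma 1 (1 - w) = - 4 * of_real pi ^ 2 * (nome w / (1 - nome w) ^ 2)"
    using trigamma_reflection[of w] assms by (simp add: sin_pi_squared_nome)
  finally show ?thesis .
qed

text \<open>The partial fractions of the cotangent. The terms 1 / (k + 1) that make each digamma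
  series converge cancel in the difference.\<close>

lemma cot_sums:
  assumes "Im a \<noteq> 0"
  shows "(\<lambda>k. 1 / (of_nat (Suc k) + a) - 1 / (of_nat (Suc k) - a))
           sums (of_real pi * cot (of_real pi * a) - 1 / a)"
proof -
  have a0: "a \<noteq> 0" "1 - a \<noteq> 0" "1 + a \<noteq> 0" using assms by (auto simp: complex_eq_iff)
  have *: "(\<lambda>k. inverse (of_nat (Suc k)) - inverse (z + of_nat k)) sums (Digamma z + euler_mascheroni)"
    if "z \<noteq> 0" for z :: complex
    using summable_Digamma[OF that] by (simp add: Digamma_def summable_sums del: of_nat_Suc)
  from sums_diff[OF *[OF a0(2)] *[OF a0(3)]]
  have "(\<lambda>k. 1 / (of_nat (Suc k) + a) - 1 / (of_nat (Suc k) - a)) sums (Digamma (1 - a) - Digamma (1 + a))"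
    by (simp add: inverse_eq_divide algebra_simps)
  moreover have "Digamma (1 + a) = Digamma a + 1 / a"
    using Digamma_plus1[OF a0(1)] by (simp add: add.commute)
  ultimately show ?thesis using digamma_reflection[OF assms] by (simp add: algebra_simps)
qed

lemma cot_eq_exp:
  assumes "exp (2 * \<i> * x) \<noteq> 1"
  shows "cot x = \<i> * (exp (2 * \<i> * x) + 1) / (exp (2 * \<i> * x) - 1)"
proof -
  define e where "e = exp (\<i> * x)"
  have e: "e \<noteq> 0" "exp (2 * \<i> * x) = e * e" "exp (- (\<i> * x)) = inverse e"
    unfolding e_def by (auto simp: exp_minus mult_ac simp flip: exp_add)
  have n: "e * e - 1 \<noteq> 0" using assms e by simp
  have sc: "sin x = (e * e - 1) / (2 * \<i> * e)" "cos x = (e * e + 1) / (2 * e)"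
    using e by (auto simp: sin_exp_eq cos_exp_eq field_simps simp flip: e_def)
  show ?thesis unfolding cot_def sc e(2) using e(1) n by (simp add: divide_simps)
qed


text \<open>This is (1 - E_2) / 24 as a function of q.\<close>

definition eisenstein_tail :: "complex \<Rightarrow> complex" where
  "eisenstein_tail q = (\<Sum>n. of_nat (divisor_sigma 1 n) * q ^ n)"

text \<open>The second series is the one that arises when Lipschitz's formula is summed over the
  rows of the lattice.\<close>

lemma sums_eisenstein_tail:
  assumes "norm q < 1"
  shows "(\<lambda>n. of_nat (divisor_sigma 1 n) * q ^ n) sums eisenstein_tail q"
    and "(\<lambda>c. q ^ Suc c / (1 - q ^ Suc c) ^ 2) sums eisenstein_tail q"
proof -
  have A: "(\<lambda>n. of_nat (Suc n) * q ^ (Suc c * Suc n)) sums (q ^ Suc c / (1 - q ^ Suc c) ^ 2)" for c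
  proof -
    have "norm (q ^ Suc c) < 1" using assms by (simp add: norm_power power_less_one_iff del: power_Suc)
    from sums_mult[OF geometric_deriv_sums[OF this], of "q ^ Suc c"]
    have "(\<lambda>n. q ^ Suc c * (of_nat (Suc n) * (q ^ Suc c) ^ n)) sums (q ^ Suc c / (1 - q ^ Suc c) ^ 2)"
      by simp
    moreover have "q ^ (Suc c * Suc n) = q ^ Suc c * (q ^ Suc c) ^ n" for n
      by (simp only: power_mult power_Suc[of "q ^ Suc c"])
    ultimately show ?thesis by (simp only: mult.left_commute)
  qed
  have 0: "{d. d dvd (0::nat)} = UNIV" by auto
  obtain X where X: "(\<lambda>c. q ^ Suc c / (1 - q ^ Suc c) ^ 2) sums X"
      "(\<lambda>n. (\<Sum>d | d dvd n. of_nat d) * q ^ n) sums X"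
    using lambert_series[of q of_nat, OF assms _ A] by (auto simp: 0 simp del: power_Suc)
  moreover have "(\<Sum>d | d dvd n. of_nat d) = (of_nat (divisor_sigma 1 n) :: complex)" for n
    by (simp add: divisor_sigma_def)
  ultimately have *: "(\<lambda>n. of_nat (divisor_sigma 1 n) * q ^ n) sums X" by simp
  hence "eisenstein_tail q = X" by (simp add: eisenstein_tail_def sums_iff)
  thus "(\<lambda>n. of_nat (divisor_sigma 1 n) * q ^ n) sums eisenstein_tail q"
    "(\<lambda>c. q ^ Suc c / (1 - q ^ Suc c) ^ 2) sums eisenstein_tail q"
    using * X by auto
qed

lemma norm_nome: "norm (nome z) = exp (- 2 * pi * Im z)"
  by (simp add: nome_def)

lemma norm_nome_less_1: "Im z > 0 \<Longrightarrow> norm (nome z) < 1"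
  by (simp add: norm_nome)

lemma nome_mult_of_nat: "nome (of_nat n * z) = nome z ^ n"
  by (simp add: nome_def exp_of_nat_mult[symmetric] mult_ac)

lemma Im_minus_inverse: "Im (- 1 / z) = Im z / norm z ^ 2"
  by (simp add: Im_divide cmod_power2)

lemma Im_minus_inverse_pos: "Im z > 0 \<Longrightarrow> Im (- 1 / z) > 0"
  unfolding Im_minus_inverse by (intro divide_pos_pos) (auto simp: complex_eq_iff)

lemma Im_of_nat_mult_pos: "Im w > 0 \<Longrightarrow> Im (of_nat (Suc n) * w) > 0"
  by (simp del: of_nat_Suc)

lemma inverse_squares_complex: "(\<lambda>n. 1 / of_nat (Suc n) ^ 2) sums (of_real pi ^ 2 / 6 :: complex)"
  using sums_of_real[OF inverse_squares_sums, where ?'a = complex] by (simp add: add_ac)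

lemma lattice_norm_bound:
  assumes "Im z > 0"
  obtains K where "K > 0" "\<And>c d. c \<ge> 0 \<Longrightarrow> K * (c + \<bar>d\<bar>) \<le> norm (of_real c * z + of_real d)"
proof -
  \<comment> \<open>With N the norm to be bounded, c <= N / Im z and |d| <= N + c |z| add up to N
    M.\<close>
  define M where "M = 1 + (1 + norm z) / Im z"
  have M: "M > 0" using assms by (auto simp: M_def intro!: add_pos_nonneg)
  have "inverse M * (c + \<bar>d\<bar>) \<le> norm (of_real c * z + of_real d)" if c: "c \<ge> 0" for c d
  proof -
    let ?N = "norm (of_real c * z + of_real d)"
    have "c * Im z \<le> ?N" using abs_Im_le_cmod[of "of_real c * z + of_real d"] c assms by simp
    hence 1: "c \<le> ?N / Im z" using assms by (simp add: field_simps)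
    have "\<bar>d\<bar> = norm ((of_real c * z + of_real d) - of_real c * z)" by simp
    also have "\<dots> \<le> ?N + norm (of_real c * z)" by (rule norm_triangle_ineq4)
    also have "norm (of_real c * z) = c * norm z" using c by (simp add: norm_mult)
    also have "c * norm z \<le> ?N / Im z * norm z" by (intro mult_right_mono 1) auto
    finally have "c + \<bar>d\<bar> \<le> ?N + ?N / Im z * norm z + ?N / Im z" using 1 by simp
    also have "\<dots> = ?N * M" by (simp add: M_def algebra_simps add_divide_distrib)
    finally have "c + \<bar>d\<bar> \<le> ?N * M" .
    thus ?thesis using M by (simp add: field_simps)
  qed
  thus ?thesis using that[of "inverse M"] M by auto
qed

lemma summable_inverse_sqrt_cube: "summable (\<lambda>n. 1 / sqrt (real (Suc n)) ^ 3)"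
proof -
  have "summable (\<lambda>n. real (Suc n) powr (- 3 / 2))"
    by (subst summable_Suc_iff) (simp add: summable_real_powr_iff)
  moreover have "real (Suc n) powr (- 3 / 2) = 1 / sqrt (real (Suc n)) ^ 3" for n
  proof -
    have "real (Suc n) powr (- 3 / 2) = 1 / real (Suc n) powr (1 / 2 * 3)"
      by (subst powr_minus_divide[symmetric]) simp
    also have "real (Suc n) powr (1 / 2 * 3) = sqrt (real (Suc n)) powr 3"
      by (subst powr_powr[symmetric]) (simp add: powr_half_sqrt)
    finally show ?thesis by (simp add: powr_numeral)
  qed
  ultimately show ?thesis by simp
qed

text \<open>By the inequality of arithmetic and geometric means, decay of third order in c + d is
  bounded by c^(-3/2) d^(-3/2), a product of two summable factors.\<close>

lemma lattice_cube_majorant: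
  assumes K: "(K::real) > 0" and x: "norm x \<ge> K * (real (Suc c) + real (Suc d))"
    and y: "norm y \<ge> K * (real (Suc c) + real (Suc d))"
  shows "norm (1 / (x ^ 2 * y) :: complex) \<le> 1 / (2 * K) ^ 3 * (1 / sqrt (real (Suc c)) ^ 3) * (1 / sqrt (real (Suc d)) ^ 3)"
proof -
  define s where "s = real (Suc c) + real (Suc d)"
  define p where "p = sqrt (real (Suc c)) * sqrt (real (Suc d))"
  have p: "p > 0" by (simp add: p_def)
  have "p = sqrt (real (Suc c) * real (Suc d))" by (simp add: p_def real_sqrt_mult)
  also have "\<dots> \<le> s / 2" unfolding s_def by (intro arith_geo_mean_sqrt) auto
  finally have "2 * K * p \<le> K * s" using K by simp
  hence 1: "2 * K * p \<le> norm x" "2 * K * p \<le> norm y" using x y unfolding s_def by linarith+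
  have "(2 * K * p) ^ 3 = (2 * K * p) ^ 2 * (2 * K * p)" by (simp add: power3_eq_cube power2_eq_square)
  also have "\<dots> \<le> norm x ^ 2 * norm y"
    using 1 K p by (intro mult_mono power_mono) auto
  finally have le: "(2 * K * p) ^ 3 \<le> norm x ^ 2 * norm y" .
  have "0 < 2 * K * p" using K p by simp
  hence "0 < norm x" "0 < norm y" "0 < (2 * K * p) ^ 3" using 1 by (linarith, linarith, simp)
  hence "1 / (norm x ^ 2 * norm y) \<le> 1 / (2 * K * p) ^ 3"
    using le by (intro divide_left_mono mult_pos_pos) auto
  also have "1 / (2 * K * p) ^ 3 = 1 / (2 * K) ^ 3 * (1 / sqrt (real (Suc c)) ^ 3) * (1 / sqrt (real (Suc d)) ^ 3)"
    by (simp add: p_def power_mult_distrib mult_ac)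
  finally show ?thesis by (simp add: norm_divide norm_mult norm_power)
qed


text \<open>Removing the telescoping difference raises the decay from second to third order, which
  is enough for absolute summability.\<close>

lemma telescoped_lattice_term:
  fixes x :: complex
  assumes "x \<noteq> 0" "x + 1 \<noteq> 0"
  shows "1 / x ^ 2 - (1 / x - 1 / (x + 1)) = 1 / (x ^ 2 * (x + 1))"
proof -
  have "1 / x - 1 / (x + 1) = 1 / (x * (x + 1))" using assms by (simp add: divide_simps)
  moreover have "1 / x ^ 2 - 1 / (x * (x + 1)) = ((x + 1) - x) / (x ^ 2 * (x + 1))"
    using assms by (simp add: divide_simps power2_eq_square)
  ultimately show ?thesis by simp
qed

text \<open>d / z tends to infinity in the lower half plane, where the cotangent tends to i. This
  limit is the source of the anomalous term in the transformation of E_2.\<close>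

lemma cot_limit_sequence:
  assumes "Im z > 0"
  shows "(\<lambda>d. (of_real pi * cot (of_real pi * (of_nat d / z)) - z / of_nat d) / z) \<longlonglongrightarrow> of_real pi * \<i> / z"
proof -
  have z: "z \<noteq> 0" using assms by auto
  define u where "u = nome (- 1 / z)"
  have u: "norm u < 1" "u \<noteq> 0" using norm_nome_less_1[OF Im_minus_inverse_pos[OF assms]]
    by (auto simp: u_def nome_def)
  have lim: "(\<lambda>d. of_real pi * (\<i> * (1 + u ^ d) / (1 - u ^ d)) / z - 1 / of_nat d) \<longlonglongrightarrow>
          of_real pi * (\<i> * (1 + 0) / (1 - 0)) / z - 0"
    using z u by (intro tendsto_intros LIMSEQ_power_zero lim_1_over_n) auto
  have "eventually (\<lambda>d. of_real pi * (\<i> * (1 + u ^ d) / (1 - u ^ d)) / z - 1 / of_nat d =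
      (of_real pi * cot (of_real pi * (of_nat d / z)) - z / of_nat d) / z) sequentially"
    using eventually_gt_at_top[of 0]
  proof eventually_elim
    case (elim d)
    have ud: "norm (u ^ d) < 1" using u elim by (simp add: norm_power power_less_one_iff)
    hence n1: "u ^ d \<noteq> 1" by auto
    have "exp (2 * \<i> * (of_real pi * (of_nat d / z))) = inverse (u ^ d)"
      unfolding u_def nome_mult_of_nat[symmetric] by (simp add: nome_def exp_minus[symmetric] mult_ac)
    hence "cot (of_real pi * (of_nat d / z)) = \<i> * (inverse (u ^ d) + 1) / (inverse (u ^ d) - 1)"
      using cot_eq_exp[of "of_real pi * (of_nat d / z)"] n1 by auto
    also have "\<dots> = \<i> * (1 + u ^ d) / (1 - u ^ d)"
      using u n1 by (simp add: divide_simps)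
    finally show ?case using z by (simp add: diff_divide_distrib)
  qed
  from Lim_transform_eventually[OF lim this] show ?thesis by simp
qed

text \<open>The terms \<open>f c d\<close> of the double series are not absolutely summable, but \<open>f c d - (v c d - v c (d + 1))\<close>
  are, so that here the order of summation can be exchanged. The sums of the telescoping terms in the two orders differ by
  the limit \<open>\<pi> i / z\<close> of \<open>\<Sum>\<^sub>c v c d\<close>.\<close>

theorem eisenstein_tail_minus_inverse:
  assumes z: "Im z > 0"
  shows "z ^ 2 * (1 - 24 * eisenstein_tail (nome z)) - (1 - 24 * eisenstein_tail (nome (- 1 / z))) = 6 * \<i> * z / of_real pi"
proof -
  have z0: "z \<noteq> 0" using z by auto
  have nz: "of_nat (Suc c) * z + of_real x \<noteq> 0" for c x
    using z by (auto simp: complex_eq_iff)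
  define f where "f = (\<lambda>c d. 1 / (of_nat (Suc c) * z + of_nat (Suc d)) ^ 2 + 1 / (of_nat (Suc c) * z - of_nat (Suc d)) ^ 2)"
  define v where "v = (\<lambda>c d. 1 / (of_nat (Suc c) * z + of_nat (Suc d)) - 1 / (of_nat (Suc c) * z - of_nat (Suc d)))"
  define F where "F = (\<lambda>c d. f c d - (v c d - v c (Suc d)))"
  define q where "q = nome z"
  define q' where "q' = nome (- 1 / z)"
  \<comment> \<open>\<open>L\<close> and \<open>M\<close> will be the sums of \<open>f\<close> over
    d and over c, evaluated by Lipschitz's formula, and \<open>V\<close> the sum of \<open>v\<close>
    over c.\<close>
  define L where "L = (\<lambda>c. - 4 * of_real pi ^ 2 * (q ^ Suc c / (1 - q ^ Suc c) ^ 2) - 1 / z ^ 2 * (1 / of_nat (Suc c) ^ 2))"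
  define M where "M = (\<lambda>d. 1 / z ^ 2 * (- 4 * of_real pi ^ 2 * (q' ^ Suc d / (1 - q' ^ Suc d) ^ 2)) - 1 / of_nat (Suc d) ^ 2)"
  define V where "V = (\<lambda>d. (of_real pi * cot (of_real pi * (of_nat (Suc d) / z)) - z / of_nat (Suc d)) / z)"
  have F_eq: "F c d = 1 / ((of_nat (Suc c) * z + of_nat (Suc d)) ^ 2 * (of_nat (Suc c) * z + of_nat (Suc (Suc d))))
       - 1 / ((of_nat (Suc c) * z - of_nat (Suc d)) ^ 2 * (of_nat (Suc c) * z - of_nat (Suc (Suc d))))" for c d
  proof -
    define a where "a = of_nat (Suc c) * z + of_nat (Suc d)"
    define b where "b = - (of_nat (Suc c) * z - of_nat (Suc d))"
    have a: "a \<noteq> 0" "a + 1 \<noteq> 0"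
      using nz[of c "real (Suc d)"] nz[of c "real (Suc (Suc d))"] by (auto simp: a_def add_ac)
    have b: "b \<noteq> 0" "b + 1 \<noteq> 0"
      using nz[of c "- real (Suc d)"] nz[of c "- real (Suc (Suc d))"]
      by (auto simp: b_def complex_eq_iff)
    have 1: "of_nat (Suc c) * z + of_nat (Suc (Suc d)) = a + 1"
      "of_nat (Suc c) * z - of_nat (Suc (Suc d)) = - (b + 1)"
      "of_nat (Suc c) * z - of_nat (Suc d) = - b" "of_nat (Suc c) * z + of_nat (Suc d) = a"
      by (simp_all add: a_def b_def algebra_simps)
    have "F c d = (1 / a ^ 2 - (1 / a - 1 / (a + 1))) + (1 / b ^ 2 - (1 / b - 1 / (b + 1)))"
      unfolding F_def f_def v_def 1 by (simp add: minus_divide_right[symmetric] algebra_simps del: minus_add_distrib)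
    also have "\<dots> = 1 / (a ^ 2 * (a + 1)) + 1 / (b ^ 2 * (b + 1))"
      using telescoped_lattice_term[OF a] telescoped_lattice_term[OF b] by simp
    finally show ?thesis unfolding 1 by (simp add: minus_divide_right[symmetric] del: minus_add_distrib)
  qed
  obtain K where K: "K > 0" "\<And>c d. c \<ge> 0 \<Longrightarrow> K * (c + \<bar>d\<bar>) \<le> norm (of_real c * z + of_real d)"
    using lattice_norm_bound[OF z] by metis
  have Kp: "K * (real (Suc c) + real (Suc d)) \<le> norm (of_nat (Suc c) * z + of_nat (Suc d))"
    "K * (real (Suc c) + real (Suc d)) \<le> norm (of_nat (Suc c) * z + of_nat (Suc (Suc d)))"
    "K * (real (Suc c) + real (Suc d)) \<le> norm (of_nat (Suc c) * z - of_nat (Suc d))"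
    "K * (real (Suc c) + real (Suc d)) \<le> norm (of_nat (Suc c) * z - of_nat (Suc (Suc d)))" for c d
  proof -
    have "K * (real (Suc c) + real (Suc d)) \<le> K * (real (Suc c) + real (Suc (Suc d)))" using K by simp
    thus "K * (real (Suc c) + real (Suc d)) \<le> norm (of_nat (Suc c) * z + of_nat (Suc d))"
    "K * (real (Suc c) + real (Suc d)) \<le> norm (of_nat (Suc c) * z + of_nat (Suc (Suc d)))"
    "K * (real (Suc c) + real (Suc d)) \<le> norm (of_nat (Suc c) * z - of_nat (Suc d))"
    "K * (real (Suc c) + real (Suc d)) \<le> norm (of_nat (Suc c) * z - of_nat (Suc (Suc d)))"
      using K(2)[of "real (Suc c)" "real (Suc d)"] K(2)[of "real (Suc c)" "real (Suc (Suc d))"]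
        K(2)[of "real (Suc c)" "- real (Suc d)"] K(2)[of "real (Suc c)" "- real (Suc (Suc d))"]
      by (simp_all del: of_nat_Suc)
  qed
  have sm: "(\<lambda>(c, d). F c d) summable_on UNIV \<times> UNIV"
  proof (rule summable_on_product_majorant)
    show "summable (\<lambda>c. 2 / (2 * K) ^ 3 * (1 / sqrt (real (Suc c)) ^ 3))"
      by (intro summable_mult summable_inverse_sqrt_cube)
    show "summable (\<lambda>c. 1 / sqrt (real (Suc c)) ^ 3)" by (rule summable_inverse_sqrt_cube)
    fix c d
    have "norm (F c d) \<le> 1 / (2 * K) ^ 3 * (1 / sqrt (real (Suc c)) ^ 3) * (1 / sqrt (real (Suc d)) ^ 3)
       + 1 / (2 * K) ^ 3 * (1 / sqrt (real (Suc c)) ^ 3) * (1 / sqrt (real (Suc d)) ^ 3)"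
      unfolding F_eq by (intro order.trans[OF norm_triangle_ineq4] add_mono lattice_cube_majorant K Kp)
    thus "norm (F c d) \<le> 2 / (2 * K) ^ 3 * (1 / sqrt (real (Suc c)) ^ 3) * (1 / sqrt (real (Suc d)) ^ 3)"
      by simp
  qed (use K in auto)
  have V: "(\<lambda>c. v c d) sums V d" for d
  proof -
    define a where "a = of_nat (Suc d) / z"
    have w: "Im (of_nat (Suc d) * (- 1 / z)) > 0"
      using Im_minus_inverse_pos[OF z] by (rule Im_of_nat_mult_pos)
    moreover have "a = - (of_nat (Suc d) * (- 1 / z))" by (simp add: a_def)
    ultimately have "Im a \<noteq> 0" by (metis less_irrefl neg_equal_0_iff_equal uminus_complex.sel(2))
    from sums_divide[OF cot_sums[OF this], of z]
    have "(\<lambda>c. (1 / (of_nat (Suc c) + a) - 1 / (of_nat (Suc c) - a)) / z) sums V d"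
      by (simp add: V_def a_def del: of_nat_Suc)
    moreover have "(1 / (of_nat (Suc c) + a) - 1 / (of_nat (Suc c) - a)) / z = v c d" for c
    proof -
      have "(of_nat (Suc c) + a) * z = of_nat (Suc c) * z + of_nat (Suc d)"
        "(of_nat (Suc c) - a) * z = of_nat (Suc c) * z - of_nat (Suc d)"
        using z0 by (simp_all add: a_def algebra_simps del: of_nat_Suc)
      thus ?thesis by (simp add: v_def diff_divide_distrib del: of_nat_Suc)
    qed
    ultimately show ?thesis by simp
  qed
  have A: "F c sums (L c - v c 0)" for c
  proof -
    have Im: "Im (of_nat (Suc c) * z) > 0" using z by simp
    have fs: "f c sums L c"
      using lipschitz_sums[OF Im] unfolding f_def L_def q_def nome_mult_of_nat
      by (simp add: power_mult_distrib mult_ac del: of_nat_Suc power_Suc)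
    have "(\<lambda>d. v c d) \<longlonglongrightarrow> 0 - 0"
      unfolding v_def
    proof (intro tendsto_diff)
      have inf: "filterlim (\<lambda>d. of_nat (Suc d) :: complex) at_infinity sequentially"
        using filterlim_compose[OF tendsto_of_nat filterlim_Suc] .
      have "filterlim (\<lambda>d. of_nat (Suc c) * z + of_nat (Suc d)) at_infinity sequentially"
        by (intro tendsto_add_filterlim_at_infinity[OF tendsto_const] inf)
      thus "(\<lambda>d. 1 / (of_nat (Suc c) * z + of_nat (Suc d))) \<longlonglongrightarrow> 0"
        by (intro tendsto_divide_0[OF tendsto_const])
      have "filterlim (\<lambda>d. - of_nat (Suc d) :: complex) at_infinity sequentially"
        using inf unfolding filterlim_at_infinity_conv_norm_at_top norm_minus_cancel .
      hence "filterlim (\<lambda>d. of_nat (Suc c) * z + (- of_nat (Suc d))) at_infinity sequentially"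
        by (intro tendsto_add_filterlim_at_infinity[OF tendsto_const])
      hence "filterlim (\<lambda>d. of_nat (Suc c) * z - of_nat (Suc d)) at_infinity sequentially"
        by (simp only: diff_conv_add_uminus)
      thus "(\<lambda>d. 1 / (of_nat (Suc c) * z - of_nat (Suc d))) \<longlonglongrightarrow> 0"
        by (intro tendsto_divide_0[OF tendsto_const])
    qed
    hence "(\<lambda>d. v c d) \<longlonglongrightarrow> 0" by simp
    from telescope_sums'[OF this] have "(\<lambda>d. v c d - v c (Suc d)) sums (v c 0)" by simp
    from sums_diff[OF fs this] show ?thesis by (simp add: F_def)
  qed
  have B: "(\<lambda>c. F c d) sums (M d - (V d - V (Suc d)))" for d
  proof -
    \<comment> \<open>For summation over c the factor z^2 is taken out and Lipschitz's formula is
      applied at -(d + 1) / z; this is how -1 / z enters.\<close>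
    define w where "w = of_nat (Suc d) * (- 1 / z)"
    have Im: "Im w > 0" using Im_minus_inverse_pos[OF z] unfolding w_def by (rule Im_of_nat_mult_pos)
    have w0: "w \<noteq> 0" using Im by auto
    from sums_mult[OF lipschitz_sums[OF Im], of "1 / z ^ 2"]
    have "(\<lambda>n. 1 / z ^ 2 * (1 / (w + of_nat (Suc n)) ^ 2 + 1 / (w - of_nat (Suc n)) ^ 2)) sums
       (1 / z ^ 2 * (- 4 * of_real pi ^ 2 * (nome w / (1 - nome w) ^ 2)) - 1 / z ^ 2 * (1 / w ^ 2))"
      by (simp add: algebra_simps)
    also have "1 / z ^ 2 * (1 / w ^ 2) = 1 / of_nat (Suc d) ^ 2"
      using z0 by (simp add: w_def power_mult_distrib power_divide del: of_nat_Suc)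
    also have "nome w = q' ^ Suc d" unfolding w_def q'_def by (rule nome_mult_of_nat)
    also have "(\<lambda>n. 1 / z ^ 2 * (1 / (w + of_nat (Suc n)) ^ 2 + 1 / (w - of_nat (Suc n)) ^ 2)) = (\<lambda>c. f c d)"
    proof
      fix c
      have "z ^ 2 * (w + of_nat (Suc c)) ^ 2 = (of_nat (Suc c) * z - of_nat (Suc d)) ^ 2"
        "z ^ 2 * (w - of_nat (Suc c)) ^ 2 = (of_nat (Suc c) * z + of_nat (Suc d)) ^ 2"
        unfolding power_mult_distrib[symmetric] power2_eq_iff
        using z0 by (simp_all add: w_def algebra_simps del: of_nat_Suc)
      thus "1 / z ^ 2 * (1 / (w + of_nat (Suc c)) ^ 2 + 1 / (w - of_nat (Suc c)) ^ 2) = f c d"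
        unfolding f_def by (simp add: distrib_left add.commute del: of_nat_Suc)
    qed
    finally have "(\<lambda>c. f c d) sums M d" by (simp add: M_def)
    from sums_diff[OF this sums_diff[OF V[of d] V[of "Suc d"]]] show ?thesis by (simp add: F_def)
  qed
  obtain X where X: "(\<lambda>c. L c - v c 0) sums X" "(\<lambda>d. M d - (V d - V (Suc d))) sums X"
    using iterated_sums_eq[OF sm A B] by blast
  have q: "norm q < 1" "norm q' < 1"
    using norm_nome_less_1[OF z] norm_nome_less_1[OF Im_minus_inverse_pos[OF z]] by (simp_all add: q_def q'_def)
  \<comment> \<open>The terms n = 0 of Lipschitz's formula add up to multiples of zeta(2) = pi^2 /
    6, which become the constant term 1 of E_2.\<close>
  have Ls: "L sums (- 4 * of_real pi ^ 2 * eisenstein_tail q - 1 / z ^ 2 * (of_real pi ^ 2 / 6))"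
    unfolding L_def by (intro sums_diff sums_mult sums_eisenstein_tail(2)[OF q(1)] inverse_squares_complex)
  have Ms: "M sums (1 / z ^ 2 * (- 4 * of_real pi ^ 2 * eisenstein_tail q') - of_real pi ^ 2 / 6)"
    unfolding M_def by (intro sums_diff sums_mult sums_eisenstein_tail(2)[OF q(2)] inverse_squares_complex)
  have "V \<longlonglongrightarrow> of_real pi * \<i> / z"
    using filterlim_compose[OF cot_limit_sequence[OF z] filterlim_Suc] by (simp add: V_def o_def)
  from telescope_sums'[OF this] have Vs: "(\<lambda>d. V d - V (Suc d)) sums (V 0 - of_real pi * \<i> / z)" .
  \<comment> \<open>The telescoping parts contribute \<open>V 0\<close> when summed over d first,
    and \<open>V 0\<close> minus pi i / z when summed over c first.\<close>
  have "(- 4 * of_real pi ^ 2 * eisenstein_tail q - 1 / z ^ 2 * (of_real pi ^ 2 / 6)) - V 0 = X"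
    using sums_diff[OF Ls V[of 0]] X(1) by (rule sums_unique2)
  moreover have "(1 / z ^ 2 * (- 4 * of_real pi ^ 2 * eisenstein_tail q') - of_real pi ^ 2 / 6) - (V 0 - of_real pi * \<i> / z) = X"
    using sums_diff[OF Ms Vs] X(2) by (rule sums_unique2)
  ultimately have "(- 4 * of_real pi ^ 2 * eisenstein_tail q - 1 / z ^ 2 * (of_real pi ^ 2 / 6)) =
     (1 / z ^ 2 * (- 4 * of_real pi ^ 2 * eisenstein_tail q') - of_real pi ^ 2 / 6) + of_real pi * \<i> / z"
    by (simp add: algebra_simps)
  hence "of_real pi * (z ^ 2 * (1 - 24 * eisenstein_tail q) * of_real pi) =
     of_real pi * ((1 - 24 * eisenstein_tail q') * of_real pi + 6 * \<i> * z)"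
    using z0 by (simp add: field_simps power2_eq_square)
  hence "z ^ 2 * (1 - 24 * eisenstein_tail q) * of_real pi = (1 - 24 * eisenstein_tail q') * of_real pi + 6 * \<i> * z"
    by (subst (asm) mult_cancel_left) simp
  thus ?thesis by (simp add: q_def q'_def field_simps)
qed

subsection \<open>The eta function\<close>

lemma fps_conv_radius_ge_1:
  fixes F :: "complex fps"
  assumes "\<And>q. norm q < 1 \<Longrightarrow> summable (\<lambda>n. fps_nth F n * q ^ n)"
  shows "fps_conv_radius F \<ge> 1"
  unfolding fps_conv_radius_def
  by (rule conv_radius_geI_ex') (use assms in auto)

text \<open>The derivation q d/dq, which is d/dz divided by 2 pi i.\<close>

definition theta :: "complex fps \<Rightarrow> complex fps" where
  "theta F = fps_X * fps_deriv F"

lemma theta_nth [simp]: "fps_nth (theta F) n = of_nat n * fps_nth F n"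
  by (cases n) (auto simp: theta_def)

definition nome_eval :: "complex fps \<Rightarrow> complex \<Rightarrow> complex" where
  "nome_eval F z = eval_fps F (nome z)"

lemma nome_in_eball:
  assumes "fps_conv_radius F \<ge> 1" "Im z > 0"
  shows "ereal (norm (nome z)) < fps_conv_radius F"
proof -
  have "ereal (norm (nome z)) < 1" using norm_nome_less_1[OF assms(2)] by simp
  thus ?thesis using assms(1) by (rule less_le_trans)
qed

lemma nome_eval_sums:
  "fps_conv_radius F \<ge> 1 \<Longrightarrow> Im z > 0 \<Longrightarrow> (\<lambda>n. fps_nth F n * nome z ^ n) sums nome_eval F z"
  unfolding nome_eval_def by (intro sums_eval_fps nome_in_eball)

lemma nome_has_derivative [derivative_intros]:
  "(f has_field_derivative f') (at z within A) \<Longrightarrow>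
     ((\<lambda>z. nome (f z)) has_field_derivative 2 * of_real pi * \<i> * nome (f z) * f') (at z within A)"
  unfolding nome_def by (auto intro!: derivative_eq_intros)

lemma nome_holomorphic [holomorphic_intros]: "f holomorphic_on A \<Longrightarrow> (\<lambda>z. nome (f z)) holomorphic_on A"
  unfolding nome_def by (intro holomorphic_intros)

lemma conv_radius_theta: "fps_conv_radius F \<ge> 1 \<Longrightarrow> fps_conv_radius (theta F) \<ge> 1"
  unfolding theta_def
  by (rule order.trans[OF _ fps_conv_radius_mult])
     (auto simp: min_def intro: order.trans[OF _ fps_conv_radius_deriv])

lemma nome_eval_has_derivative:
  assumes "fps_conv_radius F \<ge> 1" "Im z > 0"
  shows "(nome_eval F has_field_derivative 2 * of_real pi * \<i> * nome_eval (theta F) z) (at z)"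
proof -
  have r: "fps_conv_radius (fps_deriv F) \<ge> 1"
    using assms(1) by (rule order.trans[OF _ fps_conv_radius_deriv])
  have "((\<lambda>z. eval_fps F (nome z)) has_field_derivative
          eval_fps (fps_deriv F) (nome z) * (2 * of_real pi * \<i> * nome z * 1)) (at z)"
    by (rule DERIV_chain2[OF has_field_derivative_eval_fps])
       (use nome_in_eball[OF assms] in \<open>auto intro!: derivative_eq_intros\<close>)
  moreover have "nome_eval (theta F) z = nome z * eval_fps (fps_deriv F) (nome z)"
    unfolding nome_eval_def theta_def using nome_in_eball[OF r assms(2)]
    by (subst eval_fps_mult) auto
  ultimately show ?thesis unfolding nome_eval_def [abs_def] by (simp add: mult_ac)
qed

lemma nome_eval_mult:
  "fps_conv_radius F \<ge> 1 \<Longrightarrow> fps_conv_radius G \<ge> 1 \<Longrightarrow> Im z > 0 \<Longrightarrow>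
     nome_eval (F * G) z = nome_eval F z * nome_eval G z"
  unfolding nome_eval_def by (intro eval_fps_mult nome_in_eball)

lemma nome_eval_diff:
  "fps_conv_radius F \<ge> 1 \<Longrightarrow> fps_conv_radius G \<ge> 1 \<Longrightarrow> Im z > 0 \<Longrightarrow>
     nome_eval (F - G) z = nome_eval F z - nome_eval G z"
  unfolding nome_eval_def by (intro eval_fps_diff nome_in_eball)

lemma conv_radius_mult_ge_1:
  fixes F G :: "complex fps"
  shows "fps_conv_radius F \<ge> 1 \<Longrightarrow> fps_conv_radius G \<ge> 1 \<Longrightarrow> fps_conv_radius (F * G) \<ge> 1"
  by (rule order.trans[OF _ fps_conv_radius_mult]) simp

lemma conv_radius_diff_ge_1:
  fixes F G :: "complex fps"
  shows "fps_conv_radius F \<ge> 1 \<Longrightarrow> fps_conv_radius G \<ge> 1 \<Longrightarrow> fps_conv_radius (F - G) \<ge> 1"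
  by (rule order.trans[OF _ fps_conv_radius_diff]) simp

lemma conv_radius_const_mult:
  fixes F :: "complex fps"
  shows "fps_conv_radius F \<ge> 1 \<Longrightarrow> fps_conv_radius (fps_const c * F) \<ge> 1"
  by (rule conv_radius_mult_ge_1) auto

lemma nome_eval_cmult:
  "fps_conv_radius F \<ge> 1 \<Longrightarrow> Im z > 0 \<Longrightarrow> nome_eval (fps_const c * F) z = c * nome_eval F z"
  by (subst nome_eval_mult) (auto simp: nome_eval_def)

lemma nome_plus_1: "nome (z + 1) = nome z"
proof -
  have "nome (z + 1) = nome z * exp (2 * of_real pi * \<i>)"
    by (simp add: nome_def algebra_simps exp_add)
  thus ?thesis by (simp add: exp_two_pi_i')
qed

lemma nome_eval_plus_1: "nome_eval F (z + 1) = nome_eval F z"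
  by (simp add: nome_eval_def nome_plus_1)

definition E2 :: "complex fps" where
  "E2 = Abs_fps (\<lambda>n. if n = 0 then 1 else - 24 * of_nat (divisor_sigma 1 n))"

lemma sigma_0 [simp]: "divisor_sigma r 0 = 0"
proof -
  have "{d. d dvd (0::nat)} = UNIV" by auto
  thus ?thesis by (simp add: divisor_sigma_def)
qed

lemma E2_sums:
  assumes "norm q < 1"
  shows "(\<lambda>n. fps_nth E2 n * q ^ n) sums (1 - 24 * eisenstein_tail q)"
proof -
  have "(\<lambda>n. (if n = 0 then 1 else 0) * q ^ n) = (\<lambda>n. if n = 0 then 1 else 0)" by auto
  hence "(\<lambda>n. (if n = 0 then 1 else 0) * q ^ n) sums 1"
    using sums_single[of 0 "\<lambda>n. 1 :: complex"] by simp
  from sums_diff[OF this sums_mult[OF sums_eisenstein_tail(1)[OF assms], of 24]]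
  have "(\<lambda>n. (if n = 0 then 1 else 0) * q ^ n - 24 * (of_nat (divisor_sigma 1 n) * q ^ n)) sums (1 - 24 * eisenstein_tail q)"
    by simp
  also have "(\<lambda>n. (if n = 0 then 1 else 0) * q ^ n - 24 * (of_nat (divisor_sigma 1 n) * q ^ n)) = (\<lambda>n. fps_nth E2 n * q ^ n)"
    by (auto simp: E2_def fun_eq_iff)
  finally show ?thesis .
qed

lemma conv_radius_E2: "fps_conv_radius E2 \<ge> 1"
  using E2_sums by (intro fps_conv_radius_ge_1) (auto simp: sums_iff)

theorem E2_minus_inverse:
  assumes "Im z > 0"
  shows "nome_eval E2 (- 1 / z) = z ^ 2 * nome_eval E2 z - 6 * \<i> * z / of_real pi"
proof -
  have "nome_eval E2 w = 1 - 24 * eisenstein_tail (nome w)" if "Im w > 0" for w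
    using sums_unique2[OF nome_eval_sums[OF conv_radius_E2 that] E2_sums[OF norm_nome_less_1[OF that]]] .
  note E = this[OF assms] this[OF Im_minus_inverse_pos[OF assms]]
  show ?thesis
    using eisenstein_tail_minus_inverse[OF assms] unfolding E[symmetric]
    by (metis add_diff_cancel_left' diff_add_cancel)
qed

text \<open>The logarithm of Euler's product as a power series. Powers of the product are written as
  exponentials of its multiples, so no branch has to be chosen and nonvanishing is evident.\<close>

definition log_euler :: "complex fps" where
  "log_euler = Abs_fps (\<lambda>n. - of_nat (divisor_sigma 1 n) / of_nat n)"

text \<open>The logarithm of each factor is expanded and the double series is a Lambert series with
  a_n = 1 / n; the divisor sum of 1 / d is sigma_1(n) / n.\<close>

lemma euler_product:
  assumes q: "norm q < 1"
  shows "\<exists>X. (\<lambda>n. fps_nth log_euler n * q ^ n) sums X \<and> (\<Prod>n. 1 - q ^ Suc n) = exp X"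
proof -
  have lt: "norm (q ^ Suc c) < 1" for c
    using q by (simp add: norm_power power_less_one_iff del: power_Suc)
  have A: "(\<lambda>n. 1 / of_nat (Suc n) * q ^ (Suc c * Suc n)) sums (- ln (1 - q ^ Suc c))" for c
  proof -
    have "norm (- (q ^ Suc c)) < 1" using lt by simp
    from sums_minus[OF Ln_series'[OF this]]
    have "(\<lambda>n. (q ^ Suc c) ^ n / of_nat n) sums (- ln (1 - q ^ Suc c))" by simp
    hence "(\<lambda>n. (q ^ Suc c) ^ Suc n / of_nat (Suc n)) sums (- ln (1 - q ^ Suc c))"
      by (subst sums_Suc_iff) simp
    moreover have "q ^ (Suc c * Suc n) = (q ^ Suc c) ^ Suc n" for n by (rule power_mult)
    ultimately show ?thesis by (simp del: power_Suc of_nat_Suc)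
  qed
  have le: "norm (1 / of_nat n :: complex) \<le> real n" for n
  proof (cases n)
    case (Suc m)
    have "1 / real (Suc m) \<le> 1" by simp
    also have "1 \<le> real (Suc m)" by simp
    finally show ?thesis by (simp add: Suc norm_divide del: of_nat_Suc)
  qed auto
  have inf: "{d. d dvd (0::nat)} = UNIV" by auto
  obtain X where X: "(\<lambda>c. - ln (1 - q ^ Suc c)) sums X"
      "(\<lambda>n. (\<Sum>d | d dvd n. 1 / of_nat d) * q ^ n) sums X"
    using lambert_series[of q "\<lambda>n. 1 / of_nat n", OF q le A] by (auto simp: inf simp del: power_Suc)
  have "(\<Sum>d | d dvd n. 1 / of_nat d) = (of_nat (divisor_sigma 1 n) / of_nat n :: complex)" for n
  proof (cases "n = 0")
    case False
    have "(\<Sum>d | d dvd n. 1 / of_nat d) = (\<Sum>d | d dvd n. of_nat d / of_nat n :: complex)"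
      by (rule sum.reindex_bij_witness[of _ "\<lambda>d. n div d" "\<lambda>d. n div d"])
         (use False in \<open>auto elim!: dvdE simp: field_simps\<close>)
    thus ?thesis by (simp add: divisor_sigma_def sum_divide_distrib)
  qed (simp add: inf)
  hence "(\<lambda>n. of_nat (divisor_sigma 1 n) / of_nat n * q ^ n) sums X" using X(2) by simp
  from sums_minus[OF this] have 1: "(\<lambda>n. fps_nth log_euler n * q ^ n) sums (- X)"
    by (simp add: log_euler_def)
  have 2: "(\<lambda>c. ln (1 - q ^ Suc c)) sums (- X)" using sums_minus[OF X(1)] by simp
  have "1 - q ^ Suc c \<noteq> 0" for c using lt[of c] by auto
  hence "(\<Prod>n. 1 - q ^ Suc n) = (\<Prod>n. exp (ln (1 - q ^ Suc n)))" by (simp del: power_Suc)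
  also have "\<dots> = exp (- X)" using prodinf_exp[of "\<lambda>c. ln (1 - q ^ Suc c)"] 2 by (simp add: sums_iff del: power_Suc)
  finally show ?thesis using 1 by blast
qed

lemma conv_radius_log_euler: "fps_conv_radius log_euler \<ge> 1"
  using euler_product by (intro fps_conv_radius_ge_1) (auto simp: sums_iff)

lemma euler_product_eq:
  assumes "Im z > 0"
  shows "(\<Prod>n. 1 - nome z ^ Suc n) = exp (nome_eval log_euler z)"
  using euler_product[OF norm_nome_less_1[OF assms]] nome_eval_sums[OF conv_radius_log_euler assms]
  by (auto dest: sums_unique2)

text \<open>The eighth power is the common building block: phi_8 uses two of them and the
  discriminant three, and its weight 4 keeps square roots of z out of the transformation
  law.\<close>

lemma eta8_eq:
  assumes "Im z > 0"
  shows "dedekind_eta z ^ 8 = exp (2 * of_real pi * \<i> * z / 3 + 8 * nome_eval log_euler z)"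
proof -
  have "nome (z / 24) ^ 8 = exp (2 * of_real pi * \<i> * z / 3)"
    by (simp add: nome_def exp_of_nat_mult[symmetric] mult_ac)
  thus ?thesis
    using exp_of_nat_mult[of 8 "nome_eval log_euler z"]
    by (simp add: dedekind_eta_def euler_product_eq[OF assms] power_mult_distrib exp_add del: power_Suc)
qed

text \<open>Both sides have the same logarithmic derivative, and they agree at \<open>z = \<i>\<close>.\<close>

theorem eta8_minus_inverse:
  assumes z: "Im z > 0"
  shows "dedekind_eta (- 1 / z) ^ 8 = z ^ 4 * dedekind_eta z ^ 8"
proof -
  define L where "L = (\<lambda>z. 2 * of_real pi * \<i> * z / 3 + 8 * nome_eval log_euler z)"
  have L: "(L has_field_derivative 2 * of_real pi * \<i> / 3 * nome_eval E2 w) (at w)" if "Im w > 0" for w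
  proof -
    have "E2 = 1 + fps_const 24 * theta log_euler"
      by (rule fps_ext) (auto simp: E2_def log_euler_def)
    also have "nome_eval \<dots> w = eval_fps 1 (nome w) + nome_eval (fps_const 24 * theta log_euler) w"
      unfolding nome_eval_def using that
      by (intro eval_fps_add nome_in_eball conv_radius_const_mult conv_radius_theta conv_radius_log_euler) auto
    finally have "nome_eval E2 w = 1 + 24 * nome_eval (theta log_euler) w"
      using that by (simp add: nome_eval_cmult conv_radius_theta conv_radius_log_euler)
    hence "2 * of_real pi * \<i> / 3 * nome_eval E2 w = 2 * of_real pi * \<i> / 3 + 8 * (2 * of_real pi * \<i> * nome_eval (theta log_euler) w)"
      by (simp add: algebra_simps)
    thus ?thesis unfolding L_def
      by (auto intro!: derivative_eq_intros nome_eval_has_derivative[THEN DERIV_chain2] conv_radius_log_euler that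
               simp: algebra_simps)
  qed
  define h where "h = (\<lambda>z. exp (L (- 1 / z) - L z) / z ^ 4)"
  have "(h has_field_derivative 0) (at w within upper_half_plane)" if "w \<in> upper_half_plane" for w
  proof -
    have w: "Im w > 0" "w \<noteq> 0" using that by (auto simp: upper_half_plane_def)
    have "((\<lambda>z. L (- 1 / z)) has_field_derivative 2 * of_real pi * \<i> / 3 * nome_eval E2 (- 1 / w) * (1 / w ^ 2)) (at w)"
      by (rule DERIV_chain2[where f = L and g = "\<lambda>z. - 1 / z", OF L[OF Im_minus_inverse_pos[OF w(1)]]])
         (use w in \<open>auto intro!: derivative_eq_intros simp: power2_eq_square\<close>)
    hence "((\<lambda>z. L (- 1 / z) - L z) has_field_derivative
             2 * of_real pi * \<i> / 3 * nome_eval E2 (- 1 / w) * (1 / w ^ 2) - 2 * of_real pi * \<i> / 3 * nome_eval E2 w) (at w)"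
      by (intro DERIV_diff L w)
    \<comment> \<open>The anomalous term of E_2 contributes 4 / w, the logarithmic derivative of
      w^4.\<close>
    also have "2 * of_real pi * \<i> / 3 * nome_eval E2 (- 1 / w) * (1 / w ^ 2) - 2 * of_real pi * \<i> / 3 * nome_eval E2 w = 4 / w"
      unfolding E2_minus_inverse[OF w(1)] using w by (simp add: field_simps power2_eq_square)
    finally have 1: "((\<lambda>z. L (- 1 / z) - L z) has_field_derivative 4 / w) (at w)" .
    have "(h has_field_derivative
       (exp (L (- 1 / w) - L w) * (4 / w) * w ^ 4 - exp (L (- 1 / w) - L w) * (4 * w ^ 3)) / (w ^ 4 * w ^ 4)) (at w)"
      unfolding h_def
    proof (rule DERIV_divide)
      show "((\<lambda>z. exp (L (- 1 / z) - L z)) has_field_derivative exp (L (- 1 / w) - L w) * (4 / w)) (at w)"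
        by (rule DERIV_chain2[OF DERIV_exp 1])
      show "((\<lambda>z. z ^ 4) has_field_derivative 4 * w ^ 3) (at w)"
        by (auto intro!: derivative_eq_intros)
    qed (use w in auto)
    moreover have "w ^ 4 = w * w ^ 3" by (simp add: eval_nat_numeral)
    hence "exp (L (- 1 / w) - L w) * (4 / w) * w ^ 4 - exp (L (- 1 / w) - L w) * (4 * w ^ 3) = 0"
      using w by simp
    ultimately show ?thesis by (simp add: has_field_derivative_at_within)
  qed
  moreover have "convex upper_half_plane"
    unfolding upper_half_plane_def by (rule convex_halfspace_Im_gt)
  ultimately have "\<exists>c. \<forall>w\<in>upper_half_plane. h w = c"
    by (intro has_field_derivative_zero_constant)
  then obtain c where c: "\<And>w. w \<in> upper_half_plane \<Longrightarrow> h w = c" by auto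
  have "h \<i> = 1" by (simp add: h_def)
  hence "h z = 1" using c[of z] c[of \<i>] z by (simp add: upper_half_plane_def)
  hence "exp (L (- 1 / z)) = z ^ 4 * exp (L z)"
    using z by (auto simp: h_def exp_diff field_simps split: if_splits)
  thus ?thesis using eta8_eq[OF z] eta8_eq[OF Im_minus_inverse_pos[OF z]] by (simp add: L_def)
qed

subsection \<open>Families of modular forms\<close>

text \<open>The order of vanishing at infinity is measured in the parameter \<open>q\<^sup>1\<^sup>/\<^sup>2\<close>, the local parameter of level 2 at
  the cusp 0.\<close>

definition order_ge :: "int \<Rightarrow> (complex \<Rightarrow> complex) \<Rightarrow> bool" where
  "order_ge m f \<longleftrightarrow> (\<exists>g. g holomorphic_on ball 0 1 \<and>
     (\<forall>z. Im z > 0 \<longrightarrow> f z = nome (z / 2) powi m * g (nome (z / 2))))"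

lemma half_nome_in_ball: "Im z > 0 \<Longrightarrow> nome (z / 2) \<in> ball 0 1"
  using norm_nome_less_1[of "z / 2"] by simp

lemma nome_nonzero [simp]: "nome z \<noteq> 0"
  by (simp add: nome_def)

lemma half_nome_square: "nome (z / 2) ^ 2 = nome z"
  using nome_mult_of_nat[of 2 "z / 2"] by simp

lemma half_nome_surj:
  assumes "w \<noteq> 0"
  obtains z where "nome (z / 2) = w" "Im z = - ln (norm w) / pi" "\<bar>Re z\<bar> \<le> 1"
proof
  let ?z = "Ln w / (of_real pi * \<i>)"
  have eq: "?z = Complex (Im (Ln w) / pi) (- Re (Ln w) / pi)"
    by (simp add: complex_eq_iff Re_divide Im_divide power2_eq_square)
  show "nome (?z / 2) = w" using assms by (simp add: nome_def)
  show "Im ?z = - ln (norm w) / pi" unfolding eq using assms by simp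
  show "\<bar>Re ?z\<bar> \<le> 1" unfolding eq using mpi_less_Im_Ln[OF assms] Im_Ln_le_pi[OF assms]
    by (auto simp: abs_le_iff field_simps)
qed

lemma order_ge_mult:
  assumes "order_ge m f" "order_ge n g"
  shows "order_ge (m + n) (\<lambda>z. f z * g z)"
proof -
  obtain f' g' where "f' holomorphic_on ball 0 1" "g' holomorphic_on ball 0 1"
    "\<And>z. Im z > 0 \<Longrightarrow> f z = nome (z / 2) powi m * f' (nome (z / 2))"
    "\<And>z. Im z > 0 \<Longrightarrow> g z = nome (z / 2) powi n * g' (nome (z / 2))"
    using assms unfolding order_ge_def by blast
  thus ?thesis unfolding order_ge_def
    by (intro exI[of _ "\<lambda>w. f' w * g' w"]) (auto intro: holomorphic_on_mult simp: power_int_add)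
qed

lemma order_ge_add:
  assumes "order_ge m f" "order_ge m g"
  shows "order_ge m (\<lambda>z. f z + g z)"
proof -
  obtain f' g' where "f' holomorphic_on ball 0 1" "g' holomorphic_on ball 0 1"
    "\<And>z. Im z > 0 \<Longrightarrow> f z = nome (z / 2) powi m * f' (nome (z / 2))"
    "\<And>z. Im z > 0 \<Longrightarrow> g z = nome (z / 2) powi m * g' (nome (z / 2))"
    using assms unfolding order_ge_def by blast
  thus ?thesis unfolding order_ge_def
    by (intro exI[of _ "\<lambda>w. f' w + g' w"]) (auto intro: holomorphic_on_add simp: distrib_left)
qed

lemma order_ge_const: "order_ge 0 (\<lambda>_. c)"
  unfolding order_ge_def by (intro exI[of _ "\<lambda>_. c"]) auto

lemma order_ge_cmult: "order_ge m f \<Longrightarrow> order_ge m (\<lambda>z. c * f z)"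
  using order_ge_mult[OF order_ge_const] by fastforce

lemma order_ge_diff: "order_ge m f \<Longrightarrow> order_ge m g \<Longrightarrow> order_ge m (\<lambda>z. f z - g z)"
  using order_ge_add[of m f, OF _ order_ge_cmult[of m g "-1"]] by simp

lemma order_ge_mono:
  assumes "order_ge m f" "n \<le> m"
  shows "order_ge n f"
proof -
  obtain f' where f': "f' holomorphic_on ball 0 1"
    "\<And>z. Im z > 0 \<Longrightarrow> f z = nome (z / 2) powi m * f' (nome (z / 2))"
    using assms unfolding order_ge_def by blast
  have "f z = nome (z / 2) powi n * (nome (z / 2) ^ nat (m - n) * f' (nome (z / 2)))" if "Im z > 0" for z
  proof -
    have "nome (z / 2) powi m = nome (z / 2) powi (n + (m - n))" by simp
    also have "\<dots> = nome (z / 2) powi n * nome (z / 2) ^ nat (m - n)"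
      using assms(2) by (subst power_int_add) (auto simp: power_int_def)
    finally show ?thesis using f'(2)[OF that] by simp
  qed
  thus ?thesis unfolding order_ge_def using f'(1)
    by (intro exI[of _ "\<lambda>w. w ^ nat (m - n) * f' w"]) (auto intro!: holomorphic_intros)
qed

lemma order_ge_power: "order_ge m f \<Longrightarrow> order_ge (int n * m) (\<lambda>z. f z ^ n)"
proof (induction n)
  case 0
  thus ?case using order_ge_const[of 1] by simp
next
  case (Suc n)
  from order_ge_mult[OF Suc.prems Suc.IH[OF Suc.prems]] show ?case by (simp add: algebra_simps)
qed

lemma order_ge_cong: "(\<And>z. Im z > 0 \<Longrightarrow> f z = g z) \<Longrightarrow> order_ge m f \<Longrightarrow> order_ge m g"
  by (simp add: order_ge_def)

text \<open>Translation by 1 replaces the parameter \<open>nome (z / 2)\<close> by its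
  negative.\<close>

lemma order_ge_shift:
  assumes "order_ge m f"
  shows "order_ge m (\<lambda>z. f (z + 1))"
proof -
  obtain f' where f': "f' holomorphic_on ball 0 1"
    "\<And>z. Im z > 0 \<Longrightarrow> f z = nome (z / 2) powi m * f' (nome (z / 2))"
    using assms unfolding order_ge_def by blast
  have n: "nome ((z + 1) / 2) = - nome (z / 2)" for z
  proof -
    have "2 * of_real pi * \<i> * ((z + 1) / 2) = 2 * of_real pi * \<i> * (z / 2) + of_real pi * \<i>"
      by (simp add: algebra_simps add_divide_distrib)
    hence "nome ((z + 1) / 2) = nome (z / 2) * exp (of_real pi * \<i>)"
      unfolding nome_def by (simp only: exp_add)
    thus ?thesis by simp
  qed
  have "(\<lambda>w. (-1) powi m * f' (- w)) holomorphic_on ball 0 1"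
    by (intro holomorphic_intros holomorphic_on_compose_gen[of uminus "ball 0 1" f' "ball 0 1", unfolded o_def] f') auto
  moreover have "f (z + 1) = nome (z / 2) powi m * ((-1) powi m * f' (- nome (z / 2)))" if "Im z > 0" for z
    using f'(2)[of "z + 1"] that unfolding n
    by (simp add: power_int_mult_distrib[symmetric])
  ultimately show ?thesis unfolding order_ge_def by blast
qed

lemma order_ge_tendsto_0:
  assumes "order_ge 1 f"
  shows "(f \<longlongrightarrow> 0) (filtercomap Im at_top)"
proof -
  obtain f' where f': "f' holomorphic_on ball 0 1"
    "\<And>z. Im z > 0 \<Longrightarrow> f z = nome (z / 2) powi 1 * f' (nome (z / 2))"
    using assms unfolding order_ge_def by blast
  have lim: "((\<lambda>z. nome (z / 2)) \<longlongrightarrow> 0) (filtercomap Im at_top)"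
  proof (rule tendsto_norm_zero_cancel)
    have "((\<lambda>y. exp (- pi * y)) \<longlongrightarrow> 0) at_top"
      by (intro filterlim_compose[OF exp_at_bot]) 
         (intro filterlim_tendsto_neg_mult_at_bot[OF tendsto_const] filterlim_ident, simp)
    thus "((\<lambda>z. norm (nome (z / 2))) \<longlongrightarrow> 0) (filtercomap Im at_top)"
      unfolding norm_nome using filterlim_compose[OF _ filterlim_filtercomap[of Im at_top]] by fastforce
  qed
  have "continuous_on (ball 0 1) f'" by (rule holomorphic_on_imp_continuous_on[OF f'(1)])
  hence "isCont f' 0" using continuous_on_eq_continuous_at[of "ball 0 1" f'] by auto
  hence "((\<lambda>z. nome (z / 2) * f' (nome (z / 2))) \<longlongrightarrow> 0 * f' 0) (filtercomap Im at_top)"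
    by (intro tendsto_mult lim isCont_tendsto_compose[OF _ lim])
  moreover have "eventually (\<lambda>z. nome (z / 2) * f' (nome (z / 2)) = f z) (filtercomap Im at_top)"
    using eventually_filtercomapI[OF eventually_gt_at_top[of 0], of Im] f'(2)
    by (auto elim: eventually_mono)
  ultimately show ?thesis using Lim_transform_eventually by fastforce
qed

lemma filtercomap_Im_at_top_nontrivial: "filtercomap Im at_top \<noteq> bot"
  by (rule filtercomap_neq_bot_surj) (auto simp: surj_def intro: exI[of _ "Complex 0 _"])

lemma order_ge_pos_const:
  assumes "order_ge 1 f" "\<And>z. Im z > 0 \<Longrightarrow> f z = C"
  shows "C = 0"
proof -
  have "eventually (\<lambda>z. f z = C) (filtercomap Im at_top)"
    using eventually_filtercomapI[OF eventually_gt_at_top[of 0], of Im] assms(2)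
    by (auto elim: eventually_mono)
  hence "(f \<longlongrightarrow> C) (filtercomap Im at_top)"
    by (rule tendsto_eventually)
  thus ?thesis using order_ge_tendsto_0[OF assms(1)] filtercomap_Im_at_top_nontrivial tendsto_unique by blast
qed

text \<open>A modular form of level 2 is studied through its three translates under \<open>SL\<^sub>2(\<int>)\<close>, which are
  indexed by the nonzero rows \<open>(c, d)\<close> modulo 2, the form itself having index \<open>(0, 1)\<close>; the matrices
  act on the indices from the right. For level 1 all members of the family coincide.\<close>

definition modular_family :: "nat \<Rightarrow> (int \<Rightarrow> int \<Rightarrow> complex \<Rightarrow> complex) \<Rightarrow> bool" where
  "modular_family k h \<longleftrightarrow> even k \<and> (\<forall>c d. h c d = h (c mod 2) (d mod 2)) \<and>
     (\<forall>c d z. Im z > 0 \<longrightarrow> h c d (z + 1) = h c (c + d) z) \<and>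
     (\<forall>c d z. Im z > 0 \<longrightarrow> h c d (- 1 / z) = z ^ k * h d (- c) z)"

lemma modular_familyD:
  assumes "modular_family k h"
  shows "even k" "h c d = h (c mod 2) (d mod 2)"
    "Im z > 0 \<Longrightarrow> h c d (z + 1) = h c (c + d) z"
    "Im z > 0 \<Longrightarrow> h c d (- 1 / z) = z ^ k * h d (- c) z"
  using assms by (auto simp: modular_family_def)

lemma modular_family_cong:
  assumes "modular_family k h" "c mod 2 = c' mod 2" "d mod 2 = d' mod 2"
  shows "h c d = h c' d'"
  using modular_familyD(2)[OF assms(1)] assms(2,3) by metis

lemma modular_family_shift_nat:
  assumes "modular_family k h" "Im z > 0"
  shows "h c d (z + of_nat n) = h c (d + int n * c) z"
proof (induction n arbitrary: d)
  case (Suc n)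
  have "h c d (z + of_nat (Suc n)) = h c d ((z + of_nat n) + 1)" by (simp add: add_ac)
  also have "\<dots> = h c (c + d) (z + of_nat n)" using assms by (intro modular_familyD) auto
  finally show ?case by (simp add: Suc algebra_simps)
qed auto

lemma modular_family_shift:
  assumes "modular_family k h" "Im z > 0"
  shows "h c d (z + of_int n) = h c (d + n * c) z"
proof (cases "n \<ge> 0")
  case True
  thus ?thesis using modular_family_shift_nat[OF assms, of c d "nat n"] by simp
next
  case False
  have "h c (d + n * c) ((z + of_int n) + of_nat (nat (- n))) = h c (d + n * c + int (nat (- n)) * c) (z + of_int n)"
    using assms by (intro modular_family_shift_nat) auto
  thus ?thesis using False by simp
qed

lemma moebius_Im_pos:
  fixes a b c d :: int
  assumes "a * d - b * c = 1" "Im z > 0"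
  shows "Im ((of_int a * z + of_int b) / (of_int c * z + of_int d)) > 0"
    "of_int c * z + of_int d \<noteq> 0"
proof -
  show nz: "of_int c * z + of_int d \<noteq> 0"
  proof
    assume 0: "of_int c * z + of_int d = 0"
    hence "of_int c * Im z = 0" by (auto simp: complex_eq_iff)
    hence c: "c = 0" using assms by simp
    hence "d = 0" using 0 by simp
    thus False using assms c by simp
  qed
  have "Im ((of_int a * z + of_int b) * cnj (of_int c * z + of_int d)) = of_int (a * d - b * c) * Im z"
    by (simp add: algebra_simps)
  hence "Im ((of_int a * z + of_int b) / (of_int c * z + of_int d)) = Im z / norm (of_int c * z + of_int d) ^ 2"
    using assms(1) by (simp add: complex_div_cnj[of "of_int a * z + of_int b"] Im_divide_of_real flip: of_real_power)
  thus "Im ((of_int a * z + of_int b) / (of_int c * z + of_int d)) > 0"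
    using assms(2) nz by simp
qed

text \<open>The Euclidean algorithm on the column (a, c) writes the matrix as a word in translations
  and the inversion. At c = 0 the matrix may be the negative of a translation; its sign disappears
  because k is even and indices count modulo 2.\<close>

theorem modular_family_slash:
  fixes a b c d :: int
  assumes h: "modular_family k h" and "a * d - b * c = 1" "Im z > 0"
  shows "h u v ((of_int a * z + of_int b) / (of_int c * z + of_int d)) =
           (of_int c * z + of_int d) ^ k * h (u * a + v * c) (u * b + v * d) z"
  using assms(2)
proof (induction "nat \<bar>c\<bar>" arbitrary: a b c d u v rule: less_induct)
  case less
  note z = assms(3)
  show ?case
  proof (cases "c = 0")
    case True
    hence "a * d = 1" using less.prems by simp
    hence "a = d \<and> (d = 1 \<or> d = - 1)" by (auto simp: zmult_eq_1_iff)
    thus ?thesis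
    proof (elim conjE disjE)
      assume "a = d" "d = 1"
      thus ?thesis using True modular_family_shift[OF h z, of u v b] by (simp add: algebra_simps)
    next
      assume ad: "a = d" "d = - 1"
      have "h u (v + - b * u) = h (u * a + v * c) (u * b + v * d)"
      proof (rule modular_family_cong[OF h])
        have "v + - b * u - (u * b + v * d) = 2 * (v - u * b)" by (simp add: ad algebra_simps)
        thus "(v + - b * u) mod 2 = (u * b + v * d) mod 2" unfolding mod_eq_dvd_iff by simp
        have "u - (u * a + v * c) = 2 * u" by (simp add: ad True)
        thus "u mod 2 = (u * a + v * c) mod 2" unfolding mod_eq_dvd_iff by (metis dvd_triv_left)
      qed
      moreover have "even k" using h by (rule modular_familyD)
      ultimately show ?thesis using ad True modular_family_shift[OF h z, of u v "- b"]
        by (simp add: divide_simps)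
    qed
  next
    case False
    \<comment> \<open>The image of z is q - 1 / y, where y is the image of z under the matrix with
      rows (c, d) and (-a', -b').\<close>
    define q where "q = a div c"
    define a' where "a' = a mod c"
    define b' where "b' = b - q * d"
    have a: "a = q * c + a'" by (simp add: q_def a'_def)
    have b: "b = q * d + b'" by (simp add: b'_def)
    have det: "c * (- b') - d * (- a') = 1" using less.prems by (simp add: a b algebra_simps)
    have lt: "nat \<bar>- a'\<bar> < nat \<bar>c\<bar>"
      using False abs_mod_less[of c a] by (simp add: a'_def)
    define y where "y = (of_int c * z + of_int d) / (of_int (- a') * z + of_int (- b'))"
    note pos = moebius_Im_pos[OF det z] and pos' = moebius_Im_pos[OF less.prems z]
    have y: "Im y > 0" unfolding y_def by (rule pos)
    have "(of_int a * z + of_int b) / (of_int c * z + of_int d) = - 1 / y + of_int q"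
      unfolding y_def using pos'(2) pos(2) by (simp add: a b divide_simps) (simp add: algebra_simps)
    hence "h u v ((of_int a * z + of_int b) / (of_int c * z + of_int d)) = h u (v + q * u) (- 1 / y)"
      using modular_family_shift[OF h Im_minus_inverse_pos[OF y], of u v q] by simp
    also have "\<dots> = y ^ k * h (v + q * u) (- u) y" by (rule modular_familyD(4)[OF h y])
    also have "h (v + q * u) (- u) y = (of_int (- a') * z + of_int (- b')) ^ k *
        h ((v + q * u) * c + - u * - a') ((v + q * u) * d + - u * - b') z"
      unfolding y_def by (rule less.hyps[OF lt det])
    also have "(v + q * u) * c + - u * - a' = u * a + v * c" by (simp add: a algebra_simps)
    also have "(v + q * u) * d + - u * - b' = u * b + v * d" by (simp add: b algebra_simps)
    also have "y ^ k * ((of_int (- a') * z + of_int (- b')) ^ k * h (u * a + v * c) (u * b + v * d) z) =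
      (y * (of_int (- a') * z + of_int (- b'))) ^ k * h (u * a + v * c) (u * b + v * d) z"
      by (simp add: power_mult_distrib)
    also have "y * (of_int (- a') * z + of_int (- b')) = of_int c * z + of_int d"
      using pos(2) by (simp add: y_def)
    finally show ?thesis .
  qed
qed

definition cusp_indices :: "(int \<times> int) set" where
  "cusp_indices = {(0, 1), (1, 0), (1, 1)}"

lemma cusp_indices_closed:
  assumes "(c, d) \<in> cusp_indices"
  shows "(c mod 2, (d + n * c) mod 2) \<in> cusp_indices" "(d mod 2, (- c) mod 2) \<in> cusp_indices"
    "(- d mod 2, c mod 2) \<in> cusp_indices"
proof -
  have mod2: "(x mod 2, y mod 2) \<in> cusp_indices \<longleftrightarrow> odd x \<or> odd y" for x y :: int
    unfolding cusp_indices_def by (cases "even x"; cases "even y") (auto simp: even_iff_mod_2_eq_zero odd_iff_mod_2_eq_one)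
  have "odd c \<or> odd d" using assms by (auto simp: cusp_indices_def)
  thus "(c mod 2, (d + n * c) mod 2) \<in> cusp_indices" "(d mod 2, (- c) mod 2) \<in> cusp_indices"
    "(- d mod 2, c mod 2) \<in> cusp_indices" unfolding mod2 by auto
qed

text \<open>The maximum of all members of the family over the disc that corresponds to \<open>Im z \<ge> 1/2\<close> is
  attained in its interior: a point of the boundary can be translated to \<open>\<bar>Re z\<bar> \<le> 1/2\<close>, and
  \<open>z \<mapsto> -1/z\<close> moves it to height at least 1.\<close>

theorem modular_family_weight_0_constant:
  assumes h: "modular_family 0 h"
    and ord: "\<And>c d. (c, d) \<in> cusp_indices \<Longrightarrow> order_ge 0 (h c d)"
  shows "\<exists>C. \<forall>(c, d)\<in>cusp_indices. \<forall>z. Im z > 0 \<longrightarrow> h c d z = C"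
proof -
  have "\<forall>v. \<exists>g. v \<in> cusp_indices \<longrightarrow> g holomorphic_on ball 0 1 \<and>
     (\<forall>z. Im z > 0 \<longrightarrow> h (fst v) (snd v) z = g (nome (z / 2)))"
    using ord unfolding order_ge_def by (auto simp: split_paired_all)
  then obtain g where g: "\<And>v. v \<in> cusp_indices \<Longrightarrow> g v holomorphic_on ball 0 1"
    "\<And>v z. v \<in> cusp_indices \<Longrightarrow> Im z > 0 \<Longrightarrow> h (fst v) (snd v) z = g v (nome (z / 2))"
    by metis
  \<comment> \<open>The absolute value of \<open>nome (z / 2)\<close> at height 1/2.\<close>
  define r where "r = exp (- pi / 2)"
  have r: "0 < r" "r < 1" by (auto simp: r_def)
  have "\<exists>x\<in>cball 0 r. \<forall>y\<in>cball 0 r. norm (g v y) \<le> norm (g v x)" if "v \<in> cusp_indices" for v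
  proof (rule continuous_attains_sup)
    have "cball 0 r \<subseteq> ball (0::complex) 1" using r by auto
    thus "continuous_on (cball 0 r) (\<lambda>x. norm (g v x))"
      using holomorphic_on_imp_continuous_on[OF g(1)[OF that]] continuous_on_subset
      by (intro continuous_on_norm) blast
  qed (use r in auto)
  then obtain x where x: "\<And>v. v \<in> cusp_indices \<Longrightarrow> x v \<in> cball 0 r"
    "\<And>v y. v \<in> cusp_indices \<Longrightarrow> y \<in> cball 0 r \<Longrightarrow> norm (g v y) \<le> norm (g v (x v))"
    by metis
  define M where "M = Max ((\<lambda>v. norm (g v (x v))) ` cusp_indices)"
  have fin: "finite cusp_indices" "cusp_indices \<noteq> {}" by (auto simp: cusp_indices_def)
  have M: "norm (g v y) \<le> M" if "v \<in> cusp_indices" "y \<in> cball 0 r" for v y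
    using x(2)[OF that] that fin by (auto simp: M_def intro: order.trans[OF _ Max_ge])
  have "M \<in> (\<lambda>v. norm (g v (x v))) ` cusp_indices"
    unfolding M_def using fin by (intro Max_in) auto
  then obtain v where v: "v \<in> cusp_indices" "norm (g v (x v)) = M" by auto
  have "\<exists>u\<in>cusp_indices. \<exists>y\<in>ball 0 r. norm (g u y) = M"
  proof (cases "x v \<in> ball 0 r")
    case True
    thus ?thesis using v by blast
  next
    case False
    hence nx: "norm (x v) = r" using x(1)[OF v(1)] by auto
    hence "x v \<noteq> 0" using r by auto
    then obtain z0 where z0: "nome (z0 / 2) = x v" "Im z0 = - ln (norm (x v)) / pi" "\<bar>Re z0\<bar> \<le> 1"
      by (rule half_nome_surj)
    have Im0: "Im z0 = 1 / 2" using z0(2) by (simp add: nx r_def)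
    obtain c d where cd: "v = (c, d)" by force
    define n :: int where "n = (if Re z0 > 1 / 2 then 1 else if Re z0 < - 1 / 2 then - 1 else 0)"
    define z1 where "z1 = z0 - of_int n"
    have Im1: "Im z1 = 1 / 2" and Re1: "\<bar>Re z1\<bar> \<le> 1 / 2"
      using Im0 z0(3) by (auto simp: z1_def n_def)
    define d' where "d' = (d + n * c) mod 2"
    define c' where "c' = c mod 2"
    have v': "(c', d') \<in> cusp_indices" using cusp_indices_closed(1) v(1) by (auto simp: cd c'_def d'_def)
    have "h c d (z1 + of_int n) = h c (d + n * c) z1"
      using Im1 by (intro modular_family_shift[OF h]) auto
    also have "\<dots> = h c' d' z1" unfolding c'_def d'_def by (rule fun_cong[OF modular_familyD(2)[OF h]])
    finally have 1: "h c d z0 = h c' d' z1" by (simp add: z1_def)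
    define z2 where "z2 = - 1 / z1"
    have "norm z1 ^ 2 = Re z1 ^ 2 + 1 / 4" unfolding cmod_power2 Im1 by (simp add: power2_eq_square)
    also have "Re z1 ^ 2 = \<bar>Re z1\<bar> ^ 2" by simp
    also have "\<dots> \<le> (1 / 2) ^ 2" using Re1 by (intro power_mono) auto
    finally have le: "norm z1 ^ 2 \<le> 1 / 2" by (simp add: power2_eq_square)
    have n1: "norm z1 ^ 2 > 0" using Im1 by auto
    have Im2: "Im z2 \<ge> 1"
      unfolding z2_def Im_minus_inverse Im1 using le n1 by (simp add: field_simps)
    define u where "u = (- d' mod 2, c' mod 2)"
    have u: "u \<in> cusp_indices" unfolding u_def by (rule cusp_indices_closed(3)[OF v'])
    have "h (- d') c' z2 = h c' (- (- d')) z1"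
      unfolding z2_def using modular_familyD(4)[OF h, of z1 "- d'" c'] Im1 by simp
    hence 2: "h (fst u) (snd u) z2 = h c' d' z1"
      unfolding u_def using modular_familyD(2)[OF h, of "- d'" c'] by simp
    have "g u (nome (z2 / 2)) = g v (x v)"
      using g(2)[OF u, of z2] g(2)[OF v(1), of z0] 1 2 Im2 Im0 by (simp add: cd z0(1))
    moreover have "norm (nome (z2 / 2)) < r"
      using Im2 by (simp add: norm_nome r_def)
    ultimately show ?thesis using u v by (intro bexI[of _ u] bexI[of _ "nome (z2 / 2)"]) auto
  qed
  then obtain u y where u: "u \<in> cusp_indices" and y: "y \<in> ball 0 r" "norm (g u y) = M" by blast
  have "g u constant_on ball 0 1"
    by (rule maximum_modulus_principle[of _ _ "ball 0 r" y])
       (use g(1)[OF u] y M[OF u] r in auto)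
  then obtain C where C: "\<And>w. w \<in> ball 0 1 \<Longrightarrow> g u w = C" unfolding constant_on_def by blast
  have hu: "h (fst u) (snd u) z = C" if "Im z > 0" for z
    using g(2)[OF u that] C[OF half_nome_in_ball[OF that]] by simp
  \<comment> \<open>The translation and the inversion permute the three members transitively, so the
    constant passes from one member to all.\<close>
  have "h 1 0 z = C" if z: "Im z > 0" for z
  proof -
    from u consider "u = (0, 1)" | "u = (1, 0)" | "u = (1, 1)" by (auto simp: cusp_indices_def)
    thus ?thesis
    proof cases
      case 1
      thus ?thesis using hu[OF Im_minus_inverse_pos[OF z]] modular_familyD(4)[OF h z, of 0 1] by simp
    next
      case 2
      thus ?thesis using hu[OF z] by simp
    next
      case 3
      have "h 1 1 (z + 1) = h 1 2 z" using modular_familyD(3)[OF h z, of 1 1] by simp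
      also have "h 1 2 = h 1 0" by (rule modular_family_cong[OF h]) auto
      finally show ?thesis using hu[of "z + 1"] z 3 by simp
    qed
  qed
  note h10 = this
  have "h 1 1 z = C" if z: "Im z > 0" for z
    using h10[of "z + 1"] modular_familyD(3)[OF h z, of 1 0] z by simp
  moreover have "h 0 1 z = C" if z: "Im z > 0" for z
  proof -
    have "h 1 0 (- 1 / z) = h 0 (- 1) z" using modular_familyD(4)[OF h z, of 1 0] by simp
    also have "h 0 (- 1) = h 0 1" by (rule modular_family_cong[OF h]) auto
    finally show ?thesis using h10[OF Im_minus_inverse_pos[OF z]] by simp
  qed
  ultimately show ?thesis using h10 by (auto simp: cusp_indices_def)
qed

subsection \<open>Hecke operators\<close>

lemma holomorphic_on_ball_fps:
  assumes "g holomorphic_on ball 0 1"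
  shows "fps_conv_radius (fps_expansion g 0) \<ge> 1" "norm w < 1 \<Longrightarrow> eval_fps (fps_expansion g 0) w = g w"
proof -
  have *: "ball 0 1 = eball (0::complex) 1" by (simp add: one_ereal_def)
  show "fps_conv_radius (fps_expansion g 0) \<ge> 1"
    using conv_radius_fps_expansion[of g 0 1] assms by (simp add: *)
  show "norm w < 1 \<Longrightarrow> eval_fps (fps_expansion g 0) w = g w"
    using eval_fps_expansion'[of g 0 1 w] assms by (simp add: *)
qed

lemma nome_eval_fps_expansion:
  "g holomorphic_on ball 0 1 \<Longrightarrow> Im z > 0 \<Longrightarrow> nome_eval (fps_expansion g 0) z = g (nome z)"
  unfolding nome_eval_def by (rule holomorphic_on_ball_fps(2)) (auto intro: norm_nome_less_1)

lemma nome_surj: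
  assumes "w \<noteq> 0" "norm w < 1"
  obtains z where "nome z = w" "Im z > 0"
proof -
  obtain z where z: "nome (z / 2) = w" "Im z = - ln (norm w) / pi"
    using half_nome_surj[OF assms(1)] by metis
  have "ln (norm w) < 0" using assms by simp
  hence "- ln (norm w) / pi > 0" by (simp add: field_simps)
  hence "Im (z / 2) > 0" using z(2) by simp
  thus ?thesis using that z(1) by blast
qed

lemma eval_fps_holomorphic_on_ball:
  assumes "fps_conv_radius F \<ge> 1"
  shows "eval_fps F holomorphic_on ball 0 1"
proof (rule holomorphic_on_eval_fps)
  show "ball 0 1 \<subseteq> eball (0::complex) (fps_conv_radius F)"
    using assms eball_mono[of 1 "fps_conv_radius F" "0::complex"] by (simp add: one_ereal_def)
qed

text \<open>The nome takes every value of the punctured disc but never 0; the values at 0 agree by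
  continuity.\<close>

lemma fps_eq_if_nome_eval_eq:
  assumes F: "fps_conv_radius F \<ge> 1" and G: "fps_conv_radius G \<ge> 1"
    and eq: "\<And>z. Im z > 0 \<Longrightarrow> nome_eval F z = nome_eval G z"
  shows "F = G"
proof (rule eval_fps_eqD)
  have ne: "eval_fps F w = eval_fps G w" if "w \<noteq> 0" "norm w < 1" for w
    using eq nome_surj[OF that] by (metis nome_eval_def)
  have c: "isCont (eval_fps H) 0" if "fps_conv_radius H \<ge> 1" for H :: "complex fps"
    using holomorphic_on_imp_continuous_on[OF eval_fps_holomorphic_on_ball[OF that]]
      continuous_on_interior[of "ball 0 1" "eval_fps H" 0] by simp
  have "eval_fps F \<midarrow>0\<rightarrow> eval_fps F 0" "eval_fps G \<midarrow>0\<rightarrow> eval_fps G 0"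
    using c[OF F] c[OF G] by (auto simp: isCont_def)
  moreover have "eventually (\<lambda>w. eval_fps F w = eval_fps G w) (at 0)"
    unfolding eventually_at by (intro exI[of _ 1]) (auto intro!: ne)
  ultimately have "eval_fps G \<midarrow>0\<rightarrow> eval_fps F 0" "eval_fps G \<midarrow>0\<rightarrow> eval_fps G 0"
    using Lim_transform_eventually by blast+
  hence 0: "eval_fps F 0 = eval_fps G 0" by (rule LIM_unique)
  show "eventually (\<lambda>w. eval_fps F w = eval_fps G w) (nhds 0)"
    unfolding eventually_nhds_metric
  proof (intro exI[of _ 1] conjI allI impI)
    fix w :: complex assume "dist w 0 < 1"
    thus "eval_fps F w = eval_fps G w" using ne[of w] 0 by (cases "w = 0") auto
  qed simp
  show "fps_conv_radius F > 0" "fps_conv_radius G > 0"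
    using F G less_le_trans[of 0 "1::ereal"] by simp_all
qed

lemma fps_eq_0_if_nome_eval:
  "fps_conv_radius F \<ge> 1 \<Longrightarrow> (\<And>z. Im z > 0 \<Longrightarrow> nome_eval F z = 0) \<Longrightarrow> F = 0"
  by (rule fps_eq_if_nome_eval_eq) (auto simp: nome_eval_def)

lemma order_ge_half_eval:
  assumes G: "fps_conv_radius G \<ge> 1" and "\<And>i. i < m \<Longrightarrow> fps_nth G i = 0"
  shows "order_ge (int m) (\<lambda>z. nome_eval G (z / 2))"
proof -
  have eq: "eval_fps G w = w ^ m * eval_fps (fps_shift m G) w" if "norm w < 1" for w
  proof (cases "G = 0")
    case False
    hence "m \<le> subdegree G" using assms(2) by (intro subdegree_geI) auto
    hence "fps_shift m G * fps_X ^ m = G" by (simp add: fps_shift_times_fps_X_power)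
    hence "eval_fps G w = eval_fps (fps_shift m G * fps_X ^ m) w" by simp
    also have "ereal (norm w) < fps_conv_radius G"
      using that G less_le_trans[of "ereal (norm w)" 1] by simp
    hence "eval_fps (fps_shift m G * fps_X ^ m) w = eval_fps (fps_shift m G) w * w ^ m"
      by (subst eval_fps_mult) auto
    finally show ?thesis by simp
  qed auto
  have "eval_fps (fps_shift m G) holomorphic_on ball 0 1"
    using G by (intro eval_fps_holomorphic_on_ball) simp
  thus ?thesis unfolding order_ge_def nome_eval_def
    using eq norm_nome_less_1[of "_ / 2"] by (intro exI[of _ "eval_fps (fps_shift m G)"]) auto
qed

lemma order_ge_imp_half_eval:
  assumes "order_ge (int m) f"
  obtains G where "fps_conv_radius G \<ge> 1" "\<And>i. i < m \<Longrightarrow> fps_nth G i = 0"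
    "\<And>z. Im z > 0 \<Longrightarrow> f z = nome_eval G (z / 2)"
proof -
  obtain g where g: "g holomorphic_on ball 0 1"
    "\<And>z. Im z > 0 \<Longrightarrow> f z = nome (z / 2) powi int m * g (nome (z / 2))"
    using assms unfolding order_ge_def by blast
  let ?G = "fps_X ^ m * fps_expansion g 0"
  note r = holomorphic_on_ball_fps(1)[OF g(1)]
  have r': "fps_conv_radius ?G \<ge> 1" using r by (intro conv_radius_mult_ge_1) auto
  moreover have "f z = nome_eval ?G (z / 2)" if "Im z > 0" for z
    using g(2)[OF that] that r nome_eval_fps_expansion[OF g(1), of "z / 2"]
    by (subst nome_eval_mult) (auto simp: nome_eval_def)
  ultimately show ?thesis using that[of ?G] by (auto simp: fps_X_power_mult_nth)
qed

text \<open>\<open>fps_stretch p\<close> and \<open>fps_section p\<close> are the operators usually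
  called V_p and U_p.\<close>

definition fps_stretch :: "nat \<Rightarrow> complex fps \<Rightarrow> complex fps" where
  "fps_stretch p G = Abs_fps (\<lambda>n. if p dvd n then fps_nth G (n div p) else 0)"

definition fps_section :: "nat \<Rightarrow> complex fps \<Rightarrow> complex fps" where
  "fps_section p G = Abs_fps (\<lambda>n. fps_nth G (p * n))"

lemma fps_stretch_sums:
  assumes "p > 0" "fps_conv_radius G \<ge> 1" "norm q < 1"
  shows "(\<lambda>n. fps_nth (fps_stretch p G) n * q ^ n) sums eval_fps G (q ^ p)"
proof -
  have "norm (q ^ p) < 1" using assms by (simp add: norm_power power_less_one_iff)
  hence "ereal (norm (q ^ p)) < fps_conv_radius G"
    using assms(2) less_le_trans[of "ereal (norm (q ^ p))" 1] by simp
  from sums_eval_fps[OF this]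
  have "(\<lambda>n. fps_nth (fps_stretch p G) (p * n) * q ^ (p * n)) sums eval_fps G (q ^ p)"
    using assms(1) by (simp add: fps_stretch_def power_mult)
  moreover have "strict_mono (\<lambda>n. p * n)" using assms(1) by (auto intro: strict_monoI)
  moreover have "fps_nth (fps_stretch p G) n * q ^ n = 0" if "n \<notin> range (\<lambda>n. p * n)" for n
    using that by (auto simp: fps_stretch_def)
  ultimately show ?thesis
    using sums_mono_reindex[of "\<lambda>n. p * n" "\<lambda>n. fps_nth (fps_stretch p G) n * q ^ n"] by blast
qed

lemma conv_radius_stretch: "p > 0 \<Longrightarrow> fps_conv_radius G \<ge> 1 \<Longrightarrow> fps_conv_radius (fps_stretch p G) \<ge> 1"
  using fps_stretch_sums by (intro fps_conv_radius_ge_1) (auto simp: sums_iff)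

lemma nome_eval_stretch:
  assumes "p > 0" "fps_conv_radius G \<ge> 1" "Im z > 0"
  shows "nome_eval (fps_stretch p G) z = nome_eval G (of_nat p * z)"
  using sums_unique2[OF nome_eval_sums[OF conv_radius_stretch] fps_stretch_sums] assms norm_nome_less_1[OF assms(3)]
  unfolding nome_eval_def nome_mult_of_nat by blast

lemma order_ge_nome_eval:
  assumes "fps_conv_radius F \<ge> 1" "\<And>i. i < m \<Longrightarrow> fps_nth F i = 0"
  shows "order_ge (2 * int m) (nome_eval F)"
proof -
  have "order_ge (int (2 * m)) (\<lambda>z. nome_eval (fps_stretch 2 F) (z / 2))"
    using assms by (intro order_ge_half_eval conv_radius_stretch) (auto simp: fps_stretch_def)
  hence "order_ge (2 * int m) (\<lambda>z. nome_eval (fps_stretch 2 F) (z / 2))" by simp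
  thus ?thesis by (rule order_ge_cong[rotated]) (use assms in \<open>simp add: nome_eval_stretch\<close>)
qed

lemma sum_roots_of_unity:
  assumes "p > 0"
  shows "(\<Sum>j<p. nome (of_nat j / of_nat p) ^ n) = (if p dvd n then of_nat p else 0)"
proof -
  define x where "x = nome (of_nat n / of_nat p)"
  have 1: "nome (of_nat j / of_nat p) ^ n = x ^ j" for j
    unfolding x_def nome_mult_of_nat[symmetric] by (simp add: mult_ac)
  have xp: "x ^ p = 1"
    unfolding x_def nome_mult_of_nat[symmetric] using assms
    by (auto simp: nome_def exp_eq_1 intro: exI[of _ "int n"])
  have "x = 1 \<longleftrightarrow> p dvd n"
  proof
    assume "x = 1"
    moreover have "of_nat n / of_nat p = (of_real (real n / real p) :: complex)" by simp
    hence "x = exp (2 * of_real pi * \<i> * of_real (real n / real p))" by (simp only: x_def nome_def)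
    ultimately have "exp (2 * of_real pi * \<i> * of_real (real n / real p)) = 1" by simp
    then obtain m :: int where "2 * pi * (real n / real p) = of_int (2 * m) * pi"
      unfolding exp_eq_1 by (auto simp del: of_real_divide)
    hence "real n = of_int m * real p" using assms by (simp add: field_simps)
    hence "real_of_int (int n) = real_of_int (m * int p)" by simp
    hence "int n = m * int p" using of_int_eq_iff by blast
    thus "p dvd n" by (metis dvd_triv_right int_dvd_int_iff)
  next
    assume "p dvd n"
    then obtain m where "n = p * m" by auto
    thus "x = 1" using assms by (auto simp: x_def nome_def exp_eq_1 intro: exI[of _ "int m"])
  qed
  thus ?thesis unfolding 1 using xp by (auto simp: sum_gp_strict)
qed

text \<open>Averaging over the translates of w by 0, ..., p - 1 multiplies the coefficient of index
  n by a sum of roots of unity, which vanishes unless p divides n.\<close>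

lemma fps_section_sums:
  assumes p: "p > 0" and G: "fps_conv_radius G \<ge> 1" and w: "Im w > 0"
  shows "(\<lambda>n. fps_nth (fps_section p G) n * nome w ^ n) sums
     ((\<Sum>j<p. nome_eval G ((w + of_nat j) / of_nat p)) / of_nat p)"
proof -
  have Im: "Im ((w + of_nat j) / of_nat p) > 0" for j using p w by simp
  let ?f = "\<lambda>n. fps_nth G n * nome (w / of_nat p) ^ n * (if p dvd n then of_nat p else 0) / of_nat p"
  have "(\<lambda>n. (\<Sum>j<p. fps_nth G n * nome ((w + of_nat j) / of_nat p) ^ n) / of_nat p) sums
     ((\<Sum>j<p. nome_eval G ((w + of_nat j) / of_nat p)) / of_nat p)"
    by (intro sums_divide sums_sum nome_eval_sums G Im)
  moreover have "(\<Sum>j<p. fps_nth G n * nome ((w + of_nat j) / of_nat p) ^ n) / of_nat p = ?f n" for n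
  proof -
    have "nome ((w + of_nat j) / of_nat p) = nome (w / of_nat p) * nome (of_nat j / of_nat p)" for j
      by (simp add: nome_def exp_add[symmetric] algebra_simps add_divide_distrib)
    thus ?thesis by (simp only: power_mult_distrib sum_roots_of_unity[OF p, symmetric])
       (simp add: sum_distrib_left mult_ac)
  qed
  ultimately have "?f sums ((\<Sum>j<p. nome_eval G ((w + of_nat j) / of_nat p)) / of_nat p)" by simp
  moreover have "strict_mono (\<lambda>n. p * n)" using p by (auto intro: strict_monoI)
  moreover have "?f n = 0" if "n \<notin> range (\<lambda>n. p * n)" for n
    using that by auto
  ultimately have "(\<lambda>n. ?f (p * n)) sums ((\<Sum>j<p. nome_eval G ((w + of_nat j) / of_nat p)) / of_nat p)"
    using sums_mono_reindex[of "\<lambda>n. p * n" ?f] by blast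
  moreover have "nome (w / of_nat p) ^ (p * n) = nome w ^ n" for n
    unfolding power_mult nome_mult_of_nat[symmetric] using p by simp
  ultimately show ?thesis using p by (simp add: fps_section_def)
qed

lemma conv_radius_section:
  assumes "p > 0" "fps_conv_radius G \<ge> 1"
  shows "fps_conv_radius (fps_section p G) \<ge> 1"
proof (rule fps_conv_radius_ge_1)
  fix q :: complex assume q: "norm q < 1"
  show "summable (\<lambda>n. fps_nth (fps_section p G) n * q ^ n)"
  proof (cases "q = 0")
    case False
    then obtain w where "nome w = q" "Im w > 0" using nome_surj q by metis
    thus ?thesis using fps_section_sums[OF assms, of w] by (auto simp: sums_iff)
  qed (auto intro: summable_0_powser)
qed

lemma nome_eval_section:
  assumes "p > 0" "fps_conv_radius G \<ge> 1" "Im w > 0"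
  shows "nome_eval (fps_section p G) w = (\<Sum>j<p. nome_eval G ((w + of_nat j) / of_nat p)) / of_nat p"
  using sums_unique2[OF nome_eval_sums[OF conv_radius_section] fps_section_sums] assms by blast

definition hecke_fps :: "nat \<Rightarrow> nat \<Rightarrow> complex fps \<Rightarrow> complex fps" where
  "hecke_fps k p G = fps_section p G + fps_const (of_nat p ^ (k - 1)) * fps_stretch p G"

lemma conv_radius_hecke: "p > 0 \<Longrightarrow> fps_conv_radius G \<ge> 1 \<Longrightarrow> fps_conv_radius (hecke_fps k p G) \<ge> 1"
  unfolding hecke_fps_def
  by (rule order.trans[OF _ fps_conv_radius_add])
     (auto intro!: conv_radius_section conv_radius_const_mult conv_radius_stretch)

lemma nome_eval_hecke:
  assumes "p > 0" "fps_conv_radius G \<ge> 1" "Im w > 0"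
  shows "nome_eval (hecke_fps k p G) w = of_nat p ^ (k - 1) * nome_eval G (of_nat p * w) +
     (\<Sum>j<p. nome_eval G ((w + of_nat j) / of_nat p)) / of_nat p"
proof -
  have "nome_eval (hecke_fps k p G) w = nome_eval (fps_section p G) w + nome_eval (fps_const (of_nat p ^ (k - 1)) * fps_stretch p G) w"
    unfolding hecke_fps_def nome_eval_def using assms
    by (intro eval_fps_add nome_in_eball conv_radius_section conv_radius_const_mult conv_radius_stretch)
  thus ?thesis using assms
    by (simp add: nome_eval_section nome_eval_stretch nome_eval_cmult conv_radius_stretch)
qed

text \<open>The translations by even numbers keep the matrices of the Hecke operator congruent to the
  identity modulo 2, so that the operator acts on each member of a family separately.\<close>

definition hecke_family :: "nat \<Rightarrow> nat \<Rightarrow> (int \<Rightarrow> int \<Rightarrow> complex \<Rightarrow> complex) \<Rightarrow> int \<Rightarrow> int \<Rightarrow> complex \<Rightarrow> complex" where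
  "hecke_family k p h c d z = of_nat p ^ (k - 1) * h c d (of_nat p * z) +
     (\<Sum>j<p. h c d ((z + 2 * of_nat j) / of_nat p)) / of_nat p"

lemma hecke_family_half_eval:
  assumes "p > 0" "fps_conv_radius G \<ge> 1" "Im z > 0" "\<And>z. Im z > 0 \<Longrightarrow> h c d z = nome_eval G (z / 2)"
  shows "hecke_family k p h c d z = nome_eval (hecke_fps k p G) (z / 2)"
proof -
  have "hecke_family k p h c d z = of_nat p ^ (k - 1) * nome_eval G (of_nat p * (z / 2)) +
     (\<Sum>j<p. nome_eval G ((z / 2 + of_nat j) / of_nat p)) / of_nat p"
    unfolding hecke_family_def using assms(1,3)
    by (simp add: assms(4) add_divide_distrib mult_ac)
  thus ?thesis using assms by (simp add: nome_eval_hecke)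
qed

text \<open>T_p and V_2 commute for odd p. Hence \<open>hecke_family\<close>, which acts as T_p on
  expansions in q^(1/2), also acts as T_p on expansions in q.\<close>

lemma hecke_fps_stretch:
  assumes "odd p" "prime p"
  shows "hecke_fps k p (fps_stretch 2 F) = fps_stretch 2 (hecke_fps k p F)"
proof (rule fps_ext)
  fix n
  have c: "coprime 2 p" using assms by simp
  have "p dvd n \<longleftrightarrow> p dvd n div 2" if "even n"
    using that c by (auto elim!: evenE simp: coprime_commute coprime_dvd_mult_right_iff)
  moreover have "n div p div 2 = n div 2 div p" by (simp add: div_mult2_eq[symmetric] mult.commute)
  moreover have "even (n div p) \<longleftrightarrow> even n" if "p dvd n"
  proof -
    obtain m where "n = p * m" using \<open>p dvd n\<close> by (auto elim: dvdE)
    moreover have "p > 0" using assms(2) prime_gt_0_nat by blast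
    ultimately show ?thesis using assms by simp
  qed
  moreover have "p * n div 2 = p * (n div 2)" if "even n" using that by (auto elim!: evenE)
  ultimately show "fps_nth (hecke_fps k p (fps_stretch 2 F)) n = fps_nth (fps_stretch 2 (hecke_fps k p F)) n"
    using assms by (auto simp: hecke_fps_def fps_stretch_def fps_section_def)
qed

lemma hecke_family_nome_eval:
  assumes "prime p" "odd p" "fps_conv_radius F \<ge> 1" "Im z > 0"
    "\<And>z. Im z > 0 \<Longrightarrow> h c d z = nome_eval F z"
  shows "hecke_family k p h c d z = nome_eval (hecke_fps k p F) z"
proof -
  have p: "p > 0" using assms(1) prime_gt_0_nat by blast
  have "h c d z = nome_eval (fps_stretch 2 F) (z / 2)" if "Im z > 0" for z
    using assms(3,5) that by (simp add: nome_eval_stretch)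
  hence "hecke_family k p h c d z = nome_eval (hecke_fps k p (fps_stretch 2 F)) (z / 2)"
    using assms p by (intro hecke_family_half_eval conv_radius_stretch) auto
  thus ?thesis using assms p by (simp add: hecke_fps_stretch nome_eval_stretch conv_radius_hecke)
qed

text \<open>Both generators permute the p + 1 terms of the operator: the translation permutes the
  residues j, the inversion exchanges the terms at p z and z / p and permutes the other j by an
  involution.\<close>

theorem modular_family_hecke:
  assumes h: "modular_family k h" and p: "prime p" "odd p" and k: "k > 0"
  shows "modular_family k (hecke_family k p h)"
  unfolding modular_family_def
proof (intro conjI allI impI)
  show "even k" using h by (rule modular_familyD)
next
  fix c d
  show "hecke_family k p h c d = hecke_family k p h (c mod 2) (d mod 2)"
    unfolding hecke_family_def [abs_def] modular_familyD(2)[OF h, of c d] ..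
next
  fix c d z assume z: "Im z > 0"
  have p0: "p > 0" using p prime_gt_0_nat by blast
  have pz: "Im (of_nat p * z) > 0" using z p0 by simp
  have "h c d (of_nat p * (z + 1)) = h c d (of_nat p * z + of_int (int p))" by (simp add: algebra_simps)
  also have "\<dots> = h c (d + int p * c) (of_nat p * z)" by (rule modular_family_shift[OF h pz])
  also have "h c (d + int p * c) = h c (c + d)"
  proof (rule modular_family_cong[OF h refl])
    have "even (d + int p * c - (c + d))" using p by simp
    thus "(d + int p * c) mod 2 = (c + d) mod 2" by (simp only: mod_eq_dvd_iff)
  qed
  finally have 1: "h c d (of_nat p * (z + 1)) = h c (c + d) (of_nat p * z)" .
  \<comment> \<open>m is the inverse of 2 modulo p, so adding 1 to z replaces j by j + m. The
    integral translation left over, 2 t - 1, is odd and turns the index (c, d) into (c, c +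
    d).\<close>
  define m where "m = (p + 1) div 2"
  have m: "2 * m = p + 1" using p by (simp add: m_def)
  have bij: "bij_betw (\<lambda>j. (j + m) mod p) {..<p} {..<p}"
  proof -
    have "inj_on (\<lambda>j. (j + m) mod p) {..<p}"
    proof (rule inj_onI)
      fix i j assume "i \<in> {..<p}" "j \<in> {..<p}" "(i + m) mod p = (j + m) mod p"
      hence "[i + m = j + m] (mod p)" by (simp add: cong_def)
      hence "[i = j] (mod p)" by (simp add: cong_add_rcancel_nat)
      thus "i = j" using \<open>i \<in> _\<close> \<open>j \<in> _\<close> by (simp add: cong_def)
    qed
    moreover have "(\<lambda>j. (j + m) mod p) ` {..<p} \<subseteq> {..<p}" using p0 by auto
    ultimately show ?thesis by (simp add: bij_betw_def endo_inj_surj)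
  qed
  have "(\<Sum>j<p. h c d ((z + 1 + 2 * of_nat j) / of_nat p)) = (\<Sum>j<p. h c (c + d) ((z + 2 * of_nat ((j + m) mod p)) / of_nat p))"
  proof (rule sum.cong)
    fix j assume "j \<in> {..<p}"
    define r where "r = (j + m) mod p"
    define t where "t = int ((j + m) div p)"
    define w where "w = (z + 2 * of_nat r) / of_nat p"
    have "int (j + m) = t * int p + int r" by (simp add: t_def r_def flip: of_nat_mult of_nat_add)
    hence "2 * int j + int p + 1 = 2 * t * int p + 2 * int r" using m by linarith
    hence "1 + 2 * int j = 2 * int r + (2 * t - 1) * int p" by (simp add: algebra_simps)
    hence "(of_int (1 + 2 * int j) :: complex) = of_int (2 * int r + (2 * t - 1) * int p)" by simp
    hence e: "1 + 2 * of_nat j = 2 * of_nat r + of_int (2 * t - 1) * (of_nat p :: complex)" by simp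
    have "(z + 1 + 2 * of_nat j) / of_nat p = (z + (1 + 2 * of_nat j)) / of_nat p" by (simp add: add_ac)
    also have "\<dots> = w + of_int (2 * t - 1)"
      unfolding e w_def using p0 by (simp add: field_simps)
    finally have "h c d ((z + 1 + 2 * of_nat j) / of_nat p) = h c d (w + of_int (2 * t - 1))" by simp
    also have "\<dots> = h c (d + (2 * t - 1) * c) w"
      using z p0 by (intro modular_family_shift[OF h]) (simp add: w_def)
    also have "h c (d + (2 * t - 1) * c) = h c (c + d)"
    proof (rule modular_family_cong[OF h refl])
      have "even (d + (2 * t - 1) * c - (c + d))" by simp
      thus "(d + (2 * t - 1) * c) mod 2 = (c + d) mod 2" by (simp only: mod_eq_dvd_iff)
    qed
    finally show "h c d ((z + 1 + 2 * of_nat j) / of_nat p) = h c (c + d) ((z + 2 * of_nat ((j + m) mod p)) / of_nat p)"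
      by (simp add: w_def r_def)
  qed auto
  also have "\<dots> = (\<Sum>j<p. h c (c + d) ((z + 2 * of_nat j) / of_nat p))"
    by (rule sum.reindex_bij_betw[OF bij])
  finally show "hecke_family k p h c d (z + 1) = hecke_family k p h c (c + d) z"
    unfolding hecke_family_def 1 by simp
next
  fix c d z assume z: "Im z > 0"
  have p0: "p > 0" using p prime_gt_0_nat by blast
  have z0: "z \<noteq> 0" using z by auto
  have pk: "of_nat p ^ k = (of_nat p :: complex) * of_nat p ^ (k - 1)"
    using k by (metis power_eq_if bot_nat_0.not_eq_extremum)
  \<comment> \<open>The partner x of j is chosen so that p b = 4 j x + 1 for some b: then the matrix
    with rows (2 j, -b) and (p, -2 x) has determinant 1.\<close>
  have inverse_exists: "\<exists>x\<in>{1..<p}. p dvd 4 * j * x + 1" if "j \<in> {1..<p}" for j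
  proof -
    have "\<not> p dvd j" using that by (auto dest: dvd_imp_le)
    moreover have "\<not> p dvd 4"
    proof
      assume "p dvd 4"
      hence "p dvd 2 ^ 2" by simp
      hence "p dvd 2" using p(1) prime_dvd_power by blast
      thus False using p by (metis dvd_refl even_iff_mod_2_eq_zero primes_dvd_imp_eq two_is_prime_nat)
    qed
    ultimately have "coprime (4 * j) p"
      using p(1) by (metis coprime_commute prime_dvd_mult_iff prime_imp_coprime)
    then obtain y where "[4 * j * y = 1] (mod p)"
      using cong_solve_coprime_nat[of "4 * j" p] by auto
    hence "[4 * j * y * (p - 1) = 1 * (p - 1)] (mod p)" by (rule cong_scalar_right)
    then obtain x where x: "[4 * j * x = p - 1] (mod p)" by (auto simp: mult.assoc)
    hence "[4 * j * (x mod p) + 1 = p - 1 + 1] (mod p)"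
      by (intro cong_add) (auto simp: cong_def mod_mult_right_eq)
    hence d: "p dvd 4 * j * (x mod p) + 1" using p0 by (simp add: cong_def dvd_eq_mod_eq_0)
    moreover have "x mod p \<noteq> 0"
    proof
      assume "x mod p = 0"
      hence "p dvd 1" using d by simp
      thus False using p(1) by (simp add: prime_nat_iff)
    qed
    ultimately show ?thesis using p0 by (intro bexI[of _ "x mod p"]) auto
  qed
  define f where "f j = (SOME x. x \<in> {1..<p} \<and> p dvd 4 * j * x + 1)" for j
  have f: "f j \<in> {1..<p}" "p dvd 4 * j * f j + 1" if "j \<in> {1..<p}" for j
    using someI_ex[of "\<lambda>x. x \<in> {1..<p} \<and> p dvd 4 * j * x + 1"] inverse_exists[OF that]
    unfolding f_def by blast+
  have ff: "f (f j) = j" if j: "j \<in> {1..<p}" for j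
  proof -
    note fj = f[OF j] and ffj = f[OF f(1)[OF j]]
    have "[4 * f j * f (f j) + 1 = 4 * f j * j + 1] (mod p)"
    proof -
      have "[4 * f j * f (f j) + 1 = 0] (mod p)" using ffj(2) by (simp add: cong_0_iff)
      moreover have "4 * f j * j + 1 = 4 * j * f j + 1" by simp
      hence "[4 * f j * j + 1 = 0] (mod p)" using fj(2) by (simp only: cong_0_iff)
      ultimately show ?thesis by (meson cong_sym cong_trans)
    qed
    hence "[4 * f j * f (f j) = 4 * f j * j] (mod p)" by (rule iffD1[OF cong_add_rcancel_nat])
    moreover have "coprime (4 * f j) p"
    proof (rule ccontr)
      assume "\<not> coprime (4 * f j) p"
      hence "p dvd 4 * f j" using p(1) by (metis coprime_commute prime_imp_coprime)
      hence "p dvd 4 * f j * f (f j)" by (rule dvd_mult2)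
      hence "p dvd 1" using ffj(2) dvd_add_right_iff by blast
      thus False using p(1) by (simp add: prime_nat_iff)
    qed
    ultimately have "[f (f j) = j] (mod p)" by (metis cong_mult_lcancel_nat)
    thus ?thesis using ffj(1) j by (simp add: cong_def)
  qed
  have split0: "{..<p} = insert 0 {1..<p}" using p0 by auto
  have main: "h c d ((- 1 / z + 2 * of_nat j) / of_nat p) = z ^ k * h d (- c) ((z + 2 * of_nat (f j)) / of_nat p)"
    if j: "j \<in> {1..<p}" for j
  proof -
    obtain b where b: "4 * j * f j + 1 = p * b" using f(2)[OF j] by (auto elim: dvdE)
    hence bi: "4 * int j * int (f j) + 1 = int p * int b" using arg_cong[OF b, of int] by simp
    have "odd (p * b)" unfolding b[symmetric] by simp
    hence ob: "odd b" by simp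
    define w where "w = (z + 2 * of_nat (f j)) / of_nat p"
    have w: "Im w > 0" using z p0 by (simp add: w_def)
    have det: "(2 * int j) * (- 2 * int (f j)) - (- int b) * int p = 1" using bi by (simp add: algebra_simps)
    have pw: "of_nat p * w = z + 2 * of_nat (f j)" using p0 by (simp add: w_def)
    have e1: "of_int (int p) * w + of_int (- 2 * int (f j)) = z" using p0 by (simp add: w_def)
    have bc: "of_nat p * of_nat b = (4 * of_nat j * of_nat (f j) + 1 :: complex)"
      using arg_cong[OF b, of "of_nat :: nat \<Rightarrow> complex"] by (simp add: mult_ac add_ac)
    have "of_nat p * (of_int (2 * int j) * w + of_int (- int b)) = 2 * of_nat j * (of_nat p * w) - of_nat p * of_nat b"
      by (simp add: algebra_simps)
    also have "\<dots> = 2 * of_nat j * z - 1" unfolding bc pw by (simp add: algebra_simps)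
    finally have e2: "of_int (2 * int j) * w + of_int (- int b) = (2 * of_nat j * z - 1) / of_nat p"
      using p0 by (simp add: field_simps)
    have "(- 1 / z + 2 * of_nat j) / of_nat p = ((2 * of_nat j * z - 1) / of_nat p) / z"
      using z0 by (simp add: field_simps)
    also have "\<dots> = (of_int (2 * int j) * w + of_int (- int b)) / (of_int (int p) * w + of_int (- 2 * int (f j)))"
      unfolding e1 e2 ..
    finally have "h c d ((- 1 / z + 2 * of_nat j) / of_nat p) =
       (of_int (int p) * w + of_int (- 2 * int (f j))) ^ k * h (c * (2 * int j) + d * int p) (c * (- int b) + d * (- 2 * int (f j))) w"
      using modular_family_slash[OF h det w, of c d] by simp
    \<comment> \<open>As p and b are odd, the matrix is congruent to the inversion modulo 2.\<close>
    also have "h (c * (2 * int j) + d * int p) (c * (- int b) + d * (- 2 * int (f j))) = h d (- c)"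
    proof (rule modular_family_cong[OF h])
      have "even (c * (2 * int j) + d * int p - d)" using p by simp
      thus "(c * (2 * int j) + d * int p) mod 2 = d mod 2" by (simp only: mod_eq_dvd_iff)
      have "even (c * (- int b) + d * (- 2 * int (f j)) - (- c))" using ob by simp
      thus "(c * (- int b) + d * (- 2 * int (f j))) mod 2 = (- c) mod 2" by (simp only: mod_eq_dvd_iff)
    qed
    finally show ?thesis unfolding e1 by (simp add: w_def)
  qed
  have "(\<Sum>j\<in>{1..<p}. h c d ((- 1 / z + 2 * of_nat j) / of_nat p)) =
      (\<Sum>j\<in>{1..<p}. z ^ k * h d (- c) ((z + 2 * of_nat (f j)) / of_nat p))"
    by (rule sum.cong) (use main in auto)
  also have "\<dots> = (\<Sum>j\<in>{1..<p}. z ^ k * h d (- c) ((z + 2 * of_nat j) / of_nat p))"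
    by (rule sum.reindex_bij_witness[of _ f f]) (use f(1) ff in auto)
  finally have S: "(\<Sum>j\<in>{1..<p}. h c d ((- 1 / z + 2 * of_nat j) / of_nat p)) =
      z ^ k * (\<Sum>j\<in>{1..<p}. h d (- c) ((z + 2 * of_nat j) / of_nat p))"
    by (simp add: sum_distrib_left)
  have A: "h c d (of_nat p * (- 1 / z)) = (z / of_nat p) ^ k * h d (- c) (z / of_nat p)"
    using modular_familyD(4)[OF h, of "z / of_nat p" c d] z p0 by (simp add: field_simps)
  have B: "h c d ((- 1 / z) / of_nat p) = (of_nat p * z) ^ k * h d (- c) (of_nat p * z)"
    using modular_familyD(4)[OF h, of "of_nat p * z" c d] z p0 by (simp add: field_simps)
  show "hecke_family k p h c d (- 1 / z) = z ^ k * hecke_family k p h d (- c) z"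
  proof -
    have sum0: "(\<Sum>j<p. g j) = g 0 + (\<Sum>j\<in>{1..<p}. g j)" for g :: "nat \<Rightarrow> complex"
      unfolding split0 by (subst sum.insert) auto
    have alg: "Q * (x / (P * Q) * H1) + (P * Q * x * H2 + x * T) / P = x * (Q * H2 + (H1 + T) / P)"
      if "P \<noteq> 0" "Q \<noteq> 0" for P Q x H1 H2 T :: complex
      using that by (simp add: field_simps)
    have 0: "- 1 / z + 2 * of_nat 0 = - 1 / z" "z + 2 * of_nat 0 = z" by simp_all
    show ?thesis
      unfolding hecke_family_def sum0 S 0 A B power_divide power_mult_distrib pk
      by (rule alg) (use p0 in auto)
  qed
qed

text \<open>Of two coprime numbers one is odd, so the eigenvalues at odd primes suffice.\<close>

lemma multiplicative_if_hecke:
  assumes F1: "fps_nth F 1 = 1"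
    and hecke: "\<And>p. prime p \<Longrightarrow> odd p \<Longrightarrow> \<exists>a. \<forall>n>0. fps_nth (hecke_fps k p F) n = a * fps_nth F n"
  shows "multiplicative_fps F"
proof -
  have pp: "fps_nth F (p ^ r * n) = fps_nth F (p ^ r) * fps_nth F n"
    if p: "prime p" "odd p" "\<not> p dvd n" "n > 0" for p r n
  proof -
    have p0: "p > 0" using p prime_gt_0_nat by blast
    obtain a where a: "\<And>n. n > 0 \<Longrightarrow> fps_nth (hecke_fps k p F) n = a * fps_nth F n"
      using hecke[OF p(1,2)] by blast
    \<comment> \<open>Two consecutive exponents are carried along because the Hecke relation is a
      recurrence of order two in r.\<close>
    have "fps_nth F (p ^ r * n) = fps_nth F (p ^ r) * fps_nth F n \<and>
       fps_nth F (p ^ Suc r * n) = fps_nth F (p ^ Suc r) * fps_nth F n"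
    proof (induction r)
      case 0
      have "fps_nth F (p * n) = a * fps_nth F n"
        using a[OF p(4)] p by (simp add: hecke_fps_def fps_section_def fps_stretch_def)
      moreover have "fps_nth F p = a"
        using a[of 1] p F1 by (auto simp: hecke_fps_def fps_section_def fps_stretch_def prime_nat_iff)
      ultimately show ?case using F1 by simp
    next
      case (Suc r)
      have rec: "fps_nth F (p ^ Suc (Suc r) * m) = a * fps_nth F (p ^ Suc r * m) - of_nat p ^ (k - 1) * fps_nth F (p ^ r * m)"
        if "m > 0" for m
      proof -
        have "p ^ Suc r * m div p = p ^ r * m" using p0 by simp
        thus ?thesis using a[of "p ^ Suc r * m"] that p0
          by (simp add: hecke_fps_def fps_section_def fps_stretch_def mult_ac eq_diff_eq)
      qed
      have "fps_nth F (p ^ Suc (Suc r) * n) =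
          a * (fps_nth F (p ^ Suc r) * fps_nth F n) - of_nat p ^ (k - 1) * (fps_nth F (p ^ r) * fps_nth F n)"
        using Suc rec[OF p(4)] by (simp del: power_Suc)
      also have "\<dots> = (a * fps_nth F (p ^ Suc r) - of_nat p ^ (k - 1) * fps_nth F (p ^ r)) * fps_nth F n"
        by (simp add: algebra_simps del: power_Suc)
      also have "a * fps_nth F (p ^ Suc r) - of_nat p ^ (k - 1) * fps_nth F (p ^ r) = fps_nth F (p ^ Suc (Suc r))"
        using rec[of 1] by (simp del: power_Suc)
      finally show ?case using Suc by blast
    qed
    thus ?thesis by blast
  qed
  have odd: "fps_nth F (m * n) = fps_nth F m * fps_nth F n"
    if "odd m" "n > 0" "coprime m n" for m n
    using that
  proof (induction m arbitrary: n rule: less_induct)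
    case (less m)
    show ?case
    proof (cases "m = 1")
      case False
      have m0: "m > 0" using less.prems by (auto intro: Nat.gr0I)
      obtain p where p: "prime p" "p dvd m" using False prime_factor_nat by blast
      hence op: "odd p" using less.prems(1) by (meson dvd_trans)
      obtain m' where m': "m = p ^ multiplicity p m * m'" "\<not> p dvd m'"
        using multiplicity_decompose'[of m p] m0 p by (auto simp: prime_nat_iff)
      define r where "r = multiplicity p m"
      have mr: "m = p ^ r * m'" unfolding r_def by (rule m'(1))
      have "r \<noteq> 0"
      proof
        assume "r = 0"
        hence "m = m'" using mr by simp
        thus False using p(2) m'(2) by blast
      qed
      hence "p ^ r > 1" using one_less_power[OF prime_gt_1_nat[OF p(1)]] by simp
      moreover have m'0: "m' > 0" using m0 mr by (auto intro: Nat.gr0I)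
      ultimately have lt: "m' < m" using mr n_less_m_mult_n[of m' "p ^ r"] by simp
      have "odd m'" using less.prems(1) mr by simp
      moreover have "coprime m' n" using less.prems(3) mr by simp
      ultimately have IH: "fps_nth F (m' * n) = fps_nth F m' * fps_nth F n" using less.IH[OF lt] less.prems by blast
      have "\<not> p dvd n"
      proof
        assume "p dvd n"
        hence "p dvd 1" using p(2) less.prems(3) coprime_common_divisor by blast
        thus False using p(1) by (simp add: prime_nat_iff)
      qed
      hence "\<not> p dvd m' * n" using m'(2) p(1) prime_dvd_mult_iff by blast
      hence "fps_nth F (p ^ r * (m' * n)) = fps_nth F (p ^ r) * fps_nth F (m' * n)"
        using p op m'0 less.prems by (intro pp) auto
      moreover have "fps_nth F m = fps_nth F (p ^ r) * fps_nth F m'"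
        using pp[OF p(1) op m'(2) m'0, of r] mr by simp
      ultimately show ?thesis using IH mr by (simp add: mult_ac)
    qed (use F1 in simp)
  qed
  show ?thesis unfolding multiplicative_fps_def
  proof (intro conjI F1 allI impI)
    fix m n :: nat assume mn: "m > 0" "n > 0" "coprime m n"
    show "fps_nth F (m * n) = fps_nth F m * fps_nth F n"
    proof (cases "odd m")
      case False
      hence "odd n" using mn(3) by (metis coprime_common_divisor odd_one)
      thus ?thesis using odd[of n m] mn by (simp add: mult_ac coprime_commute)
    qed (use odd mn in blast)
  qed
qed

section \<open>Modular forms as power series, and the arithmetic of families\<close>

lemma Im_inverse_neg [simp]: "Im z > 0 \<Longrightarrow> Im (1 / z) < 0"
  using Im_minus_inverse_pos[of z] by simp

lemma nome_eval_const [simp]: "nome_eval (fps_const c) z = c"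
  by (simp add: nome_eval_def)

text \<open>Periodicity and holomorphy at infinity are built into being a power series in q, so only
  the inversion remains to be required.\<close>

definition modular_series :: "nat \<Rightarrow> complex fps \<Rightarrow> bool" where
  "modular_series k F \<longleftrightarrow> even k \<and> fps_conv_radius F \<ge> 1 \<and>
     (\<forall>z. Im z > 0 \<longrightarrow> nome_eval F (- 1 / z) = z ^ k * nome_eval F z)"

lemma modular_seriesD:
  assumes "modular_series k F"
  shows "even k" "fps_conv_radius F \<ge> 1" "Im z > 0 \<Longrightarrow> nome_eval F (- 1 / z) = z ^ k * nome_eval F z"
  using assms by (auto simp: modular_series_def)

lemma modular_series_mult:
  "modular_series k F \<Longrightarrow> modular_series l G \<Longrightarrow> modular_series (k + l) (F * G)"
  by (auto simp: modular_series_def conv_radius_mult_ge_1 nome_eval_mult Im_minus_inverse_pos power_add)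

lemma modular_series_diff:
  "modular_series k F \<Longrightarrow> modular_series k G \<Longrightarrow> modular_series k (F - G)"
  by (auto simp: modular_series_def conv_radius_diff_ge_1 nome_eval_diff Im_minus_inverse_pos algebra_simps)

lemma modular_series_cmult: "modular_series k F \<Longrightarrow> modular_series k (fps_const c * F)"
  by (auto simp: modular_series_def conv_radius_const_mult nome_eval_cmult Im_minus_inverse_pos)

lemma modular_series_family: "modular_series k F \<Longrightarrow> modular_family k (\<lambda>_ _. nome_eval F)"
  by (auto simp: modular_series_def modular_family_def nome_eval_plus_1)

lemma modular_family_mult:
  "modular_family k h \<Longrightarrow> modular_family l r \<Longrightarrow> modular_family (k + l) (\<lambda>c d z. h c d z * r c d z)"
  unfolding modular_family_def by (auto simp: power_add; metis)

lemma modular_family_divide: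
  assumes "modular_family (k + l) h" "modular_family l r"
  shows "modular_family k (\<lambda>c d z. h c d z / r c d z)"
proof -
  have "h c d (- 1 / z) / r c d (- 1 / z) = z ^ k * (h d (- c) z / r d (- c) z)" if "Im z > 0" for c d z
  proof -
    have "z \<noteq> 0" using that by auto
    thus ?thesis unfolding modular_familyD(4)[OF assms(1) that] modular_familyD(4)[OF assms(2) that]
      by (simp add: power_add)
  qed
  moreover have "even k" using modular_familyD(1)[OF assms(1)] modular_familyD(1)[OF assms(2)] by simp
  moreover have "(\<lambda>z. h c d z / r c d z) = (\<lambda>z. h (c mod 2) (d mod 2) z / r (c mod 2) (d mod 2) z)" for c d
    using modular_familyD(2)[OF assms(1), of c d] modular_familyD(2)[OF assms(2), of c d] by simp
  moreover have "h c d (z + 1) / r c d (z + 1) = h c (c + d) z / r c (c + d) z" if "Im z > 0" for c d z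
    using modular_familyD(3)[OF assms(1) that] modular_familyD(3)[OF assms(2) that] by simp
  ultimately show ?thesis unfolding modular_family_def by blast
qed

lemma modular_family_diff:
  "modular_family k h \<Longrightarrow> modular_family k r \<Longrightarrow> modular_family k (\<lambda>c d z. h c d z - r c d z)"
  unfolding modular_family_def by (auto simp: right_diff_distrib; metis)

lemma modular_family_cmult:
  "modular_family k h \<Longrightarrow> modular_family k (\<lambda>c d z. a * h c d z)"
  unfolding modular_family_def by (auto; metis)

lemma modular_family_power:
  "modular_family k h \<Longrightarrow> modular_family (n * k) (\<lambda>c d z. h c d z ^ n)"
  unfolding modular_family_def by (auto simp: power_mult_distrib power_mult mult.commute[of n]; metis)

text \<open>The quotient has weight 0 and no poles: \<open>m\<close> bounds the order of
  \<open>h\<close> from below and that of \<open>r\<close> from above at each index.\<close>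

theorem modular_family_proportional:
  assumes h: "modular_family k h" and r: "modular_family k r"
    and ord: "\<And>c d. (c, d) \<in> cusp_indices \<Longrightarrow> order_ge (m c d) (h c d)"
      "\<And>c d. (c, d) \<in> cusp_indices \<Longrightarrow> order_ge (- m c d) (\<lambda>z. 1 / r c d z)"
    and nz: "\<And>c d z. (c, d) \<in> cusp_indices \<Longrightarrow> Im z > 0 \<Longrightarrow> r c d z \<noteq> 0"
  shows "\<exists>C. \<forall>(c, d)\<in>cusp_indices. \<forall>z. Im z > 0 \<longrightarrow> h c d z = C * r c d z"
proof -
  have "modular_family 0 (\<lambda>c d z. h c d z / r c d z)" using h r by (intro modular_family_divide) auto
  moreover have "order_ge 0 (\<lambda>z. h c d z / r c d z)" if "(c, d) \<in> cusp_indices" for c d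
    using order_ge_mult[OF ord(1)[OF that] ord(2)[OF that]] by simp
  ultimately obtain C where "\<forall>(c, d)\<in>cusp_indices. \<forall>z. Im z > 0 \<longrightarrow> h c d z / r c d z = C"
    using modular_family_weight_0_constant by blast
  thus ?thesis using nz by (intro exI[of _ C]) (force simp: field_simps)
qed

subsection \<open>Level 1\<close>

text \<open>q times the 24th power of Euler's product, as an exponential so that it visibly has no
  zeros in the upper half plane.\<close>

definition discriminant :: "complex fps" where
  "discriminant = fps_X * fps_expansion (\<lambda>q. exp (24 * eval_fps log_euler q)) 0"

lemma euler_exp_holomorphic: "(\<lambda>q. exp (a * eval_fps log_euler q)) holomorphic_on ball 0 1"
  by (intro holomorphic_intros eval_fps_holomorphic_on_ball conv_radius_log_euler)

lemma conv_radius_discriminant: "fps_conv_radius discriminant \<ge> 1"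
  unfolding discriminant_def
  by (intro conv_radius_mult_ge_1 holomorphic_on_ball_fps euler_exp_holomorphic) auto

lemma nome_eval_discriminant:
  assumes "Im z > 0"
  shows "nome_eval discriminant z = nome z * exp (24 * nome_eval log_euler z)"
proof -
  have "nome_eval discriminant z = nome_eval fps_X z * nome_eval (fps_expansion (\<lambda>q. exp (24 * eval_fps log_euler q)) 0) z"
    unfolding discriminant_def
    by (intro nome_eval_mult holomorphic_on_ball_fps euler_exp_holomorphic assms) auto
  thus ?thesis using nome_eval_fps_expansion[OF euler_exp_holomorphic assms, of 24] by (simp add: nome_eval_def)
qed

lemma discriminant_nth_0_1 [simp]: "fps_nth discriminant 0 = 0" "fps_nth discriminant (Suc 0) = 1"
  by (simp_all add: discriminant_def fps_expansion_def eval_fps_at_0 log_euler_def)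

lemma discriminant_nonzero: "Im z > 0 \<Longrightarrow> nome_eval discriminant z \<noteq> 0"
  by (simp add: nome_eval_discriminant)

lemma modular_series_discriminant: "modular_series 12 discriminant"
proof -
  have eq: "nome_eval discriminant z = (dedekind_eta z ^ 8) ^ 3" if "Im z > 0" for z
    unfolding eta8_eq[OF that] nome_eval_discriminant[OF that]
    by (simp add: nome_def exp_of_nat_mult[symmetric] exp_add[symmetric] algebra_simps)
  have "nome_eval discriminant (- 1 / z) = z ^ 12 * nome_eval discriminant z" if "Im z > 0" for z
    unfolding eq[OF that] eq[OF Im_minus_inverse_pos[OF that]] eta8_minus_inverse[OF that]
    by (simp add: power_mult_distrib power_mult[symmetric])
  thus ?thesis by (simp add: modular_series_def conv_radius_discriminant)
qed

lemma order_ge_euler_exp: "order_ge 0 (\<lambda>z. exp (a * nome_eval log_euler z))"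
proof -
  have "order_ge (int 0) (\<lambda>z. nome_eval (fps_stretch 2 (fps_expansion (\<lambda>q. exp (a * eval_fps log_euler q)) 0)) (z / 2))"
    by (intro order_ge_half_eval conv_radius_stretch holomorphic_on_ball_fps euler_exp_holomorphic) auto
  hence "order_ge 0 (\<lambda>z. nome_eval (fps_stretch 2 (fps_expansion (\<lambda>q. exp (a * eval_fps log_euler q)) 0)) (z / 2))"
    by simp
  thus ?thesis
  proof (rule order_ge_cong[rotated])
    fix z :: complex assume z: "0 < Im z"
    show "nome_eval (fps_stretch 2 (fps_expansion (\<lambda>q. exp (a * eval_fps log_euler q)) 0)) (z / 2) =
        exp (a * nome_eval log_euler z)"
      using z nome_eval_fps_expansion[OF euler_exp_holomorphic z, of a]
      by (simp add: nome_eval_stretch holomorphic_on_ball_fps euler_exp_holomorphic nome_eval_def[of log_euler])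
  qed
qed

lemma order_ge_half_nome: "order_ge m (\<lambda>z. nome (z / 2) powi m)"
  unfolding order_ge_def by (intro exI[of _ "\<lambda>_. 1"]) auto

lemma order_ge_inverse_discriminant: "order_ge (- 2) (\<lambda>z. 1 / nome_eval discriminant z)"
proof -
  have "order_ge (- 2 + 0) (\<lambda>z. nome (z / 2) powi (- 2) * exp (- 24 * nome_eval log_euler z))"
    by (intro order_ge_mult order_ge_half_nome order_ge_euler_exp)
  hence "order_ge (- 2) (\<lambda>z. nome (z / 2) powi (- 2) * exp (- 24 * nome_eval log_euler z))" by simp
  thus ?thesis
    by (rule order_ge_cong[rotated])
       (simp add: nome_eval_discriminant power_int_minus half_nome_square exp_minus field_simps)
qed

lemma E2_eq_theta: "E2 = 1 + fps_const 24 * theta log_euler"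
  by (rule fps_ext) (auto simp: E2_def log_euler_def)

lemma nome_eval_E2:
  assumes "Im z > 0"
  shows "nome_eval E2 z = 1 + 24 * nome_eval (theta log_euler) z"
proof -
  have "nome_eval E2 z = eval_fps 1 (nome z) + nome_eval (fps_const 24 * theta log_euler) z"
    unfolding E2_eq_theta nome_eval_def using assms
    by (intro eval_fps_add nome_in_eball conv_radius_const_mult conv_radius_theta conv_radius_log_euler) auto
  thus ?thesis using assms by (simp add: nome_eval_cmult conv_radius_theta conv_radius_log_euler)
qed

lemma nome_eval_theta_eqI:
  assumes F: "fps_conv_radius F \<ge> 1" and z: "Im z > 0"
    and f: "\<And>z. Im z > 0 \<Longrightarrow> nome_eval F z = f z"
    and d: "(f has_field_derivative 2 * of_real pi * \<i> * D) (at z)"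
  shows "nome_eval (theta F) z = D"
proof -
  have "open {z. Im z > 0}" by (intro open_Collect_less continuous_intros)
  hence "(nome_eval F has_field_derivative 2 * of_real pi * \<i> * D) (at z)"
    by (intro has_field_derivative_transform_within_open[OF d, of "{z. Im z > 0}"]) (use z f in auto)
  from DERIV_unique[OF nome_eval_has_derivative[OF F z] this] show ?thesis by simp
qed

text \<open>The logarithmic derivative of the product. It also serves as the recursion that yields
  the first coefficients.\<close>

lemma theta_discriminant: "theta discriminant = E2 * discriminant"
proof (rule fps_eq_if_nome_eval_eq)
  fix z assume z: "Im z > 0"
  have "((\<lambda>z. nome z * exp (24 * nome_eval log_euler z)) has_field_derivative
      2 * of_real pi * \<i> * (nome_eval E2 z * nome_eval discriminant z)) (at z)"
    using z by (auto intro!: derivative_eq_intros nome_eval_has_derivative conv_radius_log_euler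
        simp: nome_eval_E2 nome_eval_discriminant algebra_simps)
  hence "nome_eval (theta discriminant) z = nome_eval E2 z * nome_eval discriminant z"
    using z nome_eval_discriminant by (intro nome_eval_theta_eqI[OF conv_radius_discriminant]) auto
  thus "nome_eval (theta discriminant) z = nome_eval (E2 * discriminant) z"
    using z by (simp add: nome_eval_mult conv_radius_E2 conv_radius_discriminant)
qed (auto intro!: conv_radius_theta conv_radius_mult_ge_1 conv_radius_E2 conv_radius_discriminant)

text \<open>F^12 / Delta^k has weight 0 and positive order at infinity, hence is the constant 0.
  This plays the part of the valence formula.\<close>

lemma modular_series_order_0:
  assumes F: "modular_series k F" and 0: "\<And>i. i < m \<Longrightarrow> fps_nth F i = 0" and k: "k < 12 * m"
  shows "F = 0"
proof -
  note fam = modular_series_family[OF F] and famD = modular_series_family[OF modular_series_discriminant]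
  have "modular_family (0 + k * 12) (\<lambda>_ _ z. nome_eval F z ^ 12)"
    using modular_family_power[OF fam, of 12] by (simp add: mult.commute)
  hence "modular_family 0 (\<lambda>_ _ z. nome_eval F z ^ 12 / nome_eval discriminant z ^ k)"
    by (rule modular_family_divide[OF _ modular_family_power[OF famD]])
  moreover have "order_ge (int 12 * (2 * int m) + int k * (- 2)) (\<lambda>z. nome_eval F z ^ 12 * (1 / nome_eval discriminant z) ^ k)"
    using modular_seriesD(2)[OF F] 0
    by (intro order_ge_mult order_ge_power order_ge_nome_eval order_ge_inverse_discriminant)
  hence ord: "order_ge 1 (\<lambda>z. nome_eval F z ^ 12 / nome_eval discriminant z ^ k)"
    using k by (intro order_ge_mono[of "int 12 * (2 * int m) + int k * (- 2)" _ 1]) (auto simp: power_divide)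
  ultimately obtain C where "\<forall>(c, d)\<in>cusp_indices. \<forall>z. Im z > 0 \<longrightarrow> nome_eval F z ^ 12 / nome_eval discriminant z ^ k = C"
    using modular_family_weight_0_constant[of "\<lambda>_ _ z. nome_eval F z ^ 12 / nome_eval discriminant z ^ k"]
      order_ge_mono[of 1 _ 0] by auto
  hence C: "nome_eval F z ^ 12 / nome_eval discriminant z ^ k = C" if "Im z > 0" for z
    using that by (auto simp: cusp_indices_def)
  have "C = 0" by (rule order_ge_pos_const[OF ord C])
  hence "nome_eval F z = 0" if "Im z > 0" for z using C[OF that] discriminant_nonzero[OF that] by simp
  thus ?thesis by (rule fps_eq_0_if_nome_eval[OF modular_seriesD(2)[OF F]])
qed

lemma theta_minus_inverse:
  assumes F: "modular_series k F" and z: "Im z > 0" and k: "k > 0"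
  shows "nome_eval (theta F) (- 1 / z) =
     z ^ (k + 2) * nome_eval (theta F) z + of_nat k * z ^ (k + 1) * nome_eval F z / (2 * of_real pi * \<i>)"
proof -
  have z0: "z \<noteq> 0" using z by auto
  note r = modular_seriesD(2)[OF F]
  have "((\<lambda>z. nome_eval F (- 1 / z)) has_field_derivative
          2 * of_real pi * \<i> * nome_eval (theta F) (- 1 / z) * (1 / z ^ 2)) (at z)"
    by (rule DERIV_chain2[where f = "nome_eval F" and g = "\<lambda>z. - 1 / z", OF nome_eval_has_derivative[OF r Im_minus_inverse_pos[OF z]]])
       (use z0 in \<open>auto intro!: derivative_eq_intros simp: power2_eq_square\<close>)
  moreover have "((\<lambda>z. nome_eval F (- 1 / z)) has_field_derivative
      of_nat k * z ^ (k - 1) * nome_eval F z + z ^ k * (2 * of_real pi * \<i> * nome_eval (theta F) z)) (at z)"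
  proof (rule has_field_derivative_transform_within_open[of "\<lambda>z. z ^ k * nome_eval F z" _ _ "{z. Im z > 0}"])
    show "((\<lambda>z. z ^ k * nome_eval F z) has_field_derivative
      of_nat k * z ^ (k - 1) * nome_eval F z + z ^ k * (2 * of_real pi * \<i> * nome_eval (theta F) z)) (at z)"
      using k by (auto intro!: derivative_eq_intros nome_eval_has_derivative r z)
    show "open {z. Im z > 0}" by (intro open_Collect_less continuous_intros)
  qed (use z modular_seriesD(3)[OF F] in auto)
  ultimately have e: "2 * of_real pi * \<i> * nome_eval (theta F) (- 1 / z) * (1 / z ^ 2) =
      of_nat k * z ^ (k - 1) * nome_eval F z + z ^ k * (2 * of_real pi * \<i> * nome_eval (theta F) z)"
    by (rule DERIV_unique)
  obtain l where l: "k = Suc l" using k by (cases k) auto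
  have "2 * of_real pi * \<i> * nome_eval (theta F) (- 1 / z) =
      z ^ 2 * (of_nat k * z ^ (k - 1) * nome_eval F z + z ^ k * (2 * of_real pi * \<i> * nome_eval (theta F) z))"
    unfolding e[symmetric] using z0 by simp
  thus ?thesis unfolding l by (simp add: field_simps power2_eq_square)
qed

text \<open>Ramanujan's differential equations provide modular forms of weight 4 and 6 from the quasimodular
  series of weight 2; the former is identified with \<open>E4\<close> through its Hecke eigenvalues.\<close>

definition E4_ramanujan :: "complex fps" where
  "E4_ramanujan = E2 * E2 - fps_const 12 * theta E2"

text \<open>Differentiating the transformation law of E_2 produces, after multiplication by 12,
  exactly the anomalous terms of the square of E_2.\<close>

lemma modular_series_E4_ramanujan: "modular_series 4 E4_ramanujan"
proof -
  have r: "fps_conv_radius E4_ramanujan \<ge> 1" unfolding E4_ramanujan_def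
    by (intro conv_radius_diff_ge_1 conv_radius_mult_ge_1 conv_radius_const_mult conv_radius_theta conv_radius_E2)
  have eq: "nome_eval E4_ramanujan z = nome_eval E2 z ^ 2 - 12 * nome_eval (theta E2) z" if "Im z > 0" for z
    unfolding E4_ramanujan_def using that
    by (simp add: nome_eval_diff nome_eval_mult nome_eval_cmult conv_radius_mult_ge_1 conv_radius_const_mult
        conv_radius_theta conv_radius_E2 power2_eq_square)
  have "nome_eval E4_ramanujan (- 1 / z) = z ^ 4 * nome_eval E4_ramanujan z" if z: "Im z > 0" for z
  proof -
    have z0: "z \<noteq> 0" using z by auto
    have "((\<lambda>z. nome_eval E2 (- 1 / z)) has_field_derivative
            2 * of_real pi * \<i> * nome_eval (theta E2) (- 1 / z) * (1 / z ^ 2)) (at z)"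
      by (rule DERIV_chain2[where f = "nome_eval E2" and g = "\<lambda>z. - 1 / z", OF nome_eval_has_derivative[OF conv_radius_E2 Im_minus_inverse_pos[OF z]]])
         (use z0 in \<open>auto intro!: derivative_eq_intros simp: power2_eq_square\<close>)
    moreover have "((\<lambda>z. nome_eval E2 (- 1 / z)) has_field_derivative
        2 * z * nome_eval E2 z + z ^ 2 * (2 * of_real pi * \<i> * nome_eval (theta E2) z) - 6 * \<i> / of_real pi) (at z)"
    proof (rule has_field_derivative_transform_within_open[of "\<lambda>z. z ^ 2 * nome_eval E2 z - 6 * \<i> * z / of_real pi" _ _ "{z. Im z > 0}"])
      show "((\<lambda>z. z ^ 2 * nome_eval E2 z - 6 * \<i> * z / of_real pi) has_field_derivative
        2 * z * nome_eval E2 z + z ^ 2 * (2 * of_real pi * \<i> * nome_eval (theta E2) z) - 6 * \<i> / of_real pi) (at z)"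
        by (auto intro!: derivative_eq_intros nome_eval_has_derivative conv_radius_E2 z)
      show "open {z. Im z > 0}" by (intro open_Collect_less continuous_intros)
    qed (use z E2_minus_inverse in auto)
    ultimately have e: "2 * of_real pi * \<i> * nome_eval (theta E2) (- 1 / z) * (1 / z ^ 2) =
        2 * z * nome_eval E2 z + z ^ 2 * (2 * of_real pi * \<i> * nome_eval (theta E2) z) - 6 * \<i> / of_real pi"
      by (rule DERIV_unique)
    have "2 * of_real pi * \<i> * nome_eval (theta E2) (- 1 / z) =
        z ^ 2 * (2 * z * nome_eval E2 z + z ^ 2 * (2 * of_real pi * \<i> * nome_eval (theta E2) z) - 6 * \<i> / of_real pi)"
      unfolding e[symmetric] using z0 by simp
    hence t: "nome_eval (theta E2) (- 1 / z) =
        z ^ 2 * (2 * z * nome_eval E2 z + z ^ 2 * (2 * of_real pi * \<i> * nome_eval (theta E2) z) - 6 * \<i> / of_real pi) / (2 * of_real pi * \<i>)"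
      by (simp add: field_simps)
    have t': "12 * nome_eval (theta E2) (- 1 / z) = 12 * z ^ 4 * nome_eval (theta E2) z
        - 12 * \<i> * z ^ 3 * nome_eval E2 z / of_real pi - 36 * z ^ 2 / of_real pi ^ 2"
      unfolding t by (simp add: field_simps power2_eq_square power3_eq_cube power4_eq_xxxx)
    show ?thesis
      unfolding eq[OF z] eq[OF Im_minus_inverse_pos[OF z]] t' E2_minus_inverse[OF z]
      by (simp add: field_simps power2_eq_square power3_eq_cube power4_eq_xxxx)
  qed
  thus ?thesis using r by (simp add: modular_series_def)
qed

text \<open>This is -3 times the Serre derivative of E_4; the factor makes the constant term
  1.\<close>

definition E6 :: "complex fps" where
  "E6 = E2 * E4_ramanujan - fps_const 3 * theta E4_ramanujan"

lemma modular_series_E6: "modular_series 6 E6"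
proof -
  note r4 = modular_seriesD(2)[OF modular_series_E4_ramanujan]
  have r: "fps_conv_radius E6 \<ge> 1" unfolding E6_def
    by (intro conv_radius_diff_ge_1 conv_radius_mult_ge_1 conv_radius_const_mult conv_radius_theta conv_radius_E2 r4)
  have eq: "nome_eval E6 z = nome_eval E2 z * nome_eval E4_ramanujan z - 3 * nome_eval (theta E4_ramanujan) z"
    if "Im z > 0" for z
    unfolding E6_def using that
    by (simp add: nome_eval_diff nome_eval_mult nome_eval_cmult conv_radius_mult_ge_1 conv_radius_const_mult
        conv_radius_theta conv_radius_E2 r4)
  have "nome_eval E6 (- 1 / z) = z ^ 6 * nome_eval E6 z" if z: "Im z > 0" for z
  proof -
    have t: "nome_eval (theta E4_ramanujan) (- 1 / z) =
        z ^ 6 * nome_eval (theta E4_ramanujan) z - 2 * \<i> * z ^ 5 * nome_eval E4_ramanujan z / of_real pi"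
    proof -
      have d: "x / (2 * of_real pi * \<i>) = - (\<i> * x / (2 * of_real pi))" for x by (simp add: field_simps)
      show ?thesis using theta_minus_inverse[OF modular_series_E4_ramanujan z] unfolding d by simp
    qed
    show ?thesis
      unfolding eq[OF z] eq[OF Im_minus_inverse_pos[OF z]] t E2_minus_inverse[OF z]
        modular_seriesD(3)[OF modular_series_E4_ramanujan z]
      by (simp add: field_simps eval_nat_numeral)
  qed
  thus ?thesis using r by (simp add: modular_series_def)
qed

text \<open>The matrix with rows (1, -1) and (2, -1) acts on (z + 1) / 2. This settles the third
  term of T_2 and the third translate of F(2z).\<close>

lemma modular_series_half_shift:
  assumes F: "modular_series k F" and z: "Im z > 0"
  shows "nome_eval F ((- 1 / z + 1) / 2) = z ^ k * nome_eval F ((z + 1) / 2)"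
proof -
  have z0: "z \<noteq> 0" using z by auto
  have w: "Im ((z + 1) / 2) > 0" using z by simp
  have "(- 1 / z + 1) / 2 = (of_int 1 * ((z + 1) / 2) + of_int (- 1)) / (of_int 2 * ((z + 1) / 2) + of_int (- 1))"
    using z0 by (simp add: field_simps)
  also have "nome_eval F \<dots> = (of_int 2 * ((z + 1) / 2) + of_int (- 1)) ^ k * nome_eval F ((z + 1) / 2)"
    by (rule modular_family_slash[OF modular_series_family[OF F] _ w]) simp
  also have "of_int 2 * ((z + 1) / 2) + of_int (- 1) = z"
  proof -
    have e: "2 * ((z + 1) / 2) = z + 1"
      by (metis nonzero_mult_div_cancel_left times_divide_eq_right zero_neq_numeral)
    show ?thesis unfolding of_int_numeral e by simp
  qed
  finally show ?thesis .
qed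

lemma modular_series_hecke:
  assumes F: "modular_series k F" and p: "prime p" and k: "k > 0"
  shows "modular_series k (hecke_fps k p F)"
proof (cases "odd p")
  case True
  note fam = modular_series_family[OF F] and r = modular_seriesD(2)[OF F]
  have eq: "hecke_family k p (\<lambda>_ _. nome_eval F) c d z = nome_eval (hecke_fps k p F) z" if "Im z > 0" for c d z
    by (rule hecke_family_nome_eval[OF p True r that]) auto
  have "nome_eval (hecke_fps k p F) (- 1 / z) = z ^ k * nome_eval (hecke_fps k p F) z" if "Im z > 0" for z
    using modular_familyD(4)[OF modular_family_hecke[OF fam p True k] that, of 0 0]
      eq[OF that] eq[OF Im_minus_inverse_pos[OF that]] by simp
  moreover have "p > 0" using p prime_gt_0_nat by blast
  ultimately show ?thesis using modular_seriesD(1)[OF F] by (simp add: modular_series_def conv_radius_hecke r)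
next
  case False
  hence p2: "p = 2" using p primes_dvd_imp_eq two_is_prime_nat by metis
  note fam = modular_series_family[OF F] and r = modular_seriesD(2)[OF F]
  have eq: "nome_eval (hecke_fps k 2 F) z = 2 ^ (k - 1) * nome_eval F (2 * z) +
     (nome_eval F (z / 2) + nome_eval F ((z + 1) / 2)) / 2" if "Im z > 0" for z
    using nome_eval_hecke[of 2 F z k] that r by (simp add: numeral_2_eq_2)
  have pk: "2 ^ k = (2 :: complex) * 2 ^ (k - 1)" using k by (cases k) auto
  have "nome_eval (hecke_fps k 2 F) (- 1 / z) = z ^ k * nome_eval (hecke_fps k 2 F) z" if z: "Im z > 0" for z
  proof -
    have z0: "z \<noteq> 0" using z by auto
    \<comment> \<open>The inversion exchanges the terms at 2 z and z / 2 and keeps the one at (z +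
      1) / 2.\<close>
    have A: "nome_eval F (2 * (- 1 / z)) = (z / 2) ^ k * nome_eval F (z / 2)"
      using modular_seriesD(3)[OF F, of "z / 2"] z by simp
    have B: "nome_eval F ((- 1 / z) / 2) = (2 * z) ^ k * nome_eval F (2 * z)"
      using modular_seriesD(3)[OF F, of "2 * z"] z by (simp add: mult.commute)
    note C = modular_series_half_shift[OF F z]
    have alg: "Q * (x / (2 * Q) * H1) + (2 * Q * x * H2 + x * T) / 2 = x * (Q * H2 + (H1 + T) / 2)"
      if "Q \<noteq> 0" for Q x H1 H2 T :: complex
      using that by (simp add: field_simps)
    show ?thesis
      unfolding eq[OF z] eq[OF Im_minus_inverse_pos[OF z]] A B C power_divide power_mult_distrib pk
      by (rule alg) auto
  qed
  thus ?thesis using modular_seriesD(1)[OF F] unfolding p2 by (simp add: modular_series_def conv_radius_hecke r)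
qed

lemma hecke_fps_nth:
  "fps_nth (hecke_fps k p F) n = fps_nth F (p * n) + (if p dvd n then of_nat p ^ (k - 1) * fps_nth F (n div p) else 0)"
  by (simp add: hecke_fps_def fps_section_def fps_stretch_def)

lemma hecke_fps_nth_1: "prime p \<Longrightarrow> fps_nth (hecke_fps k p F) (Suc 0) = fps_nth F p"
  by (auto simp: hecke_fps_nth prime_nat_iff)

text \<open>The coefficient of T_p F at q is b_p, so T_p F - b_p F falls under the uniqueness
  assumption.\<close>

lemma hecke_eigenform_cusp:
  assumes F: "modular_series k F" "fps_nth F 0 = 0" "fps_nth F 1 = 1" and k: "k > 0" and p: "prime p"
    and unique: "\<And>G. modular_series k G \<Longrightarrow> fps_nth G 0 = 0 \<Longrightarrow> fps_nth G 1 = 0 \<Longrightarrow> G = 0"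
  shows "hecke_fps k p F = fps_const (fps_nth F p) * F"
proof -
  have "hecke_fps k p F - fps_const (fps_nth F p) * F = 0"
  proof (rule unique)
    show "modular_series k (hecke_fps k p F - fps_const (fps_nth F p) * F)"
      by (intro modular_series_diff modular_series_hecke modular_series_cmult F p k)
  qed (use F hecke_fps_nth_1[OF p] in \<open>auto simp: hecke_fps_nth\<close>)
  thus ?thesis by simp
qed

text \<open>T_p multiplies the constant term by 1 + p^(k-1), and below weight 12 a form without
  constant term vanishes.\<close>

lemma hecke_eigenform_eisenstein:
  assumes F: "modular_series k F" and k: "0 < k" "k < 12" and p: "prime p"
  shows "hecke_fps k p F = fps_const (1 + of_nat p ^ (k - 1)) * F"
proof -
  have "hecke_fps k p F - fps_const (1 + of_nat p ^ (k - 1)) * F = 0"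
  proof (rule modular_series_order_0[where m = 1])
    show "modular_series k (hecke_fps k p F - fps_const (1 + of_nat p ^ (k - 1)) * F)"
      by (intro modular_series_diff modular_series_hecke modular_series_cmult F p k)
  qed (use k in \<open>auto simp: hecke_fps_nth algebra_simps\<close>)
  thus ?thesis by simp
qed

text \<open>The divisors of p m are those of m and their multiples by p; the overlap consists of p
  times the divisors of m / p. The result is the Hecke recursion for sigma_r.\<close>

lemma sigma_prime_mult:
  assumes p: "prime p" and m: "m > 0"
  shows "divisor_sigma r (p * m) + (if p dvd m then p ^ r * divisor_sigma r (m div p) else 0) =
     (1 + p ^ r) * divisor_sigma r m"
proof -
  have p0: "p > 0" using p prime_gt_0_nat by blast
  have fin: "finite {d. d dvd m}" using m by simp
  have U: "{d. d dvd p * m} = {d. d dvd m} \<union> (\<lambda>d. p * d) ` {d. d dvd m}" (is "_ = ?A \<union> ?B")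
  proof (intro equalityI subsetI)
    fix d assume d: "d \<in> {d. d dvd p * m}"
    show "d \<in> ?A \<union> ?B"
    proof (cases "p dvd d")
      case True
      then obtain e where "d = p * e" by auto
      thus ?thesis using d p0 by auto
    next
      case False
      hence "coprime d p" using p by (metis coprime_commute prime_imp_coprime)
      thus ?thesis using d by (simp add: coprime_dvd_mult_right_iff)
    qed
  qed (auto intro: dvd_mult)
  have I: "?A \<inter> ?B = (if p dvd m then (\<lambda>d. p * d) ` {d. d dvd m div p} else {})"
  proof (cases "p dvd m")
    case True
    then obtain e where e: "m = p * e" by auto
    show ?thesis using p0 unfolding e by (auto intro: dvd_mult)
  next
    case False
    thus ?thesis by (auto intro: dvd_mult_left dvd_trans)
  qed
  have inj: "inj_on (\<lambda>d. p * d) S" for S using p0 by (simp add: inj_on_def)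
  have s: "(\<Sum>d\<in>(\<lambda>d. p * d) ` S. d ^ r) = p ^ r * (\<Sum>d\<in>S. d ^ r)" for S
    by (simp add: sum.reindex[OF inj] power_mult_distrib sum_distrib_left o_def)
  have "sum (\<lambda>d. d ^ r) (?A \<union> ?B) + sum (\<lambda>d. d ^ r) (?A \<inter> ?B) = sum (\<lambda>d. d ^ r) ?A + sum (\<lambda>d. d ^ r) ?B"
    using fin by (intro sum.union_inter) auto
  thus ?thesis unfolding divisor_sigma_def U I using s
    by (auto simp: algebra_simps)
qed

lemma sigma_1_arg [simp]: "divisor_sigma r (Suc 0) = 1"
  by (simp add: divisor_sigma_def)

lemma E2_nth_0 [simp]: "fps_nth E2 0 = 1" and E2_nth_1 [simp]: "fps_nth E2 (Suc 0) = - 24"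
  by (simp_all add: E2_def)

text \<open>The Hecke relation at m = n / p expresses the coefficient of index n by earlier ones, in
  the same way as the recursion for 240 sigma_3.\<close>

theorem E4_ramanujan_eq: "E4_ramanujan = E4"
proof (rule fps_ext)
  fix n
  have 0: "fps_nth E4_ramanujan 0 = 1" by (simp add: E4_ramanujan_def)
  have 1: "fps_nth E4_ramanujan 1 = 240" by (simp add: E4_ramanujan_def fps_mult_nth)
  have "n > 0 \<Longrightarrow> fps_nth E4_ramanujan n = 240 * of_nat (divisor_sigma 3 n)"
  proof (induction n rule: less_induct)
    case (less n)
    show ?case
    proof (cases "n = 1")
      case False
      then obtain p where p: "prime p" "p dvd n" using prime_factor_nat by blast
      then obtain m where m: "n = p * m" by auto
      have p1: "p > 1" using p prime_gt_1_nat by blast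
      have m0: "m > 0" and mn: "m < n" using less.prems p1 by (auto simp: m)
      have "fps_nth (hecke_fps 4 p E4_ramanujan) m = (1 + of_nat p ^ 3) * fps_nth E4_ramanujan m"
        unfolding hecke_eigenform_eisenstein[OF modular_series_E4_ramanujan _ _ p(1), simplified] by simp
      hence rec: "fps_nth E4_ramanujan n =
          (1 + of_nat p ^ 3) * fps_nth E4_ramanujan m - (if p dvd m then of_nat p ^ 3 * fps_nth E4_ramanujan (m div p) else 0)"
        by (auto simp: hecke_fps_nth m eq_diff_eq split: if_splits)
      have s: "of_nat (divisor_sigma 3 n) = (1 + of_nat p ^ 3) * (of_nat (divisor_sigma 3 m) :: complex)
          - (if p dvd m then of_nat p ^ 3 * of_nat (divisor_sigma 3 (m div p)) else 0)"
        using arg_cong[OF sigma_prime_mult[OF p(1) m0, of 3], of "of_nat :: nat \<Rightarrow> complex"]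
        by (auto simp: m eq_diff_eq distrib_right split: if_splits)
      have mp: "fps_nth E4_ramanujan (m div p) = 240 * of_nat (divisor_sigma 3 (m div p))" if "p dvd m"
      proof (rule less.IH)
        show "m div p > 0" using that m0 p1 by (auto elim!: dvdE)
        show "m div p < n" using mn by (meson div_le_dividend le_less_trans)
      qed
      show ?thesis unfolding rec s less.IH[OF mn m0] using mp by (auto simp: algebra_simps)
    qed (use 1 in simp)
  qed
  thus "fps_nth E4_ramanujan n = fps_nth E4 n" using 0 by (cases "n = 0") (auto simp: E4_def)
qed

lemmas modular_series_E4 = modular_series_E4_ramanujan[unfolded E4_ramanujan_eq]

lemma multiplicative_if_unique:
  assumes F: "modular_series k F" "fps_nth F 0 = 0" "fps_nth F 1 = 1" and k: "k > 0"
    and unique: "\<And>G. modular_series k G \<Longrightarrow> fps_nth G 0 = 0 \<Longrightarrow> fps_nth G 1 = 0 \<Longrightarrow> G = 0"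
  shows "multiplicative_fps F"
  by (rule multiplicative_if_hecke[of F k])
     (use hecke_eigenform_cusp[OF F k _ unique] F in auto)

lemma cusp_series_unique:
  assumes "modular_series k G" "fps_nth G 0 = 0" "fps_nth G 1 = 0" "k < 24"
  shows "G = 0"
  by (rule modular_series_order_0[OF assms(1), of 2]) (use assms in \<open>auto simp: less_2_cases_iff\<close>)

lemma E4_nth_0_1 [simp]: "fps_nth E4 0 = 1" "fps_nth E4 (Suc 0) = 240"
  by (simp_all add: E4_def)

lemma E6_nth_0_1 [simp]: "fps_nth E6 0 = 1" "fps_nth E6 (Suc 0) = - 504"
  by (simp_all add: E6_def E4_ramanujan_eq fps_mult_nth)

text \<open>Division by the square of the discriminant would turn \<open>G\<close> into a modular form of weight 2, of
  which there are none: multiples of \<open>G\<close> determine it up to a constant \<open>a\<close> in two incompatible ways.\<close>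

lemma cusp_series_unique_26:
  assumes G: "modular_series 26 G" "fps_nth G 0 = 0" "fps_nth G 1 = 0"
  shows "G = 0"
proof -
  define a where "a = fps_nth G 2"
  have D2: "modular_series 24 (discriminant * discriminant)"
    using modular_series_mult[OF modular_series_discriminant modular_series_discriminant] by simp
  have D4: "modular_series 48 ((discriminant * discriminant) * (discriminant * discriminant))"
    using modular_series_mult[OF D2 D2] by simp
  define H where "H = fps_shift 2 G"
  have H0: "fps_nth H 0 = a" by (simp add: H_def a_def numeral_2_eq_2)
  have H: "G = fps_X ^ 2 * H"
  proof (rule fps_ext)
    fix n
    show "fps_nth G n = fps_nth (fps_X ^ 2 * H) n"
    proof (cases "n < 2")
      case True
      thus ?thesis using G by (auto simp: fps_X_power_mult_nth less_2_cases_iff)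
    next
      case False
      then obtain m where "n = m + 2" by (metis le_add_diff_inverse2 not_less)
      thus ?thesis by (simp add: fps_X_power_mult_nth H_def)
    qed
  qed
  obtain P where P: "discriminant = fps_X * P" and P0: "fps_nth P 0 = 1"
    using discriminant_nth_0_1(2) by (auto simp: discriminant_def)
  \<comment> \<open>Both products have weight 30 and begin with a q^2, so their difference has order
    at least 3, too much for weight 30. Below, the same holds for weight 52 and order 5.\<close>
  have "G * E4 - fps_const a * (E6 * (discriminant * discriminant)) = 0"
  proof (rule modular_series_order_0[where k = 30 and m = 3])
    have "modular_series (26 + 4) (G * E4)" "modular_series (6 + 24) (E6 * (discriminant * discriminant))"
      by (intro modular_series_mult G modular_series_E4 modular_series_E6 D2)+
    thus "modular_series 30 (G * E4 - fps_const a * (E6 * (discriminant * discriminant)))"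
      by (intro modular_series_diff modular_series_cmult) simp_all
  next
    have "G * E4 - fps_const a * (E6 * (discriminant * discriminant)) = fps_X ^ 2 * (H * E4 - fps_const a * (E6 * (P * P)))"
      unfolding H P by (simp add: algebra_simps power2_eq_square)
    moreover have "fps_nth (H * E4 - fps_const a * (E6 * (P * P))) 0 = 0" by (simp add: H0 P0)
    ultimately show "fps_nth (G * E4 - fps_const a * (E6 * (discriminant * discriminant))) i = 0" if "i < 3" for i
      using that by (cases "i = 2") (simp_all add: fps_X_power_mult_nth)
  qed auto
  hence 1: "G * E4 = fps_const a * (E6 * (discriminant * discriminant))" by simp
  have "G * G - fps_const (a * a) * (E4 * ((discriminant * discriminant) * (discriminant * discriminant))) = 0"
  proof (rule modular_series_order_0[where k = 52 and m = 5])
    have "modular_series (26 + 26) (G * G)" "modular_series (4 + 48) (E4 * ((discriminant * discriminant) * (discriminant * discriminant)))"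
      by (intro modular_series_mult G modular_series_E4 D4)+
    thus "modular_series 52 (G * G - fps_const (a * a) * (E4 * ((discriminant * discriminant) * (discriminant * discriminant))))"
      by (intro modular_series_diff modular_series_cmult) simp_all
  next
    have "G * G - fps_const (a * a) * (E4 * ((discriminant * discriminant) * (discriminant * discriminant))) =
        fps_X ^ 4 * (H * H - fps_const (a * a) * (E4 * ((P * P) * (P * P))))"
      unfolding H P by (simp add: algebra_simps power2_eq_square power4_eq_xxxx)
    moreover have "fps_nth (H * H - fps_const (a * a) * (E4 * ((P * P) * (P * P)))) 0 = 0" by (simp add: H0 P0)
    ultimately show "fps_nth (G * G - fps_const (a * a) * (E4 * ((discriminant * discriminant) * (discriminant * discriminant)))) i = 0"
      if "i < 5" for i
      using that by (cases "i = 4") (simp_all add: fps_X_power_mult_nth)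
  qed auto
  hence 2: "G * G = fps_const (a * a) * (E4 * ((discriminant * discriminant) * (discriminant * discriminant)))" by simp
  have "a = 0"
  proof (rule ccontr)
    assume a: "a \<noteq> 0"
    have "(G * E4) * (G * E4) = (G * G) * (E4 * E4)" by (simp add: mult_ac)
    hence "(fps_const (a * a) * ((discriminant * discriminant) * (discriminant * discriminant))) * (E6 * E6) =
       (fps_const (a * a) * ((discriminant * discriminant) * (discriminant * discriminant))) * (E4 * (E4 * E4))"
      unfolding 1 2 by (simp add: mult_ac flip: fps_const_mult)
    moreover have "discriminant \<noteq> 0" using discriminant_nth_0_1(2) by (metis fps_zero_nth zero_neq_one)
    hence "fps_const (a * a) * ((discriminant * discriminant) * (discriminant * discriminant)) \<noteq> 0" using a by simp
    ultimately have "E6 * E6 = E4 * (E4 * E4)" by (simp only: mult_cancel_left) simp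
    hence "fps_nth (E6 * E6) 1 = fps_nth (E4 * (E4 * E4)) 1" by simp
    \<comment> \<open>The two coefficients at q are -1008 and 720.\<close>
    thus False by (simp add: fps_mult_nth)
  qed
  hence "G * G = 0" using 2 by simp
  thus ?thesis by simp
qed

section \<open>The given notions of q-expansion and cusp form\<close>

lemma has_q_expansion_nome_eval:
  "fps_conv_radius F \<ge> 1 \<Longrightarrow> has_q_expansion (nome_eval F) F"
  using nome_eval_sums by (auto simp: has_q_expansion_def upper_half_plane_def)

lemma has_q_expansionD:
  assumes "has_q_expansion f F"
  shows "fps_conv_radius F \<ge> 1" "Im z > 0 \<Longrightarrow> f z = nome_eval F z"
proof -
  have s: "(\<lambda>n. fps_nth F n * nome z ^ n) sums f z" if "Im z > 0" for z
    using assms that by (auto simp: has_q_expansion_def upper_half_plane_def)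
  show r: "fps_conv_radius F \<ge> 1"
  proof (rule fps_conv_radius_ge_1)
    fix q :: complex assume q: "norm q < 1"
    show "summable (\<lambda>n. fps_nth F n * q ^ n)"
    proof (cases "q = 0")
      case False
      thus ?thesis using s nome_surj[OF False q] by (metis sums_summable)
    qed (auto intro: summable_0_powser)
  qed
  show "Im z > 0 \<Longrightarrow> f z = nome_eval F z" using sums_unique2[OF s nome_eval_sums[OF r]] by blast
qed

lemma has_q_expansion_unique: "has_q_expansion f F \<Longrightarrow> has_q_expansion f G \<Longrightarrow> F = G"
  using has_q_expansionD by (metis fps_eq_if_nome_eval_eq)

lemma q_expansion_eqI: "has_q_expansion f F \<Longrightarrow> q_expansion f = F"
  unfolding q_expansion_def using has_q_expansion_unique by blast

lemma cusp_form_q_expansion_nth_0: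
  assumes f: "cusp_form N k f" "has_q_expansion f F"
  shows "fps_nth F 0 = 0"
proof -
  note r = has_q_expansionD(1)[OF f(2)] and eq = has_q_expansionD(2)[OF f(2)]
  have "((\<lambda>z. f ((of_int 1 * z + of_int 0) / (of_int 0 * z + of_int 1)) / (of_int 0 * z + of_int 1) ^ k) \<longlongrightarrow> 0)
         (filtercomap Im at_top)"
  proof -
    have "\<forall>a b c d :: int. a * d - b * c = 1 \<longrightarrow>
        ((\<lambda>z. f ((of_int a * z + of_int b) / (of_int c * z + of_int d)) /
              (of_int c * z + of_int d) ^ k) \<longlongrightarrow> 0) (filtercomap Im at_top)"
      using f(1) by (simp add: cusp_form_def)
    from this[rule_format, of 1 1 0 0] show ?thesis by simp
  qed
  hence lim: "(f \<longlongrightarrow> 0) (filtercomap Im at_top)" by simp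
  let ?G = "F - fps_const (fps_nth F 0)"
  have rG: "fps_conv_radius ?G \<ge> 1" using r by (intro conv_radius_diff_ge_1) auto
  have "order_ge (2 * int 1) (nome_eval ?G)" using rG by (intro order_ge_nome_eval) auto
  hence "(nome_eval ?G \<longlongrightarrow> 0) (filtercomap Im at_top)"
    by (intro order_ge_tendsto_0 order_ge_mono[of "2 * int 1" _ 1]) auto
  from tendsto_diff[OF lim this] have "((\<lambda>z. f z - nome_eval ?G z) \<longlongrightarrow> 0) (filtercomap Im at_top)" by simp
  moreover have "eventually (\<lambda>z. f z - nome_eval ?G z = fps_nth F 0) (filtercomap Im at_top)"
    using eventually_filtercomapI[OF eventually_gt_at_top[of 0], of Im]
  proof (rule eventually_mono)
    fix z assume z: "0 < Im z"
    have "nome_eval ?G z = nome_eval F z - nome_eval (fps_const (fps_nth F 0)) z"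
      using r z by (intro nome_eval_diff) auto
    thus "f z - nome_eval ?G z = fps_nth F 0" using eq[OF z] by (simp add: nome_eval_def)
  qed
  ultimately have "((\<lambda>_. fps_nth F 0) \<longlongrightarrow> 0) (filtercomap Im at_top)"
    by (rule Lim_transform_eventually)
  thus ?thesis using filtercomap_Im_at_top_nontrivial tendsto_const_iff by blast
qed

text \<open>The slash of \<open>h 0 1\<close> by a matrix with lower row (c, d) is the member
  \<open>h c d\<close>, so the orders at the three indices control all cusps.\<close>

lemma cusp_form_family:
  assumes h: "modular_family k h" and ord: "\<And>c d. (c, d) \<in> cusp_indices \<Longrightarrow> order_ge 1 (h c d)"
    and N: "\<And>c d. coprime c d \<Longrightarrow> int N dvd c \<Longrightarrow> h c d = h 0 1"
  shows "cusp_form N k (h 0 1)"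
  unfolding cusp_form_def
proof (intro conjI allI impI ballI)
  have "order_ge 1 (h 0 1)" by (intro ord) (simp add: cusp_indices_def)
  then obtain g where g: "g holomorphic_on ball 0 1" "\<And>z. Im z > 0 \<Longrightarrow> h 0 1 z = nome (z / 2) powi 1 * g (nome (z / 2))"
    unfolding order_ge_def by blast
  have "(\<lambda>z. nome (z / 2) * g (nome (z / 2))) holomorphic_on upper_half_plane"
    by (intro holomorphic_intros holomorphic_on_compose_gen[of "\<lambda>z. nome (z / 2)" _ g "ball 0 1", unfolded o_def] g)
       (use half_nome_in_ball in \<open>auto simp: upper_half_plane_def\<close>)
  thus "h 0 1 holomorphic_on upper_half_plane"
    by (rule holomorphic_transform) (use g in \<open>auto simp: upper_half_plane_def\<close>)
next
  fix a b c d :: int and z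
  assume det: "a * d - b * c = 1" and "int N dvd c" and z: "z \<in> upper_half_plane"
  moreover have "coprime c d"
  proof (rule coprimeI)
    fix e assume "e dvd c" "e dvd d"
    hence "e dvd a * d - b * c" by (intro dvd_diff) auto
    thus "is_unit e" using det by simp
  qed
  ultimately show "h 0 1 ((of_int a * z + of_int b) / (of_int c * z + of_int d)) = (of_int c * z + of_int d) ^ k * h 0 1 z"
    using modular_family_slash[OF h det, of z 0 1] N[of c d] by (simp add: upper_half_plane_def)
next
  fix a b c d :: int assume det: "a * d - b * c = 1"
  have "odd c \<or> odd d"
  proof (rule ccontr)
    assume "\<not> (odd c \<or> odd d)"
    hence "even (a * d - b * c)" by simp
    thus False using det by simp
  qed
  hence "(c mod 2, d mod 2) \<in> cusp_indices"
    unfolding cusp_indices_def by (cases "even c"; cases "even d") (auto simp: even_iff_mod_2_eq_zero odd_iff_mod_2_eq_one)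
  hence "order_ge 1 (h c d)" using ord modular_familyD(2)[OF h, of c d] by simp
  hence lim: "(h c d \<longlongrightarrow> 0) (filtercomap Im at_top)" by (rule order_ge_tendsto_0)
  have "eventually (\<lambda>z. h c d z = h 0 1 ((of_int a * z + of_int b) / (of_int c * z + of_int d)) / (of_int c * z + of_int d) ^ k)
      (filtercomap Im at_top)"
    using eventually_filtercomapI[OF eventually_gt_at_top[of 0], of Im]
  proof (rule eventually_mono)
    fix z assume z: "0 < Im z"
    show "h c d z = h 0 1 ((of_int a * z + of_int b) / (of_int c * z + of_int d)) / (of_int c * z + of_int d) ^ k"
      using modular_family_slash[OF h det z, of 0 1] moebius_Im_pos(2)[OF det z] by simp
  qed
  from Lim_transform_eventually[OF lim this]
  show "((\<lambda>z. h 0 1 ((of_int a * z + of_int b) / (of_int c * z + of_int d)) / (of_int c * z + of_int d) ^ k) \<longlongrightarrow> 0)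
      (filtercomap Im at_top)" .
qed

lemma normalized_cusp_series_level_1_iff:
  assumes "even k"
  shows "normalized_cusp_series 1 k F \<longleftrightarrow> modular_series k F \<and> fps_nth F 0 = 0 \<and> fps_nth F 1 = 1"
proof
  assume "normalized_cusp_series 1 k F"
  then obtain f where F1: "fps_nth F 1 = 1" and f: "cusp_form 1 k f" "has_q_expansion f F"
    by (auto simp: normalized_cusp_series_def)
  note r = has_q_expansionD(1)[OF f(2)] and eq = has_q_expansionD(2)[OF f(2)]
  have "nome_eval F (- 1 / z) = z ^ k * nome_eval F z" if z: "Im z > 0" for z
  proof -
    have "\<forall>a b c d :: int. a * d - b * c = 1 \<longrightarrow> int 1 dvd c \<longrightarrow>
        (\<forall>z\<in>upper_half_plane. f ((of_int a * z + of_int b) / (of_int c * z + of_int d)) = (of_int c * z + of_int d) ^ k * f z)"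
      using f(1) unfolding cusp_form_def by blast
    from this[rule_format, of 0 0 "- 1" 1 z] z have "f (- 1 / z) = z ^ k * f z"
      by (simp add: upper_half_plane_def)
    thus ?thesis using eq[OF z] eq[OF Im_minus_inverse_pos[OF z]] by simp
  qed
  thus "modular_series k F \<and> fps_nth F 0 = 0 \<and> fps_nth F 1 = 1"
    using assms r F1 cusp_form_q_expansion_nth_0[OF f] by (simp add: modular_series_def)
next
  assume F: "modular_series k F \<and> fps_nth F 0 = 0 \<and> fps_nth F 1 = 1"
  note r = modular_seriesD(2)[of k F]
  have "order_ge (2 * int 1) (nome_eval F)" using F r by (intro order_ge_nome_eval) auto
  hence "order_ge 1 (nome_eval F)" by (rule order_ge_mono) simp
  hence "cusp_form 1 k (nome_eval F)"
    using cusp_form_family[OF modular_series_family, of k F 1] F by simp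
  thus "normalized_cusp_series 1 k F" using F has_q_expansion_nome_eval r
    by (auto simp: normalized_cusp_series_def)
qed

lemma Delta_eqI:
  assumes k: "even k" "k < 24" and F: "modular_series k F" "fps_nth F 0 = 0" "fps_nth F 1 = 1"
  shows "Delta k = F" "normalized_cusp_series 1 k G \<longleftrightarrow> G = F"
proof -
  show iff: "normalized_cusp_series 1 k G \<longleftrightarrow> G = F" for G
  proof
    assume "normalized_cusp_series 1 k G"
    hence G: "modular_series k G" "fps_nth G 0 = 0" "fps_nth G 1 = 1"
      using normalized_cusp_series_level_1_iff[OF k(1)] by auto
    have "G - F = 0" by (rule cusp_series_unique[of k]) (use F G k in \<open>auto intro: modular_series_diff\<close>)
    thus "G = F" by simp
  qed (use F normalized_cusp_series_level_1_iff[OF k(1)] in auto)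
  show "Delta k = F" unfolding Delta_def iff by simp
qed

text \<open>The removable singularity of \<open>f\<close> as a function of \<open>exp (\<pi> i z)\<close>, with value 0 there.\<close>

lemma order_ge_if_periodic:
  assumes f: "f holomorphic_on upper_half_plane" and per: "\<And>z. Im z > 0 \<Longrightarrow> f (z + 2) = f z"
    and lim: "(f \<longlongrightarrow> 0) (filtercomap Im at_top)"
  shows "order_ge 1 f"
proof -
  have per_nat: "f (z + 2 * of_nat n) = f z" if "Im z > 0" for z n
  proof (induction n)
    case (Suc n)
    have "f (z + 2 * of_nat (Suc n)) = f ((z + 2 * of_nat n) + 2)" by (simp add: algebra_simps)
    also have "\<dots> = f (z + 2 * of_nat n)" using that by (intro per) simp
    finally show ?case using Suc by simp
  qed auto
  have per_int: "f (z + 2 * of_int n) = f z" if "Im z > 0" for z n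
  proof (cases "n \<ge> 0")
    case True
    thus ?thesis using per_nat[OF that, of "nat n"] by simp
  next
    case False
    have "f ((z + 2 * of_int n) + 2 * of_nat (nat (- n))) = f (z + 2 * of_int n)"
      using that by (intro per_nat) simp
    thus ?thesis using False by simp
  qed
  \<comment> \<open>A point with \<open>nome (z / 2) = w\<close>, from the principal logarithm; by
    periodicity, \<open>eq\<close> below removes the dependence on this choice.\<close>
  define L where "L w = Ln w / (of_real pi * \<i>)" for w
  define G where "G w = (if w = 0 then 0 else f (L w))" for w
  have L: "nome (L w / 2) = w" if "w \<noteq> 0" for w using that by (simp add: L_def nome_def)
  have ImL: "Im (L w) = - ln (norm w) / pi" if "w \<noteq> 0" for w
    using that by (simp add: L_def Im_divide power2_eq_square)
  have eq: "f z = G w" if "Im z > 0" "nome (z / 2) = w" for z w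
  proof -
    have w: "w \<noteq> 0" using that(2) by auto
    have "exp (of_real pi * \<i> * z) = exp (of_real pi * \<i> * L w)"
      using that(2) L[OF w] by (simp add: nome_def mult_ac)
    then obtain n :: int where n: "of_real pi * \<i> * z = of_real pi * \<i> * L w + (of_int (2 * n) * pi) * \<i>"
      unfolding exp_eq by blast
    have "of_real pi * \<i> * z = of_real pi * \<i> * (L w + 2 * of_int n)" unfolding n by (simp add: algebra_simps)
    hence z: "z = L w + 2 * of_int n" by simp
    hence "Im (L w) > 0" using that(1) by simp
    thus ?thesis using per_int[of "L w" n] z w by (simp add: G_def)
  qed
  have hol: "G holomorphic_on (ball 0 1 - {0})"
    unfolding holomorphic_on_def
  proof
    fix w :: complex assume w: "w \<in> ball 0 1 - {0}"
    obtain z0 where z0: "nome z0 = w" using nome_surj[of w] w by auto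
    let ?S = "ball w (norm w) \<inter> ball 0 1"
    have ratio: "x / w \<notin> \<real>\<^sub>\<le>\<^sub>0" "x \<noteq> 0" if "x \<in> ?S" for x
    proof -
      have w0: "w \<noteq> 0" using w by simp
      have "norm (x / w - 1) = norm (x - w) / norm w" using w0 by (simp add: norm_divide[symmetric] diff_divide_distrib)
      also have "\<dots> < 1" using that w0 by (simp add: dist_norm norm_minus_commute)
      finally have "norm (x / w - 1) < 1" .
      hence "Re (1 - x / w) < 1" using complex_Re_le_cmod[of "1 - x / w"] by (simp add: norm_minus_commute)
      hence "Re (x / w) > 0" by simp
      thus "x / w \<notin> \<real>\<^sub>\<le>\<^sub>0" "x \<noteq> 0" by (auto simp: complex_nonpos_Reals_iff)
    qed
    \<comment> \<open>A holomorphic branch of \<open>L\<close> near w, also across the cut of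
      \<open>Ln\<close>: on the disc about w with radius |w| the ratio x / w stays in the right half
      plane.\<close>
    define g where "g x = 2 * z0 + Ln (x / w) / (of_real pi * \<i>)" for x
    have gn: "nome (g x / 2) = x" if "x \<in> ?S" for x
    proof -
      have "nome (g x / 2) = nome z0 * exp (Ln (x / w))"
        by (simp add: g_def nome_def algebra_simps add_divide_distrib flip: exp_add)
      thus ?thesis using ratio[OF that] z0 w by simp
    qed
    have gpos: "Im (g x) > 0" if "x \<in> ?S" for x
    proof -
      have "norm (nome (g x / 2)) < 1" using gn[OF that] that by simp
      hence "pi * Im (g x) > 0" by (simp add: norm_nome)
      thus ?thesis using pi_gt_zero by (simp only: zero_less_mult_iff) auto
    qed
    have "g holomorphic_on ?S" unfolding g_def using ratio w by (intro holomorphic_intros) auto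
    hence "(\<lambda>x. f (g x)) holomorphic_on ?S"
      by (rule holomorphic_on_compose_gen[unfolded o_def, OF _ f]) (use gpos in \<open>auto simp: upper_half_plane_def\<close>)
    moreover have "f (g x) = G x" if "x \<in> ?S" for x by (rule eq[OF gpos[OF that] gn[OF that]])
    ultimately have "G holomorphic_on ?S" by (rule holomorphic_transform)
    moreover have "w \<in> ?S" "open ?S" using w by auto
    ultimately have "G field_differentiable at w" using holomorphic_on_imp_differentiable_at by blast
    thus "G field_differentiable at w within ball 0 1 - {0}" by (rule field_differentiable_at_within)
  qed
  have "G \<midarrow>0\<rightarrow> 0"
  proof (rule LIM_I)
    fix e :: real assume "e > 0"
    hence "eventually (\<lambda>z. dist (f z) 0 < e) (filtercomap Im at_top)" using lim by (rule tendstoD[rotated])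
    then obtain Y where Y: "\<And>z. Im z \<ge> Y \<Longrightarrow> norm (f z) < e"
      unfolding eventually_filtercomap eventually_at_top_linorder by auto
    show "\<exists>s>0. \<forall>x. x \<noteq> 0 \<and> norm (x - 0) < s \<longrightarrow> norm (G x - 0) < e"
    proof (intro exI[of _ "exp (- pi * Y)"] conjI allI impI)
      fix x :: complex assume x: "x \<noteq> 0 \<and> norm (x - 0) < exp (- pi * Y)"
      hence "ln (norm x) < ln (exp (- pi * Y))" by (intro ln_less_cancel_iff[THEN iffD2]) auto
      hence "ln (norm x) < - pi * Y" by simp
      hence "Im (L x) \<ge> Y" using x by (simp add: ImL field_simps)
      thus "norm (G x - 0) < e" using Y x by (simp add: G_def)
    qed simp
  qed
  hence "isCont G 0" by (simp add: isCont_def G_def)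
  moreover have "continuous_on (ball 0 1 - {0}) G" using hol by (rule holomorphic_on_imp_continuous_on)
  ultimately have "continuous_on (ball 0 1) G"
    by (intro continuous_at_imp_continuous_on ballI)
       (metis Diff_iff continuous_on_eq_continuous_at empty_iff insert_iff open_Diff open_ball finite.emptyI finite_imp_closed finite_insert)
  hence G: "G holomorphic_on ball 0 1"
    by (rule no_isolated_singularity[OF _ hol]) simp_all
  have "order_ge (int 1) (\<lambda>z. nome_eval (fps_expansion G 0) (z / 2))"
    by (rule order_ge_half_eval[OF holomorphic_on_ball_fps(1)[OF G]]) (simp add: fps_expansion_def G_def)
  hence "order_ge 1 (\<lambda>z. nome_eval (fps_expansion G 0) (z / 2))" by simp
  thus ?thesis
  proof (rule order_ge_cong[rotated])
    fix z :: complex assume z: "0 < Im z"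
    have "nome_eval (fps_expansion G 0) (z / 2) = G (nome (z / 2))"
      using z by (intro nome_eval_fps_expansion[OF G]) simp
    thus "nome_eval (fps_expansion G 0) (z / 2) = f z" using eq[OF z refl] by simp
  qed
qed

text \<open>The row (0, 0) modulo 2 belongs to no matrix of determinant 1; the zero function
  satisfies the conditions of \<open>modular_family\<close> there.\<close>

definition three_family :: "(complex \<Rightarrow> complex) \<Rightarrow> (complex \<Rightarrow> complex) \<Rightarrow> (complex \<Rightarrow> complex) \<Rightarrow>
    int \<Rightarrow> int \<Rightarrow> complex \<Rightarrow> complex" where
  "three_family f0 f1 f2 c d = (if even c then if even d then (\<lambda>_. 0) else f0 else if even d then f1 else f2)"

lemma three_family_simps [simp]:
  "three_family f0 f1 f2 0 1 = f0" "three_family f0 f1 f2 1 0 = f1" "three_family f0 f1 f2 1 1 = f2"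
  by (simp_all add: three_family_def)

lemma modular_family_three:
  assumes "even k" "\<And>z. Im z > 0 \<Longrightarrow> f0 (z + 1) = f0 z" "\<And>z. Im z > 0 \<Longrightarrow> f1 (z + 1) = f2 z"
    "\<And>z. Im z > 0 \<Longrightarrow> f2 (z + 1) = f1 z" "\<And>z. Im z > 0 \<Longrightarrow> f0 (- 1 / z) = z ^ k * f1 z"
    "\<And>z. Im z > 0 \<Longrightarrow> f2 (- 1 / z) = z ^ k * f2 z"
  shows "modular_family k (three_family f0 f1 f2)"
proof -
  have "f1 (- 1 / z) = z ^ k * f0 z" if z: "Im z > 0" for z
  proof -
    have z0: "z \<noteq> 0" using z by auto
    have "f0 (- 1 / (- 1 / z)) = (- 1 / z) ^ k * f1 (- 1 / z)" by (rule assms(5)[OF Im_minus_inverse_pos[OF z]])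
    hence "f0 z = f1 (- 1 / z) / z ^ k" using assms(1) by (simp add: power_divide)
    thus ?thesis using z0 by (simp add: field_simps)
  qed
  thus ?thesis using assms by (auto simp: modular_family_def three_family_def)
qed

lemma cusp_indices_iff: "(c, d) \<in> cusp_indices \<longleftrightarrow> (c = 0 \<and> d = 1) \<or> (c = 1 \<and> d = 0) \<or> (c = 1 \<and> d = 1)"
  by (auto simp: cusp_indices_def)

text \<open>The oldform F(2z) of level 2 with its translates.\<close>

definition old_family :: "nat \<Rightarrow> complex fps \<Rightarrow> int \<Rightarrow> int \<Rightarrow> complex \<Rightarrow> complex" where
  "old_family k F = three_family (\<lambda>z. nome_eval F (2 * z)) (\<lambda>z. nome_eval F (z / 2) / 2 ^ k)
     (\<lambda>z. nome_eval F ((z + 1) / 2) / 2 ^ k)"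

lemma modular_family_old:
  assumes F: "modular_series k F"
  shows "modular_family k (old_family k F)"
  unfolding old_family_def
proof (rule modular_family_three)
  show "even k" using F by (rule modular_seriesD)
next
  fix z :: complex assume z: "Im z > 0"
  have "nome_eval F (2 * (z + 1)) = nome_eval F ((2 * z + 1) + 1)" by (simp add: algebra_simps)
  thus "nome_eval F (2 * (z + 1)) = nome_eval F (2 * z)" by (simp only: nome_eval_plus_1)
  have "nome_eval F ((z + 1 + 1) / 2) = nome_eval F (z / 2 + 1)" by (simp add: add_divide_distrib add.commute)
  thus "nome_eval F ((z + 1 + 1) / 2) / 2 ^ k = nome_eval F (z / 2) / 2 ^ k" by (simp only: nome_eval_plus_1)
  show "nome_eval F (2 * (- 1 / z)) = z ^ k * (nome_eval F (z / 2) / 2 ^ k)"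
    using modular_seriesD(3)[OF F, of "z / 2"] z by (simp add: power_divide)
  show "nome_eval F ((- 1 / z + 1) / 2) / 2 ^ k = z ^ k * (nome_eval F ((z + 1) / 2) / 2 ^ k)"
    using modular_series_half_shift[OF F z] by simp
qed auto

lemma order_ge_euler_exp_scaled:
  assumes "n > 0"
  shows "order_ge 0 (\<lambda>z. exp (a * nome_eval log_euler (of_nat n * (z / 2))))"
proof -
  let ?E = "fps_expansion (\<lambda>q. exp (a * eval_fps log_euler q)) 0"
  have "order_ge (int 0) (\<lambda>z. nome_eval (fps_stretch n ?E) (z / 2))"
    using assms by (intro order_ge_half_eval conv_radius_stretch holomorphic_on_ball_fps euler_exp_holomorphic) auto
  hence "order_ge 0 (\<lambda>z. nome_eval (fps_stretch n ?E) (z / 2))" by simp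
  thus ?thesis
  proof (rule order_ge_cong[rotated])
    fix z :: complex assume z: "0 < Im z"
    hence "Im (of_nat n * (z / 2)) > 0" using assms by simp
    from nome_eval_fps_expansion[OF euler_exp_holomorphic this, of a]
    show "nome_eval (fps_stretch n ?E) (z / 2) = exp (a * nome_eval log_euler (of_nat n * (z / 2)))"
      using z assms by (simp add: nome_eval_stretch holomorphic_on_ball_fps euler_exp_holomorphic nome_eval_def[of log_euler])
  qed
qed

lemma order_ge_euler_exps: "order_ge 0 (\<lambda>z. exp (a * nome_eval log_euler (z / 2)))"
  "order_ge 0 (\<lambda>z. exp (a * nome_eval log_euler (2 * z)))"
  using order_ge_euler_exp_scaled[of 1 a] order_ge_euler_exp_scaled[of 4 a] by simp_all

subsection \<open>Level 2\<close>

text \<open>q times the product of (1 - q^n)^8 (1 - q^(2n))^8, again as an exponential.\<close>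

definition phi_series :: "complex fps" where
  "phi_series = fps_X * fps_expansion (\<lambda>q. exp (8 * eval_fps (log_euler + fps_stretch 2 log_euler) q)) 0"

lemma conv_radius_phi_log: "fps_conv_radius (log_euler + fps_stretch 2 log_euler) \<ge> 1"
  by (rule order.trans[OF _ fps_conv_radius_add]) (simp add: conv_radius_log_euler conv_radius_stretch)

lemma phi_exp_holomorphic: "(\<lambda>q. exp (8 * eval_fps (log_euler + fps_stretch 2 log_euler) q)) holomorphic_on ball 0 1"
  by (intro holomorphic_intros eval_fps_holomorphic_on_ball conv_radius_phi_log)

lemma conv_radius_phi: "fps_conv_radius phi_series \<ge> 1"
  unfolding phi_series_def
  by (intro conv_radius_mult_ge_1 holomorphic_on_ball_fps phi_exp_holomorphic) auto

lemma phi_series_nth_0_1 [simp]: "fps_nth phi_series 0 = 0" "fps_nth phi_series (Suc 0) = 1"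
  by (simp_all add: phi_series_def fps_expansion_def eval_fps_at_0 log_euler_def fps_stretch_def)

lemma nome_eval_phi:
  assumes "Im z > 0"
  shows "nome_eval phi_series z = nome z * (exp (8 * nome_eval log_euler z) * exp (8 * nome_eval log_euler (2 * z)))"
proof -
  have "nome_eval phi_series z = nome_eval fps_X z *
     nome_eval (fps_expansion (\<lambda>q. exp (8 * eval_fps (log_euler + fps_stretch 2 log_euler) q)) 0) z"
    unfolding phi_series_def
    by (intro nome_eval_mult holomorphic_on_ball_fps phi_exp_holomorphic assms) auto
  also have "nome_eval (fps_expansion (\<lambda>q. exp (8 * eval_fps (log_euler + fps_stretch 2 log_euler) q)) 0) z =
      exp (8 * nome_eval (log_euler + fps_stretch 2 log_euler) z)"
    using nome_eval_fps_expansion[OF phi_exp_holomorphic assms] by (simp add: nome_eval_def)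
  also have "nome_eval (log_euler + fps_stretch 2 log_euler) z = nome_eval log_euler z + nome_eval (fps_stretch 2 log_euler) z"
    unfolding nome_eval_def using assms
    by (intro eval_fps_add nome_in_eball conv_radius_stretch conv_radius_log_euler) auto
  also have "nome_eval (fps_stretch 2 log_euler) z = nome_eval log_euler (2 * z)"
    using assms by (simp add: nome_eval_stretch conv_radius_log_euler)
  finally show ?thesis by (simp add: nome_eval_def[of fps_X] distrib_left exp_add)
qed

lemma nome_eval_phi_eta: "Im z > 0 \<Longrightarrow> nome_eval phi_series z = dedekind_eta z ^ 8 * dedekind_eta (2 * z) ^ 8"
  by (simp add: nome_eval_phi eta8_eq exp_add nome_def algebra_simps add_divide_distrib flip: exp_add)

text \<open>The expansion of phi_8 at the cusp 0; the factor 1/16 comes from (z / 2)^4 in the law of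
  eta(2z)^8.\<close>

definition phi_cusp :: "complex \<Rightarrow> complex" where
  "phi_cusp z = dedekind_eta z ^ 8 * dedekind_eta (z / 2) ^ 8 / 16"

lemma phi_cusp_eq:
  assumes "Im z > 0"
  shows "phi_cusp z = nome (z / 2) * (exp (8 * nome_eval log_euler z) * exp (8 * nome_eval log_euler (z / 2))) / 16"
  using assms by (simp add: phi_cusp_def eta8_eq nome_def algebra_simps add_divide_distrib flip: exp_add)

definition phi_family :: "int \<Rightarrow> int \<Rightarrow> complex \<Rightarrow> complex" where
  "phi_family = three_family (nome_eval phi_series) phi_cusp (\<lambda>z. phi_cusp (z + 1))"

lemma eta8_plus_1:
  assumes "Im z > 0"
  shows "dedekind_eta (z + 1) ^ 8 = exp (2 * of_real pi * \<i> / 3) * dedekind_eta z ^ 8"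
proof -
  have "Im (z + 1) > 0" using assms by simp
  from eta8_eq[OF this] eta8_eq[OF assms] show ?thesis
    unfolding nome_eval_plus_1 by (simp add: algebra_simps add_divide_distrib flip: exp_add)
qed

text \<open>The point is reached from w = (z + 1) / 2 by a translation, an inversion, two
  translations and an inversion. Each translation brings the cube root of unity \<open>e\<close>,
  and the three of them cancel.\<close>

lemma eta8_half_shift:
  assumes z: "Im z > 0"
  shows "dedekind_eta ((- 1 / z + 1) / 2) ^ 8 = z ^ 4 * dedekind_eta ((z + 1) / 2) ^ 8"
proof -
  define w where "w = (z + 1) / 2"
  define e where "e = exp (2 * of_real pi * \<i> / 3)"
  define y where "y = - 1 / (w - 1)"
  define x where "x = y - 2"
  have e3: "e ^ 3 = 1" by (simp add: e_def exp_of_nat_mult[symmetric] mult_ac exp_two_pi_i')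
  have e0: "e \<noteq> 0" by (simp add: e_def)
  have w1: "Im (w - 1) > 0" using z by (simp add: w_def)
  have y: "Im y > 0" unfolding y_def by (rule Im_minus_inverse_pos[OF w1])
  have x: "Im x > 0" using y by (simp add: x_def)
  have nz: "z \<noteq> 0" "w - 1 \<noteq> 0" "x \<noteq> 0" using z w1 x by auto
  have wz: "w - 1 = (z - 1) / 2" by (simp add: w_def diff_divide_distrib add_divide_distrib)
  have z1: "z - 1 \<noteq> 0" using nz(2) wz by auto
  have xw: "x * (w - 1) = - z"
  proof -
    have "x * (w - 1) = y * (w - 1) - 2 * (w - 1)" unfolding x_def by (rule left_diff_distrib)
    also have "y * (w - 1) = - 1" using nz(2) by (simp add: y_def)
    also have "2 * (w - 1) = z - 1" unfolding wz by simp
    finally show ?thesis by simp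
  qed
  have "(- 1 / z + 1) / 2 = - 1 / x"
  proof -
    have "- 1 / x = (w - 1) / z" using xw nz by (simp add: field_simps)
    also have "\<dots> = ((z - 1) / 2) / z" by (simp only: wz)
    finally have e: "- 1 / x = ((z - 1) / 2) / z" .
    show ?thesis unfolding e using nz(1) by (simp add: field_simps)
  qed
  hence "dedekind_eta ((- 1 / z + 1) / 2) ^ 8 = x ^ 4 * dedekind_eta x ^ 8"
    using eta8_minus_inverse[OF x] by simp
  moreover have "dedekind_eta y ^ 8 = e * (e * dedekind_eta x ^ 8)"
  proof -
    have "Im (x + 1) > 0" using x by simp
    from eta8_plus_1[OF this] eta8_plus_1[OF x] show ?thesis by (simp add: x_def e_def)
  qed
  moreover have "dedekind_eta y ^ 8 = (w - 1) ^ 4 * dedekind_eta (w - 1) ^ 8"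
    unfolding y_def by (rule eta8_minus_inverse[OF w1])
  moreover have "dedekind_eta w ^ 8 = e * dedekind_eta (w - 1) ^ 8"
    using eta8_plus_1[OF w1] by (simp add: e_def)
  ultimately have "e ^ 3 * dedekind_eta ((- 1 / z + 1) / 2) ^ 8 = (x * (w - 1)) ^ 4 * dedekind_eta w ^ 8"
    by (simp add: power_mult_distrib power3_eq_cube) 
  thus ?thesis using e3 unfolding xw by (simp add: w_def)
qed

lemma modular_family_phi: "modular_family 8 phi_family"
  unfolding phi_family_def
proof (rule modular_family_three)
  fix z :: complex assume z: "Im z > 0"
  show "nome_eval phi_series (z + 1) = nome_eval phi_series z" by (rule nome_eval_plus_1)
  show "phi_cusp (z + 1 + 1) = phi_cusp z"
  proof -
    have "nome ((z + 1 + 1) / 2) = nome (z / 2)" "nome_eval log_euler ((z + 1 + 1) / 2) = nome_eval log_euler (z / 2)"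
      using nome_plus_1[of "z / 2"] nome_eval_plus_1[of log_euler "z / 2"] by (simp_all add: add_divide_distrib add.commute)
    moreover have "nome_eval log_euler (z + 1 + 1) = nome_eval log_euler z" by (simp only: nome_eval_plus_1)
    moreover have "Im (z + 1 + 1) > 0" using z by simp
    ultimately show ?thesis using z by (simp only: phi_cusp_eq)
  qed
  have "nome_eval phi_series (- 1 / z) = dedekind_eta (- 1 / z) ^ 8 * dedekind_eta (- 1 / (z / 2)) ^ 8"
    using nome_eval_phi_eta[OF Im_minus_inverse_pos[OF z]] by simp
  also have "\<dots> = (z ^ 4 * dedekind_eta z ^ 8) * ((z / 2) ^ 4 * dedekind_eta (z / 2) ^ 8)"
    using z by (subst (1 2) eta8_minus_inverse) auto
  also have "\<dots> = z ^ 8 * phi_cusp z" by (simp add: phi_cusp_def power_divide flip: power_add)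
  finally show "nome_eval phi_series (- 1 / z) = z ^ 8 * phi_cusp z" .
  have "dedekind_eta (- 1 / z + 1) ^ 8 = z ^ 4 * dedekind_eta (z + 1) ^ 8"
    unfolding eta8_plus_1[OF Im_minus_inverse_pos[OF z]] eta8_plus_1[OF z] eta8_minus_inverse[OF z] by simp
  thus "phi_cusp (- 1 / z + 1) = z ^ 8 * phi_cusp (z + 1)"
    unfolding phi_cusp_def eta8_half_shift[OF z] by (simp flip: power_add)
qed auto

lemma order_ge_phi_cusp: "order_ge 1 phi_cusp"
proof -
  have "order_ge (1 + (0 + 0)) (\<lambda>z. nome (z / 2) powi 1 * ((1 / 16 * exp (8 * nome_eval log_euler z)) * exp (8 * nome_eval log_euler (z / 2))))"
    by (intro order_ge_mult order_ge_half_nome order_ge_euler_exp order_ge_euler_exps order_ge_cmult)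
  thus ?thesis by (intro order_ge_cong[of _ phi_cusp]) (auto simp: phi_cusp_eq)
qed

lemma order_ge_inverse_phi_cusp: "order_ge (- 1) (\<lambda>z. 1 / phi_cusp z)"
proof -
  have "order_ge (- 1 + (0 + 0)) (\<lambda>z. nome (z / 2) powi (- 1) * ((16 * exp (- 8 * nome_eval log_euler z)) * exp (- 8 * nome_eval log_euler (z / 2))))"
    by (intro order_ge_mult order_ge_half_nome order_ge_euler_exp order_ge_euler_exps order_ge_cmult)
  hence "order_ge (- 1) (\<lambda>z. nome (z / 2) powi (- 1) * ((16 * exp (- 8 * nome_eval log_euler z)) * exp (- 8 * nome_eval log_euler (z / 2))))" by simp
  thus ?thesis by (rule order_ge_cong[rotated]) (simp add: phi_cusp_eq exp_minus power_int_minus field_simps)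
qed

lemma order_ge_inverse_phi: "order_ge (- 2) (\<lambda>z. 1 / nome_eval phi_series z)"
proof -
  have "order_ge (- 2 + (0 + 0)) (\<lambda>z. nome (z / 2) powi (- 2) * (exp (- 8 * nome_eval log_euler z) * exp (- 8 * nome_eval log_euler (2 * z))))"
    by (intro order_ge_mult order_ge_half_nome order_ge_euler_exp order_ge_euler_exps)
  hence "order_ge (- 2) (\<lambda>z. nome (z / 2) powi (- 2) * (exp (- 8 * nome_eval log_euler z) * exp (- 8 * nome_eval log_euler (2 * z))))" by simp
  thus ?thesis
    by (rule order_ge_cong[rotated]) (simp add: nome_eval_phi exp_minus power_int_minus half_nome_square field_simps)
qed

text \<open>phi_8 has no zeros in the upper half plane and simple ones at both cusps, measured as 2
  at infinity and 1 at the cusp 0. Hence every cusp form of its weight and level is a multiple of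
  it.\<close>

lemma proportional_to_phi:
  assumes h: "modular_family 8 h" and ord: "order_ge 2 (h 0 1)" "order_ge 1 (h 1 0)" "order_ge 1 (h 1 1)"
  shows "\<exists>C. \<forall>z. Im z > 0 \<longrightarrow> h 0 1 z = C * nome_eval phi_series z"
proof -
  have nz: "phi_cusp z \<noteq> 0" if "Im z > 0" for z using that by (simp add: phi_cusp_eq)
  have "\<exists>C. \<forall>(c, d)\<in>cusp_indices. \<forall>z. Im z > 0 \<longrightarrow> h c d z = C * phi_family c d z"
  proof (rule modular_family_proportional[OF h modular_family_phi, where m = "\<lambda>c d. if c = 0 then 2 else 1"])
    fix c d :: int assume cd: "(c, d) \<in> cusp_indices"
    show "order_ge (if c = 0 then 2 else 1) (h c d)" using cd ord by (auto simp: cusp_indices_iff)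
    show "order_ge (- (if c = 0 then 2 else 1)) (\<lambda>z. 1 / phi_family c d z)"
      using cd order_ge_inverse_phi order_ge_inverse_phi_cusp order_ge_shift[OF order_ge_inverse_phi_cusp]
      by (auto simp: cusp_indices_iff phi_family_def)
    show "phi_family c d z \<noteq> 0" if "Im z > 0" for z
      using cd nz that nome_eval_phi[OF that] by (auto simp: cusp_indices_iff phi_family_def)
  qed
  then obtain C where C: "\<forall>(c, d)\<in>cusp_indices. \<forall>z. Im z > 0 \<longrightarrow> h c d z = C * phi_family c d z" by blast
  have "(0, 1) \<in> cusp_indices" by (simp add: cusp_indices_iff)
  from bspec[OF C this] show ?thesis by (auto simp: phi_family_def)
qed

text \<open>T_p preserves the vanishing at both cusps, so its image lies in the line spanned by
  phi_8.\<close>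

lemma hecke_phi:
  assumes p: "prime p" "odd p"
  shows "\<exists>a. hecke_fps 8 p phi_series = fps_const a * phi_series"
proof -
  have p0: "p > 0" using p prime_gt_0_nat by blast
  have "modular_family 8 (hecke_family 8 p phi_family)" by (rule modular_family_hecke[OF modular_family_phi p]) simp
  moreover have eq: "hecke_family 8 p phi_family 0 1 z = nome_eval (hecke_fps 8 p phi_series) z" if "Im z > 0" for z
    using that by (intro hecke_family_nome_eval[OF p conv_radius_phi]) (auto simp: phi_family_def)
  have "order_ge (2 * int 1) (nome_eval (hecke_fps 8 p phi_series))"
    using p0 by (intro order_ge_nome_eval conv_radius_hecke conv_radius_phi) (auto simp: hecke_fps_nth)
  hence "order_ge 2 (hecke_family 8 p phi_family 0 1)" using eq by (simp add: order_ge_def)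
  moreover have "order_ge 1 (hecke_family 8 p phi_family c d)" if "order_ge 1 (phi_family c d)" for c d
  proof -
    have "order_ge (int 1) (phi_family c d)" using that by simp
    then obtain G where G: "fps_conv_radius G \<ge> 1" "\<And>i. i < 1 \<Longrightarrow> fps_nth G i = 0"
      "\<And>z. Im z > 0 \<Longrightarrow> phi_family c d z = nome_eval G (z / 2)"
      using order_ge_imp_half_eval by blast
    have "order_ge (int 1) (\<lambda>z. nome_eval (hecke_fps 8 p G) (z / 2))"
      using p0 G by (intro order_ge_half_eval conv_radius_hecke) (auto simp: hecke_fps_nth)
    hence "order_ge 1 (\<lambda>z. nome_eval (hecke_fps 8 p G) (z / 2))" by simp
    thus ?thesis by (rule order_ge_cong[rotated]) (use hecke_family_half_eval[OF p0 G(1)] G(3) in auto)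
  qed
  moreover have "order_ge 1 (phi_family 1 0)" "order_ge 1 (phi_family 1 1)"
    using order_ge_phi_cusp order_ge_shift[OF order_ge_phi_cusp] by (simp_all add: phi_family_def)
  ultimately obtain C where C: "\<And>z. Im z > 0 \<Longrightarrow> hecke_family 8 p phi_family 0 1 z = C * nome_eval phi_series z"
    using proportional_to_phi by blast
  have "hecke_fps 8 p phi_series = fps_const C * phi_series"
    by (rule fps_eq_if_nome_eval_eq)
       (use p0 eq C in \<open>auto intro!: conv_radius_hecke conv_radius_phi conv_radius_const_mult simp: nome_eval_cmult conv_radius_phi\<close>)
  thus ?thesis by blast
qed

theorem multiplicative_phi: "multiplicative_fps phi_series"
proof (rule multiplicative_if_hecke[of _ 8])
  fix p :: nat assume "prime p" "odd p"
  then obtain a where "hecke_fps 8 p phi_series = fps_const a * phi_series" using hecke_phi by blast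
  thus "\<exists>a. \<forall>n>0. fps_nth (hecke_fps 8 p phi_series) n = a * fps_nth phi_series n" by auto
qed simp

theorem normalized_cusp_series_level_2_iff: "normalized_cusp_series 2 8 F \<longleftrightarrow> F = phi_series"
proof
  assume "F = phi_series"
  moreover have "cusp_form 2 8 (phi_family 0 1)"
  proof (rule cusp_form_family[OF modular_family_phi])
    have "order_ge (2 * int 1) (nome_eval phi_series)" by (intro order_ge_nome_eval conv_radius_phi) auto
    hence "order_ge 1 (nome_eval phi_series)" by (rule order_ge_mono) simp
    thus "order_ge 1 (phi_family c d)" if "(c, d) \<in> cusp_indices" for c d
      using that order_ge_phi_cusp order_ge_shift[OF order_ge_phi_cusp]
      by (auto simp: cusp_indices_iff phi_family_def)
    fix c d :: int assume "coprime c d" "int 2 dvd c"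
    hence "even c" "odd d" using coprime_common_divisor[of c d 2] by auto
    thus "phi_family c d = phi_family 0 1" by (simp add: phi_family_def three_family_def)
  qed
  ultimately show "normalized_cusp_series 2 8 F"
    using has_q_expansion_nome_eval[OF conv_radius_phi] by (auto simp: normalized_cusp_series_def phi_family_def)
next
  assume "normalized_cusp_series 2 8 F"
  then obtain f where F1: "fps_nth F 1 = 1" and f: "cusp_form 2 8 f" "has_q_expansion f F"
    by (auto simp: normalized_cusp_series_def)
  note r = has_q_expansionD(1)[OF f(2)] and eq = has_q_expansionD(2)[OF f(2)]
  have F0: "fps_nth F 0 = 0" by (rule cusp_form_q_expansion_nth_0[OF f])
  have hol: "f holomorphic_on upper_half_plane" using f(1) by (simp add: cusp_form_def)
  have inv: "f ((of_int a * z + of_int b) / (of_int c * z + of_int d)) = (of_int c * z + of_int d) ^ 8 * f z"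
    if "a * d - b * c = 1" "even c" "Im z > 0" for a b c d :: int and z
  proof -
    have "\<forall>a b c d :: int. a * d - b * c = 1 \<longrightarrow> int 2 dvd c \<longrightarrow>
        (\<forall>z\<in>upper_half_plane. f ((of_int a * z + of_int b) / (of_int c * z + of_int d)) = (of_int c * z + of_int d) ^ 8 * f z)"
      using f(1) unfolding cusp_form_def by blast
    thus ?thesis using that by (simp add: upper_half_plane_def)
  qed
  define f1 where "f1 z = f (- 1 / z) / z ^ 8" for z
  have f1_per: "f1 (z + 2) = f1 z" if z: "Im z > 0" for z
  proof -
    have nz: "z \<noteq> 0" "z + 2 \<noteq> 0" using z by (auto simp: complex_eq_iff)
    \<comment> \<open>Translation by 2, conjugated by the inversion, has rows (1, 0) and (-2, 1) and
      so lies in the group of level 2.\<close>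
    have "f ((of_int 1 * (- 1 / z) + of_int 0) / (of_int (- 2) * (- 1 / z) + of_int 1)) =
        (of_int (- 2) * (- 1 / z) + of_int 1) ^ 8 * f (- 1 / z)"
      by (rule inv) (use Im_minus_inverse_pos[OF z] in auto)
    moreover have fac: "of_int (- 2) * (- 1 / z) + of_int 1 = (z + 2) / z" using nz by (simp add: field_simps)
    moreover have mov: "(of_int 1 * (- 1 / z) + of_int 0) / ((z + 2) / z) = - 1 / (z + 2)" using nz by (simp add: field_simps)
    ultimately have "f (- 1 / (z + 2)) = ((z + 2) / z) ^ 8 * f (- 1 / z)" by (simp only: fac mov)
    thus ?thesis using nz by (simp add: f1_def power_divide)
  qed
  have f1_hol: "f1 holomorphic_on upper_half_plane"
    unfolding f1_def
    by (intro holomorphic_intros holomorphic_on_compose_gen[of "\<lambda>z. - 1 / z" _ f upper_half_plane, unfolded o_def] hol)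
       (auto simp: upper_half_plane_def)
  have f1_lim: "(f1 \<longlongrightarrow> 0) (filtercomap Im at_top)"
  proof -
    have "\<forall>a b c d :: int. a * d - b * c = 1 \<longrightarrow>
        ((\<lambda>z. f ((of_int a * z + of_int b) / (of_int c * z + of_int d)) /
              (of_int c * z + of_int d) ^ 8) \<longlongrightarrow> 0) (filtercomap Im at_top)"
      using f(1) by (simp add: cusp_form_def)
    from this[rule_format, of 0 0 "- 1" 1] show ?thesis by (simp add: f1_def [abs_def])
  qed
  have ord1: "order_ge 1 f1" by (rule order_ge_if_periodic[OF f1_hol f1_per f1_lim])
  have "modular_family 8 (three_family f f1 (\<lambda>z. f1 (z + 1)))"
  proof (rule modular_family_three)
    fix z :: complex assume z: "Im z > 0"
    have nz: "z \<noteq> 0" "z + 1 \<noteq> 0" "z - 1 \<noteq> 0" using z by (auto simp: complex_eq_iff)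
    show "f (z + 1) = f z" using eq[OF z] eq[of "z + 1"] z by (simp add: nome_eval_plus_1)
    show "f1 (z + 1 + 1) = f1 z" using f1_per[OF z] by (simp add: add.assoc)
    show "f (- 1 / z) = z ^ 8 * f1 z" using nz by (simp add: f1_def)
    \<comment> \<open>The two arguments of \<open>f\<close> that occur in the claim are related by
      the matrix with rows (-1, -1) and (2, 1), whose lower left entry is even.\<close>
    define u where "u = - 1 / (z + 1)"
    have u: "Im u > 0" unfolding u_def using z by (intro Im_minus_inverse_pos) simp
    have fac: "of_int 2 * u + of_int 1 = (z - 1) / (z + 1)" using nz by (simp add: u_def field_simps)
    have mov: "(of_int (- 1) * u + of_int (- 1)) / ((z - 1) / (z + 1)) = - 1 / (- 1 / z + 1)"
      using nz by (simp add: u_def divide_simps)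
    have "f ((of_int (- 1) * u + of_int (- 1)) / (of_int 2 * u + of_int 1)) = (of_int 2 * u + of_int 1) ^ 8 * f u"
      by (rule inv) (use u in auto)
    hence "f (- 1 / (- 1 / z + 1)) = ((z - 1) / (z + 1)) ^ 8 * f (- 1 / (z + 1))"
      unfolding fac mov by (simp add: u_def)
    moreover have "- 1 / z + 1 = (z - 1) / z" using nz by (simp add: field_simps)
    ultimately have "f1 (- 1 / z + 1) = ((z - 1) / (z + 1)) ^ 8 * f (- 1 / (z + 1)) / ((z - 1) / z) ^ 8"
      by (simp add: f1_def)
    thus "f1 (- 1 / z + 1) = z ^ 8 * f1 (z + 1)" using nz by (simp add: f1_def power_divide)
  qed auto
  moreover have "order_ge (2 * int 1) (nome_eval F)" using F0 by (intro order_ge_nome_eval r) auto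
  hence "order_ge 2 f" using eq by (simp add: order_ge_def)
  ultimately obtain C where C: "\<And>z. Im z > 0 \<Longrightarrow> f z = C * nome_eval phi_series z"
    using proportional_to_phi[of "three_family f f1 (\<lambda>z. f1 (z + 1))"] ord1 order_ge_shift[OF ord1] by auto
  have "F = fps_const C * phi_series"
    by (rule fps_eq_if_nome_eval_eq[OF r])
       (use eq C in \<open>auto intro!: conv_radius_phi conv_radius_const_mult simp: nome_eval_cmult conv_radius_phi\<close>)
  moreover from this F1 have "C = 1" by simp
  ultimately show "F = phi_series" by simp
qed

lemma phi8_eq: "phi8 = phi_series"
  unfolding phi8_def
  by (rule q_expansion_eqI)
     (use has_q_expansion_nome_eval[OF conv_radius_phi] nome_eval_phi_eta in \<open>simp add: has_q_expansion_def upper_half_plane_def\<close>)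

text \<open>The logarithmic derivative of the product, used as a recursion for the first
  coefficients.\<close>

lemma theta_phi: "fps_const 3 * theta phi_series = (E2 + fps_const 2 * fps_stretch 2 E2) * phi_series"
proof (rule fps_eq_if_nome_eval_eq)
  have rr: "fps_conv_radius (E2 + fps_const 2 * fps_stretch 2 E2) \<ge> 1"
    by (rule order.trans[OF _ fps_conv_radius_add])
       (auto intro!: conv_radius_E2 conv_radius_const_mult conv_radius_stretch)
  thus "fps_conv_radius ((E2 + fps_const 2 * fps_stretch 2 E2) * phi_series) \<ge> 1"
    by (intro conv_radius_mult_ge_1 conv_radius_phi)
  show "fps_conv_radius (fps_const 3 * theta phi_series) \<ge> 1"
    by (intro conv_radius_const_mult conv_radius_theta conv_radius_phi)
  fix z :: complex assume z: "Im z > 0"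
  have z2: "Im (2 * z) > 0" using z by simp
  have "((\<lambda>z. nome z * (exp (8 * nome_eval log_euler z) * exp (8 * nome_eval log_euler (2 * z)))) has_field_derivative
      2 * of_real pi * \<i> * ((nome_eval E2 z + 2 * nome_eval E2 (2 * z)) * nome_eval phi_series z / 3)) (at z)"
    using z z2 by (auto intro!: derivative_eq_intros nome_eval_has_derivative[THEN DERIV_chain2] conv_radius_log_euler
        simp: nome_eval_E2 nome_eval_phi algebra_simps)
  hence "nome_eval (theta phi_series) z = (nome_eval E2 z + 2 * nome_eval E2 (2 * z)) * nome_eval phi_series z / 3"
    using z nome_eval_phi by (intro nome_eval_theta_eqI[OF conv_radius_phi]) auto
  moreover have "nome_eval (E2 + fps_const 2 * fps_stretch 2 E2) z = nome_eval E2 z + nome_eval (fps_const 2 * fps_stretch 2 E2) z"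
    unfolding nome_eval_def using z
    by (intro eval_fps_add nome_in_eball conv_radius_E2 conv_radius_const_mult conv_radius_stretch) auto
  ultimately show "nome_eval (fps_const 3 * theta phi_series) z = nome_eval ((E2 + fps_const 2 * fps_stretch 2 E2) * phi_series) z"
    using z rr by (simp add: nome_eval_mult nome_eval_cmult conv_radius_phi conv_radius_theta conv_radius_E2
        conv_radius_stretch nome_eval_stretch mult.commute[of _ 3] del: fps_const_mult)
qed

subsection \<open>The six series\<close>

lemma divisor_sigma_values:
  "divisor_sigma 1 2 = 3" "divisor_sigma 1 3 = 4" "divisor_sigma 1 4 = 7" "divisor_sigma 1 5 = 6"
  "divisor_sigma 3 2 = 9" "divisor_sigma 3 3 = 28" "divisor_sigma 3 4 = 73" "divisor_sigma 3 5 = 126"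
proof -
  have p: "divisor_sigma r p = 1 + p ^ r" if "prime p" for p r
  proof -
    have "\<not> p dvd 1" using that by (simp add: prime_nat_iff)
    thus ?thesis using sigma_prime_mult[OF that, of 1 r] by simp
  qed
  have 4: "divisor_sigma r 4 + 2 ^ r = (1 + 2 ^ r) * divisor_sigma r 2" for r
    using sigma_prime_mult[of 2 2 r] by simp
  have "prime (2::nat)" "prime (3::nat)" "prime (5::nat)" by simp_all
  note v = this[THEN p]
  show "divisor_sigma 1 2 = 3" "divisor_sigma 1 3 = 4" "divisor_sigma 1 5 = 6"
    "divisor_sigma 3 2 = 9" "divisor_sigma 3 3 = 28" "divisor_sigma 3 5 = 126" by (simp_all add: v)
  show "divisor_sigma 1 4 = 7" "divisor_sigma 3 4 = 73" using 4[of 1] 4[of 3] by (simp_all add: v)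
qed

lemma fps_mult_nth_upto_5:
  fixes F G :: "complex fps"
  shows "fps_nth (F * G) 2 = fps_nth F 0 * fps_nth G 2 + fps_nth F (Suc 0) * fps_nth G (Suc 0) + fps_nth F 2 * fps_nth G 0"
    "fps_nth (F * G) 3 = fps_nth F 0 * fps_nth G 3 + fps_nth F (Suc 0) * fps_nth G 2 + fps_nth F 2 * fps_nth G (Suc 0) + fps_nth F 3 * fps_nth G 0"
    "fps_nth (F * G) 4 = fps_nth F 0 * fps_nth G 4 + fps_nth F (Suc 0) * fps_nth G 3 + fps_nth F 2 * fps_nth G 2
       + fps_nth F 3 * fps_nth G (Suc 0) + fps_nth F 4 * fps_nth G 0"
    "fps_nth (F * G) 5 = fps_nth F 0 * fps_nth G 5 + fps_nth F (Suc 0) * fps_nth G 4 + fps_nth F 2 * fps_nth G 3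
       + fps_nth F 3 * fps_nth G 2 + fps_nth F 4 * fps_nth G (Suc 0) + fps_nth F 5 * fps_nth G 0"
proof -
  have "{0..2::nat} = {0, 1, 2}" "{0..3::nat} = {0, 1, 2, 3}" "{0..4::nat} = {0, 1, 2, 3, 4}" "{0..5::nat} = {0, 1, 2, 3, 4, 5}"
    by auto
  thus "fps_nth (F * G) 2 = fps_nth F 0 * fps_nth G 2 + fps_nth F (Suc 0) * fps_nth G (Suc 0) + fps_nth F 2 * fps_nth G 0"
    "fps_nth (F * G) 3 = fps_nth F 0 * fps_nth G 3 + fps_nth F (Suc 0) * fps_nth G 2 + fps_nth F 2 * fps_nth G (Suc 0) + fps_nth F 3 * fps_nth G 0"
    "fps_nth (F * G) 4 = fps_nth F 0 * fps_nth G 4 + fps_nth F (Suc 0) * fps_nth G 3 + fps_nth F 2 * fps_nth G 2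
       + fps_nth F 3 * fps_nth G (Suc 0) + fps_nth F 4 * fps_nth G 0"
    "fps_nth (F * G) 5 = fps_nth F 0 * fps_nth G 5 + fps_nth F (Suc 0) * fps_nth G 4 + fps_nth F 2 * fps_nth G 3
       + fps_nth F 3 * fps_nth G 2 + fps_nth F 4 * fps_nth G (Suc 0) + fps_nth F 5 * fps_nth G 0"
    by (simp_all add: fps_mult_nth)
qed

lemma fps_mult_nth_Suc_0: "fps_nth (F * G) (Suc 0) = fps_nth F 0 * fps_nth G (Suc 0) + fps_nth F (Suc 0) * fps_nth G 0"
  by (simp add: fps_mult_nth)

lemmas nth_mult = fps_mult_nth_upto_5 fps_mult_nth_Suc_0 fps_mult_nth_0

lemma E2_values: "fps_nth E2 2 = - 72" "fps_nth E2 3 = - 96" "fps_nth E2 4 = - 168" "fps_nth E2 5 = - 144"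
  by (simp_all add: E2_def divisor_sigma_values[unfolded One_nat_def])

lemma E4_values: "fps_nth E4 2 = 2160" "fps_nth E4 3 = 6720" "fps_nth E4 4 = 17520" "fps_nth E4 5 = 30240"
  by (simp_all add: E4_def divisor_sigma_values)

lemma E6_values: "fps_nth E6 2 = - 16632" "fps_nth E6 3 = - 122976" "fps_nth E6 4 = - 532728" "fps_nth E6 5 = - 1575504"
  by (simp_all add: E6_def E4_ramanujan_eq nth_mult E2_values E4_values)

lemma discriminant_values:
  "fps_nth discriminant 2 = - 24" "fps_nth discriminant 3 = 252" "fps_nth discriminant 4 = - 1472" "fps_nth discriminant 5 = 4830"
proof -
  have *: "of_nat n * fps_nth discriminant n = fps_nth (E2 * discriminant) n" for n
    by (simp flip: theta_discriminant)
  show 2: "fps_nth discriminant 2 = - 24" using *[of 2] by (simp add: nth_mult)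
  show 3: "fps_nth discriminant 3 = 252" using *[of 3] by (simp add: nth_mult 2 E2_values)
  show 4: "fps_nth discriminant 4 = - 1472" using *[of 4] by (simp add: nth_mult 2 3 E2_values)
  show 5: "fps_nth discriminant 5 = 4830" using *[of 5] by (simp add: nth_mult 2 3 4 E2_values)
qed

lemma phi_values:
  "fps_nth phi_series 2 = - 8" "fps_nth phi_series 3 = 12" "fps_nth phi_series 4 = 64" "fps_nth phi_series 5 = - 210"
proof -
  define E where "E = E2 + fps_const 2 * fps_stretch 2 E2"
  have E: "fps_nth E 0 = 3" "fps_nth E (Suc 0) = - 24" "fps_nth E 2 = - 120" "fps_nth E 3 = - 96" "fps_nth E 4 = - 312"
    by (simp_all add: E_def fps_stretch_def E2_values)
  have *: "3 * (of_nat n * fps_nth phi_series n) = fps_nth (E * phi_series) n" for n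
    unfolding E_def theta_phi[symmetric] by simp
  show 2: "fps_nth phi_series 2 = - 8" using *[of 2] by (simp add: nth_mult E)
  show 3: "fps_nth phi_series 3 = 12" using *[of 3] by (simp add: nth_mult 2 E)
  show 4: "fps_nth phi_series 4 = 64" using *[of 4] by (simp add: nth_mult 2 3 E)
  show 5: "fps_nth phi_series 5 = - 210" using *[of 5] by (simp add: nth_mult 2 3 4 E)
qed

text \<open>The quotient of the difference of both sides by the nowhere vanishing form
  \<open>\<Delta>(2z)\<^sup>2 / \<Delta>(z)\<close>, which has a triple zero at infinity and none at the other cusp, is constant.\<close>

theorem E4_mult_phi: "E4 * phi_series = discriminant + fps_const 256 * fps_stretch 2 discriminant"
proof -
  note D = modular_series_discriminant and rD = conv_radius_discriminant
  note r4 = modular_seriesD(2)[OF modular_series_E4]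
  \<comment> \<open>The constant 256 is forced by the coefficients at q^2: 240 - 8 = -24 +
    256.\<close>
  define h where "h c d z = (nome_eval E4 z * phi_family c d z - nome_eval discriminant z) - 256 * old_family 12 discriminant c d z"
    for c d z
  define r where "r c d z = old_family 12 discriminant c d z ^ 2 / nome_eval discriminant z" for c d z
  have "modular_family (4 + 8) (\<lambda>c d z. nome_eval E4 z * phi_family c d z)"
    by (rule modular_family_mult[OF modular_series_family[OF modular_series_E4] modular_family_phi])
  hence "modular_family 12 (\<lambda>c d z. nome_eval E4 z * phi_family c d z)" by simp
  hence h: "modular_family 12 h" unfolding h_def [abs_def]
    by (intro modular_family_diff modular_family_cmult modular_family_old modular_series_family D)
  have "modular_family (12 + 12) (\<lambda>c d z. old_family 12 discriminant c d z ^ 2)"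
    using modular_family_power[OF modular_family_old[OF D], of 2] by simp
  hence r: "modular_family 12 r" unfolding r_def [abs_def]
    by (rule modular_family_divide[OF _ modular_series_family[OF D]])
  have Dhalf: "nome_eval discriminant (z / 2) = nome (z / 2) * exp (24 * nome_eval log_euler (z / 2))" if "Im z > 0" for z
    using that by (simp add: nome_eval_discriminant)
  have old1: "order_ge 1 (\<lambda>z. nome_eval discriminant (z / 2) / 2 ^ 12)"
  proof -
    have "order_ge (int 1) (\<lambda>z. nome_eval discriminant (z / 2))" by (rule order_ge_half_eval[OF rD]) simp
    hence "order_ge 1 (\<lambda>z. nome_eval discriminant (z / 2))" by simp
    from order_ge_cmult[OF this, of "1 / 2 ^ 12"] show ?thesis by simp
  qed
  have old1': "order_ge (- 1) (\<lambda>z. 1 / (nome_eval discriminant (z / 2) / 2 ^ 12))"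
  proof -
    have "order_ge (- 1 + 0) (\<lambda>z. nome (z / 2) powi (- 1) * (2 ^ 12 * exp (- 24 * nome_eval log_euler (z / 2))))"
      by (intro order_ge_mult order_ge_half_nome order_ge_euler_exps order_ge_cmult)
    hence "order_ge (- 1) (\<lambda>z. nome (z / 2) powi (- 1) * (2 ^ 12 * exp (- 24 * nome_eval log_euler (z / 2))))" by simp
    thus ?thesis by (rule order_ge_cong[rotated]) (simp add: Dhalf exp_minus power_int_minus field_simps)
  qed
  have old0': "order_ge (- 4) (\<lambda>z. 1 / nome_eval discriminant (2 * z))"
  proof -
    have "order_ge (- 4 + 0) (\<lambda>z. nome (z / 2) powi (- 4) * exp (- 24 * nome_eval log_euler (2 * z)))"
      by (intro order_ge_mult order_ge_half_nome order_ge_euler_exps)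
    hence "order_ge (- 4) (\<lambda>z. nome (z / 2) powi (- 4) * exp (- 24 * nome_eval log_euler (2 * z)))" by simp
    moreover have "nome (2 * z) = nome (z / 2) ^ 4" for z using nome_mult_of_nat[of 4 "z / 2"] by simp
    ultimately show ?thesis
      by (elim order_ge_cong[rotated]) (simp add: nome_eval_discriminant exp_minus power_int_minus field_simps)
  qed
  have oldnz: "old_family 12 discriminant c d z \<noteq> 0" if "(c, d) \<in> cusp_indices" "Im z > 0" for c d z
    using that discriminant_nonzero[of "2 * z"] discriminant_nonzero[of "z / 2"] discriminant_nonzero[of "(z + 1) / 2"]
    by (auto simp: cusp_indices_iff old_family_def)
  have old_ord: "order_ge 1 (old_family 12 discriminant 1 0)" "order_ge 1 (old_family 12 discriminant 1 1)"
    "order_ge (- 1) (\<lambda>z. 1 / old_family 12 discriminant 1 0 z)" "order_ge (- 1) (\<lambda>z. 1 / old_family 12 discriminant 1 1 z)"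
    "order_ge (- 4) (\<lambda>z. 1 / old_family 12 discriminant 0 1 z)"
    using old1 old1' old0' order_ge_shift[OF old1] order_ge_shift[OF old1'] by (simp_all add: old_family_def)
  have E4_ord: "order_ge 0 (nome_eval E4)" using order_ge_nome_eval[OF r4, of 0] by simp
  have D_ord: "order_ge 2 (nome_eval discriminant)" using order_ge_nome_eval[OF rD, of 1] by simp
  have cusp1: "order_ge 1 (h c d)" if "order_ge 1 (phi_family c d)" "order_ge 1 (old_family 12 discriminant c d)" for c d
    unfolding h_def [abs_def]
    using order_ge_mult[OF E4_ord that(1)] that(2) order_ge_mono[OF D_ord, of 1]
    by (intro order_ge_diff order_ge_cmult) auto
  have h10: "order_ge 1 (h 1 0)" "order_ge 1 (h 1 1)"
    using order_ge_phi_cusp order_ge_shift[OF order_ge_phi_cusp] old_ord by (intro cusp1; simp add: phi_family_def)+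
  define G where "G = (E4 * phi_series - discriminant) - fps_const 256 * fps_stretch 2 discriminant"
  have rG: "fps_conv_radius G \<ge> 1" unfolding G_def
    by (intro conv_radius_diff_ge_1 conv_radius_mult_ge_1 conv_radius_const_mult conv_radius_stretch conv_radius_phi rD r4) simp
  have hG: "h 0 1 z = nome_eval G z" if "Im z > 0" for z
    unfolding G_def using that
    by (simp add: h_def phi_family_def old_family_def nome_eval_diff nome_eval_mult nome_eval_cmult nome_eval_stretch
        conv_radius_diff_ge_1 conv_radius_mult_ge_1 conv_radius_const_mult conv_radius_stretch conv_radius_phi rD r4)
  \<comment> \<open>Vanishing at q^0, q^1, q^2 gives order 6 in q^(1/2), which matches the zero of
    \<open>r\<close> at infinity.\<close>
  have G0: "fps_nth G i = 0" if "i < 3" for i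
  proof -
    have "i = 0 \<or> i = Suc 0 \<or> i = 2" using that by presburger
    thus ?thesis by (auto simp: G_def nth_mult fps_stretch_def phi_values discriminant_values)
  qed
  have "order_ge (2 * int 3) (nome_eval G)" by (rule order_ge_nome_eval[OF rG G0])
  hence h01: "order_ge 6 (h 0 1)" using hG by (simp add: order_ge_def)
  have r_ord: "order_ge (2 - 2 * m) (\<lambda>z. 1 / r c d z)" if "order_ge (- m) (\<lambda>z. 1 / old_family 12 discriminant c d z)" for c d m
  proof -
    have "order_ge (2 + int 2 * (- m)) (\<lambda>z. nome_eval discriminant z * (1 / old_family 12 discriminant c d z) ^ 2)"
      by (intro order_ge_mult D_ord order_ge_power that)
    hence "order_ge (2 - 2 * m) (\<lambda>z. nome_eval discriminant z * (1 / old_family 12 discriminant c d z) ^ 2)" by simp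
    thus ?thesis by (rule order_ge_cong[rotated]) (simp add: r_def power_divide)
  qed
  have r_ords: "order_ge (- 6) (\<lambda>z. 1 / r 0 1 z)" "order_ge 0 (\<lambda>z. 1 / r 1 0 z)" "order_ge 0 (\<lambda>z. 1 / r 1 1 z)"
    using r_ord[of 4 0 1] r_ord[of 1 1 0] r_ord[of 1 1 1] old_ord by simp_all
  have rnz: "r c d z \<noteq> 0" if "(c, d) \<in> cusp_indices" "Im z > 0" for c d z
    using oldnz[OF that] discriminant_nonzero[OF that(2)] by (simp add: r_def)
  have "\<exists>C. \<forall>(c, d)\<in>cusp_indices. \<forall>z. Im z > 0 \<longrightarrow> h c d z = C * r c d z"
  proof (rule modular_family_proportional[OF h r, where m = "\<lambda>c d. if c = 0 then 6 else 0"])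
    fix c d :: int assume cd: "(c, d) \<in> cusp_indices"
    show "order_ge (if c = 0 then 6 else 0) (h c d)"
      using cd h01 order_ge_mono[OF h10(1), of 0] order_ge_mono[OF h10(2), of 0] by (auto simp: cusp_indices_iff)
    show "order_ge (- (if c = 0 then 6 else 0)) (\<lambda>z. 1 / r c d z)"
      using cd r_ords by (auto simp: cusp_indices_iff)
    show "r c d z \<noteq> 0" if "Im z > 0" for z by (rule rnz[OF cd that])
  qed
  then obtain C where C: "\<forall>(c, d)\<in>cusp_indices. \<forall>z. Im z > 0 \<longrightarrow> h c d z = C * r c d z" by blast
  have "(1, 0) \<in> cusp_indices" "(0, 1) \<in> cusp_indices" by (simp_all add: cusp_indices_iff)
  note C10 = bspec[OF C this(1), simplified] and C01 = bspec[OF C this(2), simplified]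
    and nz10 = rnz[OF this(1)]
  \<comment> \<open>At the cusp 0 the form \<open>h\<close> vanishes but \<open>r\<close> does not,
    so the constant is 0.\<close>
  have "order_ge (1 + 0) (\<lambda>z. h 1 0 z * (1 / r 1 0 z))" by (intro order_ge_mult h10 r_ords)
  hence "order_ge 1 (\<lambda>z. h 1 0 z * (1 / r 1 0 z))" by simp
  hence "C = 0" by (rule order_ge_pos_const) (use C10 nz10 in simp)
  hence "nome_eval G z = 0" if "Im z > 0" for z using C01 hG[OF that] that by simp
  hence "G = 0" by (rule fps_eq_0_if_nome_eval[OF rG])
  thus ?thesis by (simp add: G_def diff_diff_eq)
qed

section \<open>Multiplicativity of the six series and of their products with E_4\<close>

lemma multiplicative_cusp:
  assumes "modular_series k F" "fps_nth F 0 = 0" "fps_nth F (Suc 0) = 1" "0 < k" "k < 24 \<or> k = 26"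
  shows "multiplicative_fps F"
  by (rule multiplicative_if_unique[of k])
     (use assms in \<open>auto intro: cusp_series_unique cusp_series_unique_26\<close>)

lemma multiplicative_eisenstein:
  assumes "modular_series k F" "fps_nth F 1 = 1" "0 < k" "k < 12"
  shows "multiplicative_fps F"
  by (rule multiplicative_if_hecke[of _ k])
     (use assms hecke_eigenform_eisenstein[OF assms(1,3,4)] in auto)

lemma multiplicative_theta: "multiplicative_fps F \<Longrightarrow> multiplicative_fps (theta F)"
  by (simp add: multiplicative_fps_def)

text \<open>Adding 256 Delta(2z) to Delta changes only how coefficients depend on the power of 2 in
  the index, and of two coprime numbers one is odd.\<close>

lemma multiplicative_E4_phi: "multiplicative_fps (E4 * phi_series)"
proof -
  define A where "A = E4 * phi_series"
  have D: "multiplicative_fps discriminant"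
    by (rule multiplicative_cusp[OF modular_series_discriminant]) auto
  have a: "fps_nth A n = fps_nth discriminant n + (if even n then 256 * fps_nth discriminant (n div 2) else 0)" for n
    by (simp add: A_def E4_mult_phi fps_stretch_def)
  have main: "fps_nth A (m * n) = fps_nth A m * fps_nth A n"
    if "m > 0" "n > 0" "coprime m n" "odd m" for m n
  proof (cases "even n")
    case True
    then obtain l where l: "n = 2 * l" by auto
    have "coprime m l" "l > 0" using that l by auto
    hence "fps_nth discriminant (m * l) = fps_nth discriminant m * fps_nth discriminant l"
      "fps_nth discriminant (m * n) = fps_nth discriminant m * fps_nth discriminant n"
      using D that by (auto simp: multiplicative_fps_def)
    moreover have "m * n div 2 = m * l" "n div 2 = l" using l by auto
    ultimately show ?thesis using that True by (simp add: a algebra_simps)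
  next
    case False
    thus ?thesis using D that by (simp add: a multiplicative_fps_def)
  qed
  have "fps_nth A 1 = 1" by (simp add: a)
  moreover have "fps_nth A (m * n) = fps_nth A m * fps_nth A n"
    if "m > 0" "n > 0" "coprime m n" for m n
  proof (cases "odd m")
    case False
    hence "odd n" using that(3) by (metis coprime_common_divisor odd_one)
    from main[OF that(2,1) _ this] that(3) show ?thesis by (simp add: mult_ac coprime_commute)
  qed (use main that in blast)
  ultimately show ?thesis unfolding multiplicative_fps_def A_def by blast
qed

lemma E4_deriv_series_eq: "E4_deriv_series = theta (fps_const (1 / 240) * E4)"
  unfolding E4_deriv_series_def
proof (rule q_expansion_eqI)
  note r4 = modular_seriesD(2)[OF modular_series_E4]
  have eq: "theta (fps_const (1 / 240) * E4) = fps_const (1 / 240) * theta E4"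
    by (rule fps_ext) simp
  have r: "fps_conv_radius (theta (fps_const (1 / 240) * E4)) \<ge> 1"
    by (intro conv_radius_theta conv_radius_const_mult r4)
  have "1 / (480 * of_real pi * \<i>) * deriv (\<lambda>w. eval_fps E4 (nome w)) z = nome_eval (theta (fps_const (1 / 240) * E4)) z"
    if z: "Im z > 0" for z
  proof -
    have "deriv (nome_eval E4) z = 2 * of_real pi * \<i> * nome_eval (theta E4) z"
      by (rule DERIV_imp_deriv[OF nome_eval_has_derivative[OF r4 z]])
    hence "deriv (\<lambda>w. eval_fps E4 (nome w)) z = 2 * of_real pi * \<i> * nome_eval (theta E4) z"
      by (simp add: nome_eval_def [abs_def])
    moreover have "nome_eval (fps_const (1 / 240) * theta E4) z = 1 / 240 * nome_eval (theta E4) z"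
      by (rule nome_eval_cmult[OF conv_radius_theta[OF r4] z])
    ultimately show ?thesis unfolding eq by simp
  qed
  thus "has_q_expansion (\<lambda>z. 1 / (480 * of_real pi * \<i>) * deriv (\<lambda>w. eval_fps E4 (nome w)) z) (theta (fps_const (1 / 240) * E4))"
    using has_q_expansion_nome_eval[OF r] by (simp add: has_q_expansion_def upper_half_plane_def)
qed

text \<open>Multiplication by E_4 takes the weights 12, 16, 18, 22 to 16, 20, 22, 26, in each of
  which a normalized cusp form is unique.\<close>

lemma modular_products:
  "modular_series 16 (E4 * discriminant)" "modular_series 18 (E6 * discriminant)"
  "modular_series 20 (E4 * (E4 * discriminant))" "modular_series 22 (E4 * (E6 * discriminant))"
  "modular_series 26 (E4 * (E4 * (E6 * discriminant)))"
proof -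
  note D = modular_series_discriminant and E4 = modular_series_E4 and E6 = modular_series_E6
  show 16: "modular_series 16 (E4 * discriminant)" using modular_series_mult[OF E4 D] by simp
  show 18: "modular_series 18 (E6 * discriminant)" using modular_series_mult[OF E6 D] by simp
  show "modular_series 20 (E4 * (E4 * discriminant))" using modular_series_mult[OF E4 16] by simp
  show 22: "modular_series 22 (E4 * (E6 * discriminant))" using modular_series_mult[OF E4 18] by simp
  show "modular_series 26 (E4 * (E4 * (E6 * discriminant)))" using modular_series_mult[OF E4 22] by simp
qed

lemma Delta_eqs:
  "Delta 12 = discriminant" "Delta 16 = E4 * discriminant" "Delta 18 = E6 * discriminant" "Delta 22 = E4 * (E6 * discriminant)"
  using modular_products modular_series_discriminant by (auto intro!: Delta_eqI simp: nth_mult)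

definition six_series :: "complex fps set" where
  "six_series = {discriminant, E4 * discriminant, E6 * discriminant, E4 * (E6 * discriminant), phi_series,
     theta (fps_const (1 / 240) * E4)}"

lemma twin_multiplicative_six: "g \<in> six_series \<Longrightarrow> twin_multiplicative g"
proof -
  have "multiplicative_fps discriminant" "multiplicative_fps (E4 * discriminant)" "multiplicative_fps (E6 * discriminant)"
    "multiplicative_fps (E4 * (E6 * discriminant))" "multiplicative_fps (E4 * (E4 * discriminant))"
    "multiplicative_fps (E4 * (E4 * (E6 * discriminant)))"
    by (rule multiplicative_cusp[OF modular_series_discriminant] multiplicative_cusp[OF modular_products(1)]
        multiplicative_cusp[OF modular_products(2)] multiplicative_cusp[OF modular_products(3)]
        multiplicative_cusp[OF modular_products(4)] multiplicative_cusp[OF modular_products(5)];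
        simp add: nth_mult)+
  moreover have "multiplicative_fps (theta (fps_const (1 / 240) * E4))"
    by (intro multiplicative_theta multiplicative_eisenstein[OF modular_series_cmult[OF modular_series_E4]]) auto
  \<comment> \<open>E_4 times its derivative is half the derivative of E_4^2, an eigenform of weight
    8.\<close>
  moreover have "multiplicative_fps (E4 * theta (fps_const (1 / 240) * E4))"
  proof -
    have "modular_series 8 (E4 * E4)" using modular_series_mult[OF modular_series_E4 modular_series_E4] by simp
    hence "multiplicative_fps (theta (fps_const (1 / 480) * (E4 * E4)))"
      by (intro multiplicative_theta multiplicative_eisenstein[OF modular_series_cmult]) (auto simp: nth_mult)
    moreover have "theta (fps_const (1 / 480) * (E4 * E4)) = E4 * theta (fps_const (1 / 240) * E4)"
    proof -
      have "theta (fps_const (1 / 480) * (E4 * E4)) = (fps_const (1 / 480) + fps_const (1 / 480)) * (E4 * theta E4)"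
        by (simp add: theta_def algebra_simps)
      also have "fps_const (1 / 480) + fps_const (1 / 480) = (fps_const (1 / 240) :: complex fps)" by simp
      finally show ?thesis by (simp add: theta_def algebra_simps)
    qed
    ultimately show ?thesis by simp
  qed
  ultimately show "g \<in> six_series \<Longrightarrow> twin_multiplicative g"
    using multiplicative_phi multiplicative_E4_phi by (auto simp: six_series_def twin_multiplicative_def)
qed

lemma six_series_nth_2: "(\<lambda>g. fps_nth g 2) ` six_series = {- 24, 216, - 528, - 288, - 8, 18}"
  by (simp add: six_series_def nth_mult discriminant_values phi_values E4_values E6_values)

subsection \<open>Every solution is determined by its first coefficients\<close>

definition decomposable :: "nat \<Rightarrow> bool" where
  "decomposable N \<longleftrightarrow> (\<exists>a c. 1 < a \<and> 1 < c \<and> coprime a c \<and> N = a * c)"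

lemma decomposableI: "1 < a \<Longrightarrow> 1 < c \<Longrightarrow> coprime a c \<Longrightarrow> N = a * c \<Longrightarrow> decomposable N"
  by (auto simp: decomposable_def)

lemma prime_power_if_not_decomposable:
  assumes "\<not> decomposable N" "N > 0" "prime q" "q dvd N"
  shows "\<exists>r. N = q ^ r"
proof -
  obtain m where m: "N = q ^ multiplicity q N * m" "\<not> q dvd m"
    using multiplicity_decompose'[of N q] assms by (auto simp: prime_nat_iff)
  define r where "r = multiplicity q N"
  have N: "N = q ^ r * m" unfolding r_def by (rule m(1))
  have r: "r \<noteq> 0"
  proof
    assume "r = 0"
    hence "N = m" using N by simp
    thus False using assms(4) m(2) by blast
  qed
  have "m = 1"
  proof (rule ccontr)
    assume "m \<noteq> 1"
    moreover have "m \<noteq> 0" using N assms(2) by (intro notI) simp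
    ultimately have "1 < m" by simp
    moreover have "1 < q ^ r" using one_less_power[OF prime_gt_1_nat[OF assms(3)]] r by simp
    moreover have "coprime (q ^ r) m" using assms(3) m(2) by (simp add: prime_imp_coprime)
    ultimately show False using assms(1) N decomposableI by blast
  qed
  thus ?thesis using N by auto
qed

lemma power_3_mod_8: "(3::nat) ^ a mod 8 = 1 \<or> (3::nat) ^ a mod 8 = 3"
proof (induction a)
  case (Suc a)
  have "(3::nat) ^ Suc a mod 8 = 3 * (3 ^ a mod 8) mod 8" by (simp add: mod_mult_right_eq)
  thus ?case using Suc by auto
qed auto

text \<open>Modulo 16 the equation forces 4 to divide a; then 3^a is 1 modulo 5, so 5 would divide
  2^k. The exceptions 2 + 1 = 3 and 8 + 1 = 9 lie below the bound on k.\<close>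

lemma power_2_plus_1_not_power_3:
  assumes "k \<ge> 4"
  shows "(2::nat) ^ k + 1 \<noteq> 3 ^ a"
proof
  assume eq: "(2::nat) ^ k + 1 = 3 ^ a"
  define b where "b = a div 4"
  have a: "a = 4 * b + a mod 4" by (simp add: b_def)
  obtain l where l: "k = 4 + l" using assms le_Suc_ex by blast
  have "(3::nat) ^ a mod 16 = (16 * 2 ^ l + 1) mod 16" unfolding eq[symmetric] l by (simp add: power_add)
  also have "\<dots> = 1" by (simp add: mod_Suc)
  finally have m1: "(3::nat) ^ a mod 16 = 1" .
  have 81: "(81::nat) ^ b mod 16 = 1" "(81::nat) ^ b mod 5 = 1"
  proof -
    have "(81::nat) ^ b mod 16 = (81 mod 16) ^ b mod 16" "(81::nat) ^ b mod 5 = (81 mod 5) ^ b mod 5"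
      by (rule power_mod[symmetric])+
    thus "(81::nat) ^ b mod 16 = 1" "(81::nat) ^ b mod 5 = 1" by simp_all
  qed
  have e: "(3::nat) ^ a = 81 ^ b * 3 ^ (a mod 4)" by (subst a) (simp add: power_add power_mult)
  have "(3::nat) ^ a mod 16 = 3 ^ (a mod 4) mod 16"
    unfolding e using mod_mult_left_eq[of "(81::nat) ^ b" 16 "3 ^ (a mod 4)"] 81 by simp
  moreover have "a mod 4 = 0 \<or> a mod 4 = 1 \<or> a mod 4 = 2 \<or> a mod 4 = 3" by presburger
  moreover have "r = 0" if "(3::nat) ^ r mod 16 = 1" "r = 0 \<or> r = 1 \<or> r = 2 \<or> r = 3" for r :: nat
    using that(2,1) by (elim disjE) simp_all
  ultimately have "a mod 4 = 0" using m1 by metis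
  hence "(3::nat) ^ a mod 5 = 1" unfolding e using 81 by simp
  hence "5 dvd (2::nat) ^ k" using eq by presburger
  hence "5 dvd (2::nat)" using prime_dvd_power[of "5::nat" 2 k] by simp
  thus False by simp
qed

text \<open>Powers of 3 are 1 or 3 modulo 8, whereas 2^k - 1 and 2^k + 5 are 7 and 5.\<close>

lemma power_2_minus_1_not_power_3:
  assumes "k \<ge> 4"
  shows "(2::nat) ^ k \<noteq> 3 ^ a + 1" "(2::nat) ^ k + 5 \<noteq> 3 ^ a"
proof -
  obtain l where l: "k = 3 + l" using assms le_Suc_ex[of 3 k] by auto
  have k: "(2::nat) ^ k = 8 * 2 ^ l" by (simp add: l power_add)
  show "(2::nat) ^ k \<noteq> 3 ^ a + 1"
  proof
    assume "(2::nat) ^ k = 3 ^ a + 1"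
    hence "Suc (3 ^ a) mod 8 = 0" using k by (metis Suc_eq_plus1 mod_mult_self1_is_0)
    thus False using power_3_mod_8[of a] by (auto simp: mod_Suc)
  qed
  show "(2::nat) ^ k + 5 \<noteq> 3 ^ a"
  proof
    assume "(2::nat) ^ k + 5 = 3 ^ a"
    hence "(3::nat) ^ a mod 8 = (8 * 2 ^ l + 5) mod 8" using k by simp
    thus False using power_3_mod_8[of a] by simp
  qed
qed

text \<open>For n = 2^k one of n + 1, n + 5 is divisible by 3, and for n + 1 = 2^k one of n, n + 2.
  If that number were not decomposable, it would be a power of 3, which the two preceding lemmas
  exclude.\<close>

lemma three_dvd_power_2: "3 dvd (2::nat) ^ k + 1 \<or> (3 dvd (2::nat) ^ k + 2 \<and> 3 dvd (2::nat) ^ k + 5)"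
proof -
  have "(2::nat) ^ k mod 3 = 1 \<or> (2::nat) ^ k mod 3 = 2"
  proof (induction k)
    case (Suc k)
    have "(2::nat) ^ Suc k mod 3 = 2 * (2 ^ k mod 3) mod 3" by (simp add: mod_mult_right_eq)
    thus ?case using Suc by auto
  qed auto
  thus ?thesis by presburger
qed

lemma sum_short_interval:
  fixes f :: "nat \<Rightarrow> complex"
  shows "(\<Sum>j=n..<n + 2. f j) = f n + f (n + 1)" "(\<Sum>j=n..<n + 3. f j) = f n + f (n + 1) + f (n + 2)"
    "(\<Sum>j=n..<n + 4. f j) = f n + f (n + 1) + f (n + 2) + f (n + 3)"
    "(\<Sum>j=n..<n + 5. f j) = f n + f (n + 1) + f (n + 2) + f (n + 3) + f (n + 4)"
  by (simp_all add: eval_nat_numeral)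

text \<open>If neither \<open>n\<close> nor \<open>n + 1\<close> is a product of coprime factors, then one of them is a power of 2. In this case
  the relations at the next two or three such products are linear equations for the differences of the coefficients from \<open>n\<close> on,
  and have only the zero solution.\<close>

theorem twin_multiplicative_eqI:
  assumes g: "twin_multiplicative g" and h: "twin_multiplicative h"
    and base: "\<And>n. n \<in> {2, 3, 4, 7, 8} \<Longrightarrow> fps_nth g n = fps_nth h n"
  shows "g = h"
proof (rule fps_ext)
  define e where "e n = fps_nth g n - fps_nth h n" for n
  \<comment> \<open>N < 2 n forces both factors below n.\<close>
  have mult: "e N = 0" if "decomposable N" "\<And>j. j < n \<Longrightarrow> e j = 0" "N < 2 * n" for N n
  proof -
    from that(1) obtain a c where ac: "1 < a" "1 < c" "coprime a c" "N = a * c"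
      unfolding decomposable_def by blast
    have "2 * a \<le> N" "2 * c \<le> N" using ac by (auto simp: mult.commute[of a])
    hence "e a = 0" "e c = 0" using that by auto
    thus ?thesis using g h ac by (simp add: e_def twin_multiplicative_def multiplicative_fps_def)
  qed
  \<comment> \<open>Both factors lie below n, so the right side of the relation is the same for
    \<open>g\<close> and \<open>h\<close>; the difference of the left sides is a linear equation in
    \<open>e n\<close>, ..., \<open>e (N - 1)\<close>.\<close>
  have conv: "(\<Sum>j=n..<N. of_nat (divisor_sigma 3 (N - j)) * e j) = 0"
    if "decomposable N" "\<And>j. j < n \<Longrightarrow> e j = 0" "N < 2 * n" "0 < n" "n \<le> N" for N n
  proof -
    from that(1) obtain a c where ac: "1 < a" "1 < c" "coprime a c" "N = a * c"
      unfolding decomposable_def by blast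
    have le: "2 * a \<le> N" "2 * c \<le> N" using ac by (auto simp: mult.commute[of a])
    have s: "sigma_conv g m = sigma_conv h m" if "m \<le> n" for m
      unfolding sigma_conv_def by (rule sum.cong) (use that \<open>\<And>j. j < n \<Longrightarrow> e j = 0\<close> in \<open>auto simp: e_def\<close>)
    have "fps_nth g a = fps_nth h a" "fps_nth g c = fps_nth h c" "sigma_conv g a = sigma_conv h a" "sigma_conv g c = sigma_conv h c"
      using le that s by (auto simp: e_def)
    hence "sigma_conv g N = sigma_conv h N"
      using sigma_conv_mult[OF g, of a c] sigma_conv_mult[OF h, of a c] ac by simp
    hence "0 = (\<Sum>j=1..<N. of_nat (divisor_sigma 3 (N - j)) * e j)"
      by (simp add: sigma_conv_def e_def right_diff_distrib sum_subtractf)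
    also have "\<dots> = (\<Sum>j=n..<N. of_nat (divisor_sigma 3 (N - j)) * e j)"
      by (rule sum.mono_neutral_right) (use that in auto)
    finally show ?thesis by simp
  qed
  fix n
  have "e n = 0"
  proof (induction n rule: less_induct)
    case (less n)
    have e01: "e 0 = 0" "e 1 = 0" using g h by (auto simp: e_def twin_multiplicative_def multiplicative_fps_def)
    have succ: "e n = 0" if "decomposable (n + 1)" "n > 1"
    proof -
      have "(\<Sum>j=n..<n + 1. of_nat (divisor_sigma 3 (n + 1 - j)) * e j) = 0"
        by (rule conv[OF that(1) less.IH]) (use that(2) in auto)
      thus ?thesis by simp
    qed
    consider "n \<le> 1" | "n = 2 \<or> n = 3 \<or> n = 4 \<or> n = 7 \<or> n = 8" | "n = 5" | "n = 6" | "n \<ge> 9"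
      by linarith
    thus ?case
    proof cases
      case 1
      thus ?thesis using e01 by (cases n) auto
    next
      case 2
      thus ?thesis using base by (auto simp: e_def)
    next
      case 3
      have "decomposable (n + 1)" by (rule decomposableI[of 2 3]) (use 3 in auto)
      thus ?thesis by (rule succ) (use 3 in simp)
    next
      case 4
      have "decomposable 6" by (rule decomposableI[of 2 3]) auto
      hence "decomposable n" using 4 by simp
      from mult[OF this less.IH] show ?thesis using 4 by simp
    next
      case 5
      show ?thesis
      proof (cases "decomposable n \<or> decomposable (n + 1)")
        case True
        thus ?thesis
        proof
          assume "decomposable n"
          from mult[OF this less.IH] show ?thesis using 5 by simp
        next
          assume "decomposable (n + 1)"
          thus ?thesis by (rule succ) (use 5 in simp)
        qed
      next
        case False
        \<comment> \<open>The bound 4 excludes 2^3 + 1 = 3^2, the coincidence because of which b_7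
          and b_8 belong to the assumed coefficients.\<close>
        have large: "k \<ge> 4" if "(2::nat) ^ k \<ge> 9" for k
        proof (rule ccontr)
          assume "\<not> k \<ge> 4"
          hence "(2::nat) ^ k \<le> 2 ^ 3" by (intro power_increasing) auto
          thus False using that by simp
        qed
        show ?thesis
        proof (cases "even n")
          case False
          hence "2 dvd n + 1" by simp
          then obtain k where k: "n + 1 = 2 ^ k"
            using prime_power_if_not_decomposable[of "n + 1" 2] \<open>\<not> (decomposable n \<or> decomposable (n + 1))\<close> by auto
          have k4: "k \<ge> 4" using 5 k large[of k] by simp
          then obtain l where l: "k = Suc l" by (cases k) auto
          have n0: "n = 2 ^ k - 1" using k by simp
          have d2: "decomposable (n + 2)"
          proof (rule ccontr)
            assume nd: "\<not> decomposable (n + 2)"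
            have "3 dvd n \<or> 3 dvd n + 2"
              using three_dvd_power_2[of k] unfolding k[symmetric] by presburger
            thus False
            proof
              assume "3 dvd n"
              then obtain a where "n = 3 ^ a"
                using prime_power_if_not_decomposable[of n 3] 5 \<open>\<not> (decomposable n \<or> decomposable (n + 1))\<close> by auto
              thus False using k power_2_minus_1_not_power_3(1)[OF k4, of a] by simp
            next
              assume "3 dvd n + 2"
              then obtain a where "n + 2 = 3 ^ a" using prime_power_if_not_decomposable[of "n + 2" 3] nd by auto
              thus False using k power_2_plus_1_not_power_3[OF k4, of a] by simp
            qed
          qed
          have d3: "decomposable (n + 3)"
          proof (rule decomposableI[of 2 "2 ^ l + 1"])
            show "n + 3 = 2 * (2 ^ l + 1)" using k by (simp add: l)
            show "coprime 2 ((2::nat) ^ l + 1)" using k4 l by simp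
          qed auto
          have "(\<Sum>j=n..<n + 2. of_nat (divisor_sigma 3 (n + 2 - j)) * e j) = 0" by (rule conv[OF d2 less.IH]) (use 5 in auto)
          hence 1: "e (n + 1) + 9 * e n = 0"
            unfolding sum_short_interval by (simp add: divisor_sigma_values algebra_simps)
          have "(\<Sum>j=n..<n + 3. of_nat (divisor_sigma 3 (n + 3 - j)) * e j) = 0" by (rule conv[OF d3 less.IH]) (use 5 in auto)
          moreover have "e (n + 2) = 0" by (rule mult[OF d2 less.IH]) (use 5 in auto)
          ultimately have 2: "9 * e (n + 1) + 28 * e n = 0"
            unfolding sum_short_interval by (simp add: divisor_sigma_values algebra_simps)
          \<comment> \<open>Elimination leaves (28 - 81) \<open>e n\<close> = 0.\<close>
          from 1 have "e (n + 1) = - 9 * e n" by (simp add: eq_neg_iff_add_eq_0)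
          thus ?thesis using 2 by simp
        next
          case True
          then obtain k where k: "n = 2 ^ k"
            using prime_power_if_not_decomposable[of n 2] \<open>\<not> (decomposable n \<or> decomposable (n + 1))\<close> 5 by auto
          have k4: "k \<ge> 4" using 5 k large[of k] by simp
          define l where "l = k - 2"
          have l: "k = Suc (Suc l)" "l \<noteq> 0" using k4 by (auto simp: l_def)
          have d2: "decomposable (n + 2)"
            by (rule decomposableI[of 2 "2 ^ Suc l + 1"]) (auto simp: k l)
          have d4: "decomposable (n + 4)"
          proof (rule decomposableI[of 4 "2 ^ l + 1"])
            have "coprime (2 ^ 2) ((2::nat) ^ l + 1)" using l by (subst coprime_power_left_iff) simp
            thus "coprime 4 ((2::nat) ^ l + 1)" by simp
          qed (auto simp: k l)
          have d5: "decomposable (n + 5)"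
          proof (rule ccontr)
            assume nd: "\<not> decomposable (n + 5)"
            from three_dvd_power_2[of k] show False
            proof
              assume "3 dvd 2 ^ k + (1::nat)"
              then obtain a where "2 ^ k + (1::nat) = 3 ^ a"
                using prime_power_if_not_decomposable[of "2 ^ k + 1" 3] k \<open>\<not> (decomposable n \<or> decomposable (n + 1))\<close> by auto
              thus False using power_2_plus_1_not_power_3[OF k4, of a] by simp
            next
              assume "3 dvd 2 ^ k + (2::nat) \<and> 3 dvd 2 ^ k + (5::nat)"
              then obtain a where "2 ^ k + (5::nat) = 3 ^ a"
                using prime_power_if_not_decomposable[of "2 ^ k + 5" 3] k nd by auto
              thus False using power_2_minus_1_not_power_3(2)[OF k4, of a] by simp
            qed
          qed
          have z2: "e (n + 2) = 0" by (rule mult[OF d2 less.IH]) (use 5 in auto)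
          have z4: "e (n + 4) = 0" by (rule mult[OF d4 less.IH]) (use 5 in auto)
          note z = z2 z4
          have "(\<Sum>j=n..<n + 2. of_nat (divisor_sigma 3 (n + 2 - j)) * e j) = 0" by (rule conv[OF d2 less.IH]) (use 5 in auto)
          hence 1: "e (n + 1) + 9 * e n = 0"
            unfolding sum_short_interval by (simp add: divisor_sigma_values algebra_simps)
          have "(\<Sum>j=n..<n + 4. of_nat (divisor_sigma 3 (n + 4 - j)) * e j) = 0" by (rule conv[OF d4 less.IH]) (use 5 in auto)
          hence 2: "e (n + 3) + 28 * e (n + 1) + 73 * e n = 0" using z
            unfolding sum_short_interval by (simp add: divisor_sigma_values algebra_simps)
          have "(\<Sum>j=n..<n + 5. of_nat (divisor_sigma 3 (n + 5 - j)) * e j) = 0" by (rule conv[OF d5 less.IH]) (use 5 in auto)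
          hence 3: "9 * e (n + 3) + 73 * e (n + 1) + 126 * e n = 0" using z
            unfolding sum_short_interval by (simp add: divisor_sigma_values algebra_simps)
          \<comment> \<open>Elimination leaves (9 * 179 - 9 * 73 + 126) \<open>e n\<close> = 1080
            \<open>e n\<close> = 0.\<close>
          from 1 have y: "e (n + 1) = - 9 * e n" by (simp add: eq_neg_iff_add_eq_0)
          from 2 have "e (n + 3) = 179 * e n" unfolding y by (simp add: add_eq_0_iff)
          thus ?thesis using 3 unfolding y by simp
        qed
      qed
    qed
  qed
  thus "fps_nth g n = fps_nth h n" by (simp add: e_def)
qed

section \<open>The classification of the solutions\<close>

lemma represents_powers_of_two:
  "represents f P \<Longrightarrow> list_all (\<lambda>(k, c). k \<in> set [1, 2, 4, 8, 16, 32]) P \<Longrightarrow>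
     \<exists>q. degree q < 6 \<and> (\<forall>g. twin_multiplicative g \<longrightarrow> f g = poly q (fps_nth g 2))"
proof (induction P arbitrary: f)
  case Nil
  thus ?case by (intro exI[of _ 0]) auto
next
  case (Cons x P)
  obtain k c where x: "x = (k, c)" by force
  from Cons.prems obtain r where r: "represents (\<lambda>g. f g - r * coeff_monomial g k) P" by (auto simp: x)
  from Cons.IH[OF r] Cons.prems(2) obtain q where q: "degree q < 6"
    "\<And>g. twin_multiplicative g \<Longrightarrow> f g - r * coeff_monomial g k = poly q (fps_nth g 2)" by auto
  have k: "k \<in> {2 ^ 0, 2 ^ 1, 2 ^ 2, 2 ^ 3, 2 ^ 4, 2 ^ 5}" using Cons.prems(2) by (auto simp: x)
  then obtain i where i: "i < 6" "k = 2 ^ i" by (auto intro: that[of 0] that[of 1] that[of 2] that[of 3] that[of 4] that[of 5])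
  have two: "coeff_monomial g (2 ^ j) = fps_nth g 2 ^ j" for g j
  proof (induction j)
    case (Suc j)
    have "coeff_monomial g 2 = fps_nth g 2" using coeff_monomial_var[of 2 2 g] by (simp add: var_index_def)
    thus ?case using Suc coeff_monomial_mult[of 2 "2 ^ j" g] by simp
  qed (use coeff_monomial_1 in simp)
  have "degree (q + monom r i) < 6" using q(1) i(1) by (intro degree_add_less) (auto simp: degree_monom_eq intro: le_less_trans[OF degree_monom_le])
  moreover have "f g = poly (q + monom r i) (fps_nth g 2)" if "twin_multiplicative g" for g
    using q(2)[OF that] by (simp add: i two poly_monom algebra_simps)
  ultimately show ?case by blast
qed

lemma monomials_are_polynomials:
  assumes "m \<in> {64, 3, 5, 7, 11}"
  shows "\<exists>q. degree q < 6 \<and> (\<forall>g. twin_multiplicative g \<longrightarrow> coeff_monomial g m = poly q (fps_nth g 2))"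
proof -
  obtain bs rs where run: "elim_run sigma_residues (coeff_steps @ relation_steps @ multiply_steps) ([(1, [(1, 1)])], []) = Some (bs, rs)"
    and succ: "list_all (powers_of_two_only rs) [64, 3, 5, 7, 11]"
    using elimination_success unfolding elimination_succeeds_def by (auto split: option.splits)
  have "1 + length (coeff_steps @ relation_steps @ multiply_steps) \<le> length sigma_residues"
    by (simp add: coeff_steps_def relation_steps_def multiply_steps_def sigma_residues_def)
  from elim_run_sound[OF state_ok_initial sigma_table_residues this run]
  have "rules_ok rs" by (auto simp: state_ok_def)
  moreover have "powers_of_two_only rs m" using succ assms by auto
  then obtain R where R: "map_of rs m = Some R" "list_all (\<lambda>(k, c). k \<in> set [1, 2, 4, 8, 16, 32]) R"
    by (auto simp: powers_of_two_only_def split: option.splits)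
  ultimately have "represents (\<lambda>g. coeff_monomial g m) R"
    using map_of_SomeD[OF R(1)] by (auto simp: rules_ok_def)
  thus ?thesis using R(2) by (rule represents_powers_of_two)
qed

theorem twin_multiplicative_iff: "twin_multiplicative g \<longleftrightarrow> g \<in> six_series"
proof
  assume g: "twin_multiplicative g"
  obtain q where q: "degree q < 6" "\<And>g. twin_multiplicative g \<Longrightarrow> coeff_monomial g 64 = poly q (fps_nth g 2)"
    using monomials_are_polynomials[of 64] by auto
  have c64: "coeff_monomial g 64 = fps_nth g 2 ^ 6" for g
  proof -
    have "coeff_monomial g 2 = fps_nth g 2" using coeff_monomial_var[of 2 2 g] by (simp add: var_index_def)
    moreover have "coeff_monomial g 64 = coeff_monomial g 2 ^ 6"
      using coeff_monomial_mult[of 2 32 g] coeff_monomial_mult[of 2 16 g] coeff_monomial_mult[of 2 8 g]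
        coeff_monomial_mult[of 2 4 g] coeff_monomial_mult[of 2 2 g] by (simp add: eval_nat_numeral)
    ultimately show ?thesis by simp
  qed
  define p where "p = monom 1 6 - q"
  have dp: "degree p = 6" unfolding p_def diff_conv_add_uminus
    using q(1) by (subst degree_add_eq_left) (auto simp: degree_monom_eq)
  hence p0: "p \<noteq> 0" by auto
  have root: "poly p (fps_nth g 2) = 0" if "twin_multiplicative g" for g
    using q(2)[OF that] by (simp add: p_def poly_monom c64)
  let ?S = "{- 24, 216, - 528, - 288, - 8, 18} :: complex set"
  have sub: "?S \<subseteq> {x. poly p x = 0}"
    unfolding six_series_nth_2[symmetric] using root twin_multiplicative_six by auto
  have "card ?S = 6" by simp
  moreover have "card {x. poly p x = 0} \<le> 6" using card_poly_roots_bound[OF p0] dp by simp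
  ultimately have "?S = {x. poly p x = 0}"
    using sub poly_roots_finite[OF p0] by (intro card_seteq) auto
  hence "fps_nth g 2 \<in> (\<lambda>g. fps_nth g 2) ` six_series" unfolding six_series_nth_2 using root[OF g] by auto
  then obtain h where h: "h \<in> six_series" "fps_nth g 2 = fps_nth h 2" by auto
  note h' = twin_multiplicative_six[OF h(1)]
  have "g = h"
  proof (rule twin_multiplicative_eqI[OF g h'])
    fix n :: nat assume n: "n \<in> {2, 3, 4, 7, 8}"
    show "fps_nth g n = fps_nth h n"
    proof (cases "n = 2")
      case False
      hence "n = 3 \<or> n = 4 \<or> n = 7 \<or> n = 8" using n by auto
      hence "(3, int n) \<in> set var_index \<or> (5, int n) \<in> set var_index \<or> (7, int n) \<in> set var_index
          \<or> (11, int n) \<in> set var_index"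
        by (auto simp: var_index_def)
      then obtain m where m: "(m, int n) \<in> set var_index" "m \<in> {3, 5, 7, 11}" by blast
      obtain q where "\<And>g. twin_multiplicative g \<Longrightarrow> coeff_monomial g m = poly q (fps_nth g 2)"
        using monomials_are_polynomials[of m] m(2) by auto
      from this[OF g] this[OF h'] show ?thesis using coeff_monomial_var[OF m(1)] h(2) by simp
    qed (use h in simp)
  qed
  thus "g \<in> six_series" using h by simp
qed (rule twin_multiplicative_six)

theorem theorem1:
  shows "(\<forall>g :: complex fps. fps_nth g 0 = 0 \<longrightarrow> fps_nth g 1 = 1 \<longrightarrow>
            (multiplicative_fps g \<and> multiplicative_fps (E4 * g) \<longleftrightarrow>
             g \<in> {Delta 12, Delta 16, Delta 18, Delta 22, phi8, E4_deriv_series})) \<and>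
         (\<forall>k\<in>{12, 16, 18, 22}. \<forall>F. normalized_cusp_series 1 k F \<longleftrightarrow> F = Delta k) \<and>
         (\<forall>F. normalized_cusp_series 2 8 F \<longleftrightarrow> F = phi8) \<and>
         map (fps_nth (Delta 12)) [0..<6] = [0, 1, - 24, 252, - 1472, 4830] \<and>
         map (fps_nth (Delta 16)) [0..<6] = [0, 1, 216, - 3348, 13888, 52110] \<and>
         map (fps_nth (Delta 18)) [0..<6] = [0, 1, - 528, - 4284, 147712, - 1025850] \<and>
         map (fps_nth (Delta 22)) [0..<6] = [0, 1, - 288, - 128844, - 2014208, 21640950] \<and>
         map (fps_nth phi8) [0..<6] = [0, 1, - 8, 12, 64, - 210] \<and>
         map (fps_nth E4_deriv_series) [0..<6] = [0, 1, 18, 84, 292, 630]"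
proof -
  have six: "{Delta 12, Delta 16, Delta 18, Delta 22, phi8, E4_deriv_series} = six_series"
    by (simp add: six_series_def Delta_eqs phi8_eq E4_deriv_series_eq)
  have A: "\<forall>g :: complex fps. fps_nth g 0 = 0 \<longrightarrow> fps_nth g 1 = 1 \<longrightarrow>
      (multiplicative_fps g \<and> multiplicative_fps (E4 * g) \<longleftrightarrow>
       g \<in> {Delta 12, Delta 16, Delta 18, Delta 22, phi8, E4_deriv_series})"
    unfolding six using twin_multiplicative_iff by (auto simp: twin_multiplicative_def)
  have "normalized_cusp_series 1 12 F \<longleftrightarrow> F = Delta 12" "normalized_cusp_series 1 16 F \<longleftrightarrow> F = Delta 16"
    "normalized_cusp_series 1 18 F \<longleftrightarrow> F = Delta 18" "normalized_cusp_series 1 22 F \<longleftrightarrow> F = Delta 22" for F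
    unfolding Delta_eqs
    by (rule Delta_eqI(2); simp add: modular_products modular_series_discriminant nth_mult)+
  hence B: "\<forall>k\<in>{12, 16, 18, 22}. \<forall>F. normalized_cusp_series 1 k F \<longleftrightarrow> F = Delta k" by blast
  have C: "\<forall>F. normalized_cusp_series 2 8 F \<longleftrightarrow> F = phi8"
    unfolding phi8_eq using normalized_cusp_series_level_2_iff by blast
  have list: "[0..<6] = [0, Suc 0, 2, 3, 4, 5]" by (simp add: upt_rec)
  show ?thesis
    by (intro conjI A B C)
       (simp_all add: list Delta_eqs phi8_eq E4_deriv_series_eq nth_mult discriminant_values phi_values E4_values E6_values
          del: upt_Suc)
qed

end
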